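(* Let $\lambda>1$ be any absolute constant. Suppose there exists an efficient $\epsilon$-differentially private algorithm $\mathcal{A}$ for Uniform Facility Location on $\lambda$-HST metrics, under the super-set output setting, whose expected multiplicative approximation ratio is at most $\alpha_{\mathrm{tree}}(n,\epsilon)$ on $n$-point instances. Then there exists an efficient $\epsilon$-differentially private algorithm for Uniform Facility Location on general metrics, under the same setting, whose expected multiplicative approximation ratio is $O(\log n)\cdot \alpha_{\mathrm{tree}}(n,\epsilon)$.
   Context: Uniform Facility Location (UFL): an instance is a tuple $(V,d,f,\vec N)$, where $(V,d)$ is an $n$-point metric, $f\ge 0$ is the facility cost, and $\vec N=(N_v)_{v\in V}\in\mathbb{Z}_{\ge0}^V$ gives the number of clients at each location. The cost of $S\subseteq V$ is $\mathrm{cost}_d(S;\vec N)=|S|\cdot f+\sum_{v\in V}N_v\, d(v,S)$, where $d(v,S)=\min_{s\in S}d(v,s)$; the goal is to minimize it. Super-set output setting: the algorithm outputs a set $R$ of potential facility locations. Every client is connected to its nearest location in $R$ (with respect to a metric the algorithm specifies; in the general-metric case the algorithm may also output the tree metric used for connecting), and the set $S\subseteq R$ of actually opened facilities is the set of locations in $R$ with at least one connected client. The cost of the solution is the cost of $S$. Differential privacy: a randomized algorithm $\mathcal{A}$ taking $\vec N$ as input is $\epsilon$-DP if for all $\vec N,\vec N'\in\mathbb{Z}_{\ge0}^V$ with $\|\vec N-\vec N'\|_1=1$ and every event $\mathcal{T}$ in the output space, $\Pr[\mathcal{A}(\vec N)\in\mathcal{T}]\le e^{\epsilon}\Pr[\mathcal{A}(\vec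 N')\in\mathcal{T}]$. The (expected multiplicative) approximation ratio of $\mathcal{A}$ on an instance is $\mathbb{E}[\mathrm{cost}_d(\text{solution of }\mathcal{A};\vec N)]/\min_{S\subseteq V}\mathrm{cost}_d(S;\vec N)$, the expectation over the randomness of $\mathcal{A}$. $\lambda$-HST: for real $\lambda>1$ and integer $L\ge1$, a $\lambda$-hierarchically well-separated tree of depth $L$ is an edge-weighted rooted tree in which every root-to-leaf path has exactly $L$ edges, and, defining the level of a vertex $v$ to be $L$ minus the number of edges on the root-to-$v$ path, every edge between vertices of levels $\ell$ and $\ell+1$ has weight $\lambda^\ell$. A metric $(V,d)$ is a $\lambda$-HST metric if there is a $\lambda$-HST $T$ whose leaf set is $V$ and $d$ equals the shortest-path distance $d_T$ of $T$ restricted to $V$ (the tree $T$ is given with the metric). *)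

theory Defs
  imports "HOL-Probability.Probability" "HOL-Library.Landau_Symbols"
begin

section \<open>Uniform Facility Location\<close>

text \<open>
  The point set of an \<open>n\<close>-point instance is \<open>V = {..<n}\<close>. Costs are extended nonnegative reals:
  \<open>d(v, {}) = \<infinity>\<close>, so the empty set is a solution of finite cost exactly if there is no client
  (\<open>0 * \<infinity> = 0\<close>).
\<close>

definition dist_set :: "(nat \<Rightarrow> nat \<Rightarrow> real) \<Rightarrow> nat \<Rightarrow> nat set \<Rightarrow> ennreal" where
  "dist_set d v S = (INF s\<in>S. ennreal (d v s))"

definition ufl_cost :: "nat \<Rightarrow> (nat \<Rightarrow> nat \<Rightarrow> real) \<Rightarrow> real \<Rightarrow> (nat \<Rightarrow> nat) \<Rightarrow> nat set \<Rightarrow> ennreal" where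
  "ufl_cost n d f N S =
     of_nat (card S) * ennreal f + (\<Sum>v<n. of_nat (N v) * dist_set d v S)"

definition ufl_opt :: "nat \<Rightarrow> (nat \<Rightarrow> nat \<Rightarrow> real) \<Rightarrow> real \<Rightarrow> (nat \<Rightarrow> nat) \<Rightarrow> ennreal" where
  "ufl_opt n d f N = (INF S\<in>Pow {..<n}. ufl_cost n d f N S)"

text \<open>
  Super-set output: \<open>c\<close> is the connection metric. A tie-breaking rule picks one of the nearest
  locations, depending only on the client's location and the set of candidates.
\<close>

definition tie_rule :: "(nat \<Rightarrow> nat set \<Rightarrow> nat) \<Rightarrow> bool" where
  "tie_rule tie \<longleftrightarrow> (\<forall>v X. X \<noteq> {} \<longrightarrow> tie v X \<in> X)"

definition nearest ::
    "(nat \<Rightarrow> nat set \<Rightarrow> nat) \<Rightarrow> (nat \<Rightarrow> nat \<Rightarrow> real) \<Rightarrow> nat set \<Rightarrow> nat \<Rightarrow> nat" where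
  "nearest tie c R v = tie v {s\<in>R. \<forall>s'\<in>R. c v s \<le> c v s'}"

definition opened ::
    "(nat \<Rightarrow> nat set \<Rightarrow> nat) \<Rightarrow> nat \<Rightarrow> (nat \<Rightarrow> nat \<Rightarrow> real) \<Rightarrow> (nat \<Rightarrow> nat) \<Rightarrow> nat set \<Rightarrow> nat set" where
  "opened tie n c N R = {s\<in>R. \<exists>v<n. N v > 0 \<and> nearest tie c R v = s}"

definition differentially_private :: "real \<Rightarrow> nat \<Rightarrow> ((nat \<Rightarrow> nat) \<Rightarrow> 'o pmf) \<Rightarrow> bool" where
  "differentially_private \<epsilon> n M \<longleftrightarrow>
     (\<forall>N N'. (\<Sum>v<n. \<bar>int (N v) - int (N' v)\<bar>) = 1 \<longrightarrow>
        (\<forall>E. measure_pmf.prob (M N) E \<le> exp \<epsilon> * measure_pmf.prob (M N') E))"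

section \<open>Edge-weighted rooted trees and HSTs\<close>

text \<open>
  The vertices are \<open>{..<num_vertices T}\<close>; \<open>weight T v\<close> is the weight of the edge between a
  vertex \<open>v\<close> other than the root and its parent.
\<close>

record wtree =
  num_vertices :: nat
  root_vertex :: nat
  parent :: "nat \<Rightarrow> nat"
  weight :: "nat \<Rightarrow> real"

definition is_wtree :: "wtree \<Rightarrow> bool" where
  "is_wtree T \<longleftrightarrow>
     root_vertex T < num_vertices T \<and>
     parent T (root_vertex T) = root_vertex T \<and> weight T (root_vertex T) = 0 \<and>
     (\<forall>v<num_vertices T. v \<noteq> root_vertex T \<longrightarrow> parent T v < num_vertices T \<and> weight T v > 0) \<and>
     (\<forall>v<num_vertices T. \<exists>k. (parent T ^^ k) v = root_vertex T)"

definition tree_edge :: "wtree \<Rightarrow> nat \<Rightarrow> nat \<Rightarrow> bool" where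
  "tree_edge T u v \<longleftrightarrow> u < num_vertices T \<and> v < num_vertices T \<and>
     (u \<noteq> root_vertex T \<and> parent T u = v \<or> v \<noteq> root_vertex T \<and> parent T v = u)"

definition edge_weight :: "wtree \<Rightarrow> nat \<Rightarrow> nat \<Rightarrow> real" where
  "edge_weight T u v =
     (if u \<noteq> root_vertex T \<and> parent T u = v then weight T u else weight T v)"

definition tree_walks :: "wtree \<Rightarrow> nat \<Rightarrow> nat \<Rightarrow> nat list set" where
  "tree_walks T u v = {p. p \<noteq> [] \<and> hd p = u \<and> last p = v \<and> successively (tree_edge T) p}"

definition walk_length :: "wtree \<Rightarrow> nat list \<Rightarrow> real" where
  "walk_length T p = (\<Sum>(x, y)\<leftarrow>zip p (tl p). edge_weight T x y)"

definition tree_dist :: "wtree \<Rightarrow> nat \<Rightarrow> nat \<Rightarrow> real" where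
  "tree_dist T u v = (INF p\<in>tree_walks T u v. walk_length T p)"

definition depth :: "wtree \<Rightarrow> nat \<Rightarrow> nat" where
  "depth T v = (LEAST k. (parent T ^^ k) v = root_vertex T)"

definition leaves :: "wtree \<Rightarrow> nat set" where
  "leaves T = {v. v < num_vertices T \<and>
     \<not> (\<exists>u<num_vertices T. u \<noteq> root_vertex T \<and> parent T u = v)}"

definition level :: "nat \<Rightarrow> wtree \<Rightarrow> nat \<Rightarrow> nat" where
  "level L T v = L - depth T v"

definition is_hst :: "real \<Rightarrow> nat \<Rightarrow> wtree \<Rightarrow> bool" where
  "is_hst lam L T \<longleftrightarrow> lam > 1 \<and> L \<ge> 1 \<and> is_wtree T \<and>
     (\<forall>v\<in>leaves T. depth T v = L) \<and>
     (\<forall>v<num_vertices T. v \<noteq> root_vertex T \<longrightarrow> weight T v = lam ^ level L T v)"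

section \<open>Randomized polynomial-time computation over the reals\<close>

text \<open>
  The model is a randomized real RAM in the form of a Lisp-like machine: data are built by pairing
  from real numbers; pairing and projection, real arithmetic, \<open>exp\<close>, \<open>ln\<close>, comparison, and
  tossing a coin of computed bias have unit cost. There is no rounding operation. As for
  Blum-Shub-Smale machines, a program may mention finitely many arbitrary real constants.
\<close>

datatype val = VNil | VNum real | VPair val val

datatype arith = Add | Sub | Mul | Div | Exp | Ln

datatype prog =
    Skip
  | Const real
  | Nil_Const
  | Head
  | Tail
  | Mk_Pair prog prog
  | Seq prog prog
  | Cond prog prog prog
  | While prog prog
  | Arith arith
  | Less
  | Flip

fun head_val :: "val \<Rightarrow> val" where
  "head_val (VPair x y) = x"
| "head_val _ = VNil"

fun tail_val :: "val \<Rightarrow> val" where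
  "tail_val (VPair x y) = y"
| "tail_val _ = VNil"

fun num_val :: "val \<Rightarrow> real" where
  "num_val (VNum r) = r"
| "num_val _ = 0"

definition bool_val :: "bool \<Rightarrow> val" where
  "bool_val b = (if b then VNum 1 else VNil)"

fun arith_fun :: "arith \<Rightarrow> real \<Rightarrow> real \<Rightarrow> real" where
  "arith_fun Add x y = x + y"
| "arith_fun Sub x y = x - y"
| "arith_fun Mul x y = x * y"
| "arith_fun Div x y = x / y"
| "arith_fun Exp x y = exp x"
| "arith_fun Ln x y = ln x"

text \<open>
  A computation yields its result together with the number of steps; missing probability mass is
  divergence. Every value other than \<open>VNil\<close> counts as true. Binary operations read the two
  components of a pair; \<open>Exp\<close> and \<open>Ln\<close> ignore the second one.
\<close>

partial_function (spmf) while_loop ::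
    "(val \<Rightarrow> (val \<times> nat) spmf) \<Rightarrow> (val \<Rightarrow> (val \<times> nat) spmf) \<Rightarrow> val \<Rightarrow> (val \<times> nat) spmf" where
  "while_loop g b x =
     bind_spmf (g x) (\<lambda>(c, r).
       if c = VNil then return_spmf (x, r + 1)
       else bind_spmf (b x) (\<lambda>(y, s).
         bind_spmf (while_loop g b y) (\<lambda>(z, t). return_spmf (z, r + s + t + 1))))"

primrec run :: "prog \<Rightarrow> val \<Rightarrow> (val \<times> nat) spmf" where
  "run Skip x = return_spmf (x, 1)"
| "run (Const r) x = return_spmf (VNum r, 1)"
| "run Nil_Const x = return_spmf (VNil, 1)"
| "run Head x = return_spmf (head_val x, 1)"
| "run Tail x = return_spmf (tail_val x, 1)"
| "run (Mk_Pair p q) x =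
     bind_spmf (run p x) (\<lambda>(y, s). bind_spmf (run q x) (\<lambda>(z, t).
       return_spmf (VPair y z, s + t + 1)))"
| "run (Seq p q) x =
     bind_spmf (run p x) (\<lambda>(y, s). bind_spmf (run q y) (\<lambda>(z, t).
       return_spmf (z, s + t + 1)))"
| "run (Cond g p q) x =
     bind_spmf (run g x) (\<lambda>(c, s). bind_spmf (if c = VNil then run q x else run p x) (\<lambda>(z, t).
       return_spmf (z, s + t + 1)))"
| "run (While g p) x = while_loop (run g) (run p) x"
| "run (Arith a) x =
     return_spmf (VNum (arith_fun a (num_val (head_val x)) (num_val (tail_val x))), 1)"
| "run Less x =
     return_spmf (bool_val (num_val (head_val x) < num_val (tail_val x)), 1)"
| "run Flip x =
     map_spmf (\<lambda>b. (bool_val b, 1)) (spmf_of_pmf (bernoulli_pmf (num_val x)))"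

text \<open>
  The size of an input accounts for the orders of magnitude of its numbers, and hence, for a
  metric, for the logarithm of its aspect ratio. (The depth of an HST is of that order.)
\<close>

primrec val_size :: "val \<Rightarrow> nat" where
  "val_size VNil = 1"
| "val_size (VNum r) = 1 + nat \<lceil>\<bar>log 2 \<bar>r\<bar>\<bar>\<rceil>"
| "val_size (VPair x y) = val_size x + val_size y + 1"

text \<open>
  The randomized algorithm \<open>A\<close> is implemented on all inputs from \<open>D\<close> by one program that always
  halts, within time polynomial in the size of the input.
\<close>

definition polytime :: "'i set \<Rightarrow> ('i \<Rightarrow> val) \<Rightarrow> ('o \<Rightarrow> val) \<Rightarrow> ('i \<Rightarrow> 'o pmf) \<Rightarrow> bool" where
  "polytime D enc_in enc_out A \<longleftrightarrow>
     (\<exists>P c k. \<forall>x\<in>D.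
        map_spmf fst (run P (enc_in x)) = spmf_of_pmf (map_pmf enc_out (A x)) \<and>
        (\<forall>(y, t)\<in>set_spmf (run P (enc_in x)). t \<le> c * val_size (enc_in x) ^ k))"

definition enc_list :: "('a \<Rightarrow> val) \<Rightarrow> 'a list \<Rightarrow> val" where
  "enc_list e xs = foldr (\<lambda>x. VPair (e x)) xs VNil"

definition enc_nat :: "nat \<Rightarrow> val" where
  "enc_nat k = VNum (real k)"

definition enc_set :: "nat set \<Rightarrow> val" where
  "enc_set R = enc_list enc_nat (sorted_list_of_set R)"

definition enc_wtree :: "wtree \<Rightarrow> val" where
  "enc_wtree T = VPair (enc_nat (root_vertex T))
     (enc_list (\<lambda>v. VPair (enc_nat (parent T v)) (VNum (weight T v))) [0..<num_vertices T])"

definition enc_metric :: "nat \<Rightarrow> (nat \<Rightarrow> nat \<Rightarrow> real) \<Rightarrow> val" where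
  "enc_metric n d = enc_list (\<lambda>u. enc_list (\<lambda>v. VNum (d u v)) [0..<n]) [0..<n]"

section \<open>Algorithms for HST metrics and for general metrics\<close>

type_synonym 'm ufl_instance = "nat \<times> 'm \<times> real \<times> (nat \<Rightarrow> nat)"

fun enc_instance :: "(nat \<Rightarrow> 'm \<Rightarrow> val) \<Rightarrow> 'm ufl_instance \<Rightarrow> val" where
  "enc_instance e (n, m, f, N) = VPair (e n m) (VPair (VNum f) (enc_list (\<lambda>v. enc_nat (N v)) [0..<n]))"

definition hst_instances :: "real \<Rightarrow> wtree ufl_instance set" where
  "hst_instances lam =
     {(n, T, f, N). n \<ge> 1 \<and> (\<exists>L. is_hst lam L T) \<and> leaves T = {..<n} \<and> f \<ge> 0}"

definition metric_instances :: "(nat \<Rightarrow> nat \<Rightarrow> real) ufl_instance set" where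
  "metric_instances = {(n, d, f, N). n \<ge> 1 \<and> Metric_space {..<n} d \<and> f \<ge> 0}"

text \<open>
  On an HST metric, the output is the super-set \<open>R\<close>, and clients connect with respect to the HST
  metric itself. On a general metric, the output is \<open>R\<close> together with an edge-weighted tree whose
  vertices include all points; clients connect with respect to the tree metric, while the cost is
  measured in the given metric.
\<close>

definition efficient_hst_algorithm :: "real \<Rightarrow> (wtree ufl_instance \<Rightarrow> nat set pmf) \<Rightarrow> bool" where
  "efficient_hst_algorithm lam A \<longleftrightarrow>
     (\<forall>(n, T, f, N)\<in>hst_instances lam. \<forall>R\<in>set_pmf (A (n, T, f, N)). R \<subseteq> {..<n}) \<and>
     polytime (hst_instances lam) (enc_instance (\<lambda>n. enc_wtree)) enc_set A"

definition efficient_metric_algorithm ::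
    "((nat \<Rightarrow> nat \<Rightarrow> real) ufl_instance \<Rightarrow> (nat set \<times> wtree) pmf) \<Rightarrow> bool" where
  "efficient_metric_algorithm A \<longleftrightarrow>
     (\<forall>(n, d, f, N)\<in>metric_instances. \<forall>(R, T)\<in>set_pmf (A (n, d, f, N)).
        R \<subseteq> {..<n} \<and> is_wtree T \<and> n \<le> num_vertices T) \<and>
     polytime metric_instances (enc_instance enc_metric)
       (\<lambda>(R, T). VPair (enc_set R) (enc_wtree T)) A"

definition private_on ::
    "'m ufl_instance set \<Rightarrow> real \<Rightarrow> ('m ufl_instance \<Rightarrow> 'o pmf) \<Rightarrow> bool" where
  "private_on D \<epsilon> A \<longleftrightarrow>
     (\<forall>(n, m, f, N)\<in>D. differentially_private \<epsilon> n (\<lambda>N'. A (n, m, f, N')))"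

text \<open>In the ratios, \<open>0 / 0 = 0\<close> and \<open>c / 0 = \<infinity>\<close> for \<open>c > 0\<close>.\<close>

fun hst_ratio :: "(nat \<Rightarrow> nat set \<Rightarrow> nat) \<Rightarrow> (wtree ufl_instance \<Rightarrow> nat set pmf) \<Rightarrow>
    wtree ufl_instance \<Rightarrow> ennreal" where
  "hst_ratio tie A (n, T, f, N) =
     (\<integral>\<^sup>+ R. ufl_cost n (tree_dist T) f N (opened tie n (tree_dist T) N R)
        \<partial>measure_pmf (A (n, T, f, N)))
     / ufl_opt n (tree_dist T) f N"

fun metric_ratio :: "(nat \<Rightarrow> nat set \<Rightarrow> nat) \<Rightarrow>
    ((nat \<Rightarrow> nat \<Rightarrow> real) ufl_instance \<Rightarrow> (nat set \<times> wtree) pmf) \<Rightarrow>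
    (nat \<Rightarrow> nat \<Rightarrow> real) ufl_instance \<Rightarrow> ennreal" where
  "metric_ratio tie A (n, d, f, N) =
     (\<integral>\<^sup>+ (R, T). ufl_cost n d f N (opened tie n (tree_dist T) N R)
        \<partial>measure_pmf (A (n, d, f, N)))
     / ufl_opt n d f N"

end

theory Submission
  imports Defs
begin

text \<open>
  The reduction embeds the metric into a random HST, runs the tree algorithm on it and outputs its
  super-set together with the tree. The tree does not depend on the clients, so privacy is preserved;
  tree distances dominate the given ones, so costs in the metric are at most costs in the tree; and
  the optimum for the metric has expected cost \<open>O(log n)\<close> times as large in the tree.

  The tree is the one of Fakcharoenphol, Rao and Talwar. At scale \<open>lam ^ j\<close> each point is labelled by
  the center of highest priority within distance \<open>radius lam s b j\<close>, for random priorities and a random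
  \<open>b\<close>; the vertices at level \<open>j\<close> are the sequences of labels from level \<open>j\<close> upwards. Among the centers
  that reach \<open>u\<close> or \<open>v\<close>, a center separates them only if it has the highest priority (probability at
  most 1 over its rank by distance) and the radius falls into an interval of length at most \<open>d u v\<close>.
  As the ranges of the radii are disjoint, the sum over all scales is
  \<open>O(d u v)\<close> for each center, and the ranks contribute a harmonic number.

  The machine can only toss coins, so \<open>b\<close> is a dyadic rational whose precision is of the order of the
  inverse aspect ratio.
\<close>

section \<open>Running times and output distributions of programs\<close>

text \<open>The leaf edges of an HST weigh 1, so the tree lives in units of \<open>s\<close>, a
  lower bound on the positive distances: the tree algorithm gets facility cost \<open>f / s\<close>,
  and multiplying its costs by \<open>s\<close> leaves its ratio unchanged. The radius of one scale
  is, up to discretization, uniform over a range \<open>[a, lam * a)\<close>. Its density is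
  inversely proportional to the cost of a cut at that scale, so all scales charge the same rate per
  unit of length, for every \<open>lam > 1\<close>. One \<open>b\<close> serves all scales because
  the estimate adds expectations and sees only the law of each single radius. The rounding error of
  \<open>b\<close> is additive on each scale and not small against a short distance at a large
  scale; only its geometric sum over the scales below the diameter, times the precision, is of the
  order of \<open>s\<close>. A concrete program is demanded, in a model without rounding and arrays.
  Random objects are therefore folds over lists that the program holds anyway (rows of the metric,
  list of scales), and their laws are analysed apart from the implementation.\<close>

definition yields :: "(val \<times> nat) spmf \<Rightarrow> val pmf \<Rightarrow> nat \<Rightarrow> bool" where
  "yields m M B \<longleftrightarrow> (\<exists>J. m = spmf_of_pmf J \<and> map_pmf fst J = M \<and> (\<forall>(y, t)\<in>set_pmf J. t \<le> B))"

lemma spmf_of_pmf_inject: "spmf_of_pmf p = spmf_of_pmf q \<longleftrightarrow> p = q"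
  unfolding spmf_of_pmf_def by (rule inj_eq[OF pmf.inj_map]) simp

text \<open>The bridge to \<open>polytime\<close>. A marginal that is an embedded pmf forces the
  whole computation to be lossless, so the joint law of result and time, on which the composition
  rules work, can be recovered from the two conditions stated there.\<close>

lemma yields_iff:
  "yields m M B \<longleftrightarrow> map_spmf fst m = spmf_of_pmf M \<and> (\<forall>(y, t)\<in>set_spmf m. t \<le> B)"
proof
  assume "yields m M B"
  then obtain J where "m = spmf_of_pmf J" "map_pmf fst J = M" "\<forall>(y, t)\<in>set_pmf J. t \<le> B"
    unfolding yields_def by blast
  then show "map_spmf fst m = spmf_of_pmf M \<and> (\<forall>(y, t)\<in>set_spmf m. t \<le> B)"
    by (simp only: map_spmf_of_pmf set_spmf_spmf_of_pmf) 
next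
  assume *: "map_spmf fst m = spmf_of_pmf M \<and> (\<forall>(y, t)\<in>set_spmf m. t \<le> B)"
  then have "lossless_spmf m"
    by (metis lossless_map_spmf lossless_spmf_spmf_of_spmf)
  then obtain J where J: "m = spmf_of_pmf J"
    unfolding lossless_spmf_conv_spmf_of_pmf by blast
  with * have "map_pmf fst J = M"
    by (simp add: spmf_of_pmf_inject)
  moreover have "\<forall>(y, t)\<in>set_pmf J. t \<le> B"
    using * unfolding J set_spmf_spmf_of_pmf by blast
  ultimately show "yields m M B" unfolding yields_def using J by blast
qed

lemma yields_return: "t \<le> B \<Longrightarrow> yields (return_spmf (y, t)) (return_pmf y) B"
  unfolding yields_def by (intro exI[of _ "return_pmf (y, t)"]) auto

lemma yields_returnI: "m = return_spmf (y, t) \<Longrightarrow> t \<le> B \<Longrightarrow> M = return_pmf y \<Longrightarrow> yields m M B"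
  by (simp add: yields_return)

lemma yields_mono: "yields m M B \<Longrightarrow> B \<le> B' \<Longrightarrow> M = M' \<Longrightarrow> yields m M' B'"
  unfolding yields_def by fastforce

text \<open>The composite cases of \<open>run\<close> have this shape, with \<open>h\<close>
  combining results and \<open>\<tau>\<close> combining times. \<open>Q\<close> is controlled only
  on results that can occur, so its witnesses are chosen pointwise on the support of
  \<open>M\<close>.\<close>

lemma yields_bind:
  assumes m: "yields m M Ba"
    and Q: "\<And>y. y \<in> set_pmf M \<Longrightarrow> yields (Q y) (K y) Bb"
    and \<tau>: "\<And>s t. s \<le> Ba \<Longrightarrow> t \<le> Bb \<Longrightarrow> \<tau> s t \<le> B"
  shows "yields (bind_spmf m (\<lambda>(y, s). bind_spmf (Q y) (\<lambda>(z, t). return_spmf (h y z, \<tau> s t))))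
    (bind_pmf M (\<lambda>y. map_pmf (h y) (K y))) B"
proof -
  obtain J where J: "m = spmf_of_pmf J" "map_pmf fst J = M" "\<And>y t. (y, t) \<in> set_pmf J \<Longrightarrow> t \<le> Ba"
    using m unfolding yields_def by fast
  have "\<forall>y. \<exists>I. y \<in> set_pmf M \<longrightarrow> Q y = spmf_of_pmf I \<and> map_pmf fst I = K y \<and>
      (\<forall>(z, t)\<in>set_pmf I. t \<le> Bb)"
    using Q unfolding yields_def by blast
  then obtain I where I: "\<And>y. y \<in> set_pmf M \<Longrightarrow> Q y = spmf_of_pmf (I y)"
      "\<And>y. y \<in> set_pmf M \<Longrightarrow> map_pmf fst (I y) = K y"
      "\<And>y z t. y \<in> set_pmf M \<Longrightarrow> (z, t) \<in> set_pmf (I y) \<Longrightarrow> t \<le> Bb"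
    by (metis (no_types, lifting) case_prodD)
  have M: "y \<in> set_pmf M" if "(y, s) \<in> set_pmf J" for y s
    using that J(2) by force
  define H where "H = bind_pmf J (\<lambda>(y, s). map_pmf (\<lambda>(z, t). (h y z, \<tau> s t)) (I y))"
  have "bind_spmf m (\<lambda>(y, s). bind_spmf (Q y) (\<lambda>(z, t). return_spmf (h y z, \<tau> s t))) =
      bind_pmf J (\<lambda>(y, s). bind_spmf (Q y) (\<lambda>(z, t). return_spmf (h y z, \<tau> s t)))"
    by (simp add: J(1) bind_spmf_of_pmf)
  also have "\<dots> = bind_pmf J (\<lambda>(y, s). spmf_of_pmf (map_pmf (\<lambda>(z, t). (h y z, \<tau> s t)) (I y)))"
  proof (rule bind_pmf_cong[OF refl], clarsimp)
    fix y s assume "(y, s) \<in> set_pmf J"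
    then have Qy: "Q y = spmf_of_pmf (I y)" using I(1) M by blast
    show "bind_spmf (Q y) (\<lambda>(z, t). return_spmf (h y z, \<tau> s t)) =
        spmf_of_pmf (map_pmf (\<lambda>(z, t). (h y z, \<tau> s t)) (I y))"
      unfolding Qy map_spmf_of_pmf[symmetric] map_spmf_conv_bind_spmf
      by (rule bind_spmf_cong) auto
  qed
  also have "\<dots> = spmf_of_pmf H"
    unfolding H_def spmf_of_pmf_bind by (rule bind_pmf_cong) auto
  finally have 1: "bind_spmf m (\<lambda>(y, s). bind_spmf (Q y) (\<lambda>(z, t). return_spmf (h y z, \<tau> s t))) =
      spmf_of_pmf H" .
  have "map_pmf fst H = bind_pmf J (\<lambda>(y, s). map_pmf (h y) (K y))"
    unfolding H_def map_bind_pmf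
  proof (rule bind_pmf_cong[OF refl], safe)
    fix y s assume "(y, s) \<in> set_pmf J"
    from I(2)[OF M[OF this]] have Ky: "K y = map_pmf fst (I y)" by simp
    show "map_pmf fst (map_pmf (\<lambda>(z, t). (h y z, \<tau> s t)) (I y)) = map_pmf (h y) (K y)"
      unfolding Ky pmf.map_comp by (rule map_pmf_cong) auto
  qed
  also have "\<dots> = bind_pmf M (\<lambda>y. map_pmf (h y) (K y))"
    unfolding J(2)[symmetric] bind_map_pmf by (rule bind_pmf_cong) auto
  finally have 2: "map_pmf fst H = bind_pmf M (\<lambda>y. map_pmf (h y) (K y))" .
  have "\<tau> s t \<le> B" if "(y, s) \<in> set_pmf J" "(z, t) \<in> set_pmf (I y)" for y s z t
    using \<tau>[OF J(3)[OF that(1)] I(3)[OF M[OF that(1)] that(2)]] .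
  then have "\<forall>(y, t)\<in>set_pmf H. t \<le> B"
    unfolding H_def by auto
  with 1 2 show ?thesis unfolding yields_def by blast
qed

lemma yields_Seq:
  assumes "yields (run p x) M B1" "\<And>y. y \<in> set_pmf M \<Longrightarrow> yields (run q y) (K y) B2"
  shows "yields (run (Seq p q) x) (bind_pmf M K) (B1 + B2 + 1)"
  using yields_bind[OF assms, where h = "\<lambda>y z. z" and \<tau> = "\<lambda>s t. s + t + 1" and B = "B1 + B2 + 1"]
  by simp

lemma yields_Seq_det:
  assumes "yields (run p x) (return_pmf y) B1" "yields (run q y) K B2"
  shows "yields (run (Seq p q) x) K (B1 + B2 + 1)"
  using yields_Seq[OF assms(1), where K = "\<lambda>_. K" and ?B2.0 = B2 and q = q] assms(2)
  by (simp add: bind_return_pmf)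

lemma yields_Mk_Pair:
  assumes "yields (run p x) M B1" "yields (run q x) K B2"
  shows "yields (run (Mk_Pair p q) x) (bind_pmf M (\<lambda>y. map_pmf (VPair y) K)) (B1 + B2 + 1)"
  using yields_bind[OF assms(1), where Q = "\<lambda>_. run q x" and K = "\<lambda>_. K" and Bb = B2 and h = VPair
      and \<tau> = "\<lambda>s t. s + t + 1" and B = "B1 + B2 + 1"] assms(2) by simp

lemma yields_Cond:
  assumes "yields (run g x) M B1"
    "\<And>c. c \<in> set_pmf M \<Longrightarrow> yields (run (if c = VNil then q else p) x) (K c) B2"
  shows "yields (run (Cond g p q) x) (bind_pmf M K) (B1 + B2 + 1)"
proof -
  have "yields (if c = VNil then run q x else run p x) (K c) B2" if "c \<in> set_pmf M" for c
    using assms(2)[OF that] by (cases "c = VNil") (simp_all only: if_True if_False simp_thms)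
  from yields_bind[OF assms(1) this, where h = "\<lambda>y z. z" and \<tau> = "\<lambda>s t. s + t + 1" and B = "B1 + B2 + 1"]
  show ?thesis by simp
qed

lemma yields_Flip: "yields (run Flip x) (map_pmf bool_val (bernoulli_pmf (num_val x))) 1"
  unfolding yields_def
  by (rule exI[of _ "map_pmf (\<lambda>b. (bool_val b, 1)) (bernoulli_pmf (num_val x))"])
    (auto simp: map_spmf_of_pmf pmf.map_comp o_def)

lemma yields_While_stop:
  assumes "run g x = return_spmf (VNil, r)"
  shows "yields (run (While g p) x) (return_pmf x) (r + 1)"
  unfolding run.simps by (subst while_loop.simps) (simp add: assms yields_return)

lemma yields_While_step:
  assumes "run g x = return_spmf (c, r)" "c \<noteq> VNil" "yields (run p x) M B1"
    "\<And>y. y \<in> set_pmf M \<Longrightarrow> yields (run (While g p) y) (K y) B2"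
  shows "yields (run (While g p) x) (bind_pmf M K) (r + B1 + B2 + 1)"
  using yields_bind[OF assms(3), where Q = "run (While g p)" and K = K
      and Bb = B2 and h = "\<lambda>y z. z" and \<tau> = "\<lambda>s t. r + s + t + 1" and B = "r + B1 + B2 + 1"] assms(1,2,4)
  unfolding run.simps by (subst while_loop.simps) simp

text \<open>The state of a program is used as an environment, a nested pair; \<open>let_prog\<close> pushes a value.\<close>

abbreviation let_prog :: "prog \<Rightarrow> prog \<Rightarrow> prog" where
  "let_prog p q \<equiv> Seq (Mk_Pair p Skip) q"

lemma yields_unique: "yields m M B \<Longrightarrow> yields m M' B' \<Longrightarrow> M = M'"
  unfolding yields_def by (auto simp: spmf_of_pmf_inject)

text \<open>The continuation law \<open>K\<close> is indexed by abstract values, while the program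
  sees only their encodings \<open>h y\<close>. Values with equal encodings have equal continuation
  laws by \<open>yields_unique\<close>, so \<open>THE\<close> turns \<open>K\<close> into a function
  of the encoding.\<close>

lemma yields_While_step_map:
  assumes "run g x = return_spmf (c, r)" "c \<noteq> VNil" "yields (run p x) (map_pmf h M) B1"
    and K: "\<And>y. y \<in> set_pmf M \<Longrightarrow> yields (run (While g p) (h y)) (K y) B2"
  shows "yields (run (While g p) x) (bind_pmf M K) (r + B1 + B2 + 1)"
proof -
  define K' where "K' z = (THE M. yields (run (While g p) z) M B2)" for z
  have K': "K' (h y) = K y" if "y \<in> set_pmf M" for y
    unfolding K'_def using K[OF that] by (intro the_equality) (auto intro: yields_unique)
  have "yields (run (While g p) x) (bind_pmf (map_pmf h M) K') (r + B1 + B2 + 1)"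
    by (rule yields_While_step[OF assms(1-3)]) (auto simp: K' simp del: run.simps intro: K)
  also have "bind_pmf (map_pmf h M) K' = bind_pmf M K"
    unfolding bind_map_pmf by (rule bind_pmf_cong) (auto simp: K')
  finally show ?thesis .
qed

lemma yields_let:
  assumes "yields (run p x) M B1" "\<And>y. y \<in> set_pmf M \<Longrightarrow> yields (run q (VPair y x)) (K y) B2"
  shows "yields (run (let_prog p q) x) (bind_pmf M K) (B1 + B2 + 3)"
proof -
  have "yields (run (Mk_Pair p Skip) x) (bind_pmf M (\<lambda>y. map_pmf (VPair y) (return_pmf x))) (B1 + 1 + 1)"
    by (intro yields_Mk_Pair assms(1)) (simp add: yields_return)
  then have 1: "yields (run (Mk_Pair p Skip) x) (map_pmf (\<lambda>y. VPair y x) M) (B1 + 2)"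
    by (rule yields_mono) (simp_all add: map_pmf_def bind_return_pmf)
  have "yields (run (let_prog p q) x) (bind_pmf (map_pmf (\<lambda>y. VPair y x) M) (\<lambda>z. K (head_val z))) (B1 + 2 + B2 + 1)"
    by (rule yields_Seq[OF 1]) (use assms(2) in \<open>auto simp del: run.simps\<close>)
  then show ?thesis by (rule yields_mono) (auto simp: bind_map_pmf)
qed

lemma yields_let_map:
  assumes "yields (run p x) (map_pmf h M) B1"
    and K: "\<And>y. y \<in> set_pmf M \<Longrightarrow> yields (run q (VPair (h y) x)) (K y) B2"
  shows "yields (run (let_prog p q) x) (bind_pmf M K) (B1 + B2 + 3)"
proof -
  define K' where "K' z = (THE M. yields (run q (VPair z x)) M B2)" for z
  have K': "K' (h y) = K y" if "y \<in> set_pmf M" for y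
    unfolding K'_def using K[OF that] by (intro the_equality) (auto intro: yields_unique)
  have "yields (run (let_prog p q) x) (bind_pmf (map_pmf h M) K') (B1 + B2 + 3)"
    by (rule yields_let[OF assms(1)]) (auto simp: K' simp del: run.simps intro: K)
  also have "bind_pmf (map_pmf h M) K' = bind_pmf M K"
    unfolding bind_map_pmf by (rule bind_pmf_cong) (auto simp: K')
  finally show ?thesis .
qed

lemma yields_let_det:
  assumes "yields (run p x) (return_pmf y) B1" "yields (run q (VPair y x)) K B2"
  shows "yields (run (let_prog p q) x) K (B1 + B2 + 3)"
  using yields_let[OF assms(1), where K = "\<lambda>_. K" and ?B2.0 = B2 and q = q] assms(2)
  by (simp add: bind_return_pmf)

section \<open>Monadic folds and the loops that execute them\<close>

fun foldM :: "('x \<Rightarrow> 'a \<Rightarrow> 'a pmf) \<Rightarrow> 'x list \<Rightarrow> 'a \<Rightarrow> 'a pmf" where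
  "foldM F [] a = return_pmf a"
| "foldM F (x # xs) a = bind_pmf (F x a) (foldM F xs)"

lemma foldM_return: "foldM (\<lambda>x a. return_pmf (g x a)) xs a = return_pmf (fold g xs a)"
  by (induction xs arbitrary: a) (auto simp: bind_return_pmf)

text \<open>The loop state pairs the remaining list with accumulator and environment. The empty list
  is encoded by \<open>VNil\<close>, the one value that counts as false, so \<open>Head\<close>
  serves as loop guard.\<close>

definition fold_body :: "prog \<Rightarrow> prog" where
  "fold_body p = Mk_Pair (Seq Head Tail) (Mk_Pair (Seq (Mk_Pair (Seq Tail Head)
     (Mk_Pair (Seq Head Head) (Seq Tail Tail))) p) (Seq Tail Tail))"

text \<open>The body \<open>p\<close> of a fold sees the accumulator and the list element on top of the environment.\<close>

definition fold_prog :: "prog \<Rightarrow> prog \<Rightarrow> prog \<Rightarrow> prog" where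
  "fold_prog l a p = Seq (Mk_Pair l (Mk_Pair a Skip)) (Seq (While Head (fold_body p)) (Seq Tail Head))"

lemma enc_list_simps [simp]:
  "enc_list e [] = VNil" "enc_list e (x # xs) = VPair (e x) (enc_list e xs)"
  by (simp_all add: enc_list_def)

text \<open>The invariant also sees the remaining list, so that it can tie the size of the
  accumulator to the work that is left. The 22 is the cost of the guard and of repacking the state
  in one round.\<close>

lemma yields_fold_loop:
  assumes step: "\<And>x xs a. I (x # xs) a \<Longrightarrow>
      yields (run p (VPair (r a) (VPair (e x) env))) (map_pmf r (F x a)) B"
    and inv: "\<And>x xs a b. I (x # xs) a \<Longrightarrow> b \<in> set_pmf (F x a) \<Longrightarrow> I xs b"
    and "I xs a"
  shows "yields (run (While Head (fold_body p)) (VPair (enc_list e xs) (VPair (r a) env)))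
    (map_pmf (\<lambda>a. VPair VNil (VPair (r a) env)) (foldM F xs a)) (length xs * (B + 22) + 2)"
  using \<open>I xs a\<close>
proof (induction xs arbitrary: a)
  case Nil
  show ?case using yields_While_stop[of Head "VPair VNil (VPair (r a) env)" 1] by simp
next
  case (Cons x xs)
  let ?S = "VPair (enc_list e (x # xs)) (VPair (r a) env)"
  have 1: "yields (run (Mk_Pair (Seq Tail Head) (Mk_Pair (Seq Head Head) (Seq Tail Tail))) ?S)
      (return_pmf (VPair (r a) (VPair (e x) env))) 11"
    by (rule yields_returnI) auto
  have "yields (run (Seq (Mk_Pair (Seq Tail Head) (Mk_Pair (Seq Head Head) (Seq Tail Tail))) p) ?S)
      (map_pmf r (F x a)) (11 + B + 1)"
    using step[OF Cons.prems] by (intro yields_Seq_det[OF 1]) 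
  from yields_Mk_Pair[OF this yields_returnI[of "run (Seq Tail Tail) ?S" env 3 3]]
  have "yields (run (Mk_Pair (Seq (Mk_Pair (Seq Tail Head) (Mk_Pair (Seq Head Head) (Seq Tail Tail))) p)
      (Seq Tail Tail)) ?S) (bind_pmf (map_pmf r (F x a)) (\<lambda>y. map_pmf (VPair y) (return_pmf env)))
      (11 + B + 1 + 3 + 1)"
    by simp
  from yields_Mk_Pair[OF yields_returnI[of "run (Seq Head Tail) ?S" "enc_list e xs" 3 3, OF _ _ refl] this]
  have "yields (run (fold_body p) ?S) (map_pmf (\<lambda>a. VPair (enc_list e xs) (VPair (r a) env)) (F x a)) (B + 20)"
    unfolding fold_body_def
    by (rule yields_mono) (simp_all add: bind_return_pmf map_pmf_def bind_assoc_pmf)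
  from yields_While_step_map[OF _ _ this, of Head "enc_list e (x # xs)" 1 "\<lambda>a. map_pmf (\<lambda>a. VPair VNil (VPair (r a) env))
      (foldM F xs a)" "length xs * (B + 22) + 2"] Cons.IH inv[OF Cons.prems]
  have "yields (run (While Head (fold_body p)) ?S) (bind_pmf (F x a) (\<lambda>a. map_pmf (\<lambda>a. VPair VNil (VPair (r a) env))
      (foldM F xs a))) (1 + (B + 20) + (length xs * (B + 22) + 2) + 1)"
    by simp
  then show ?case by (rule yields_mono) (auto simp: map_bind_pmf)
qed

text \<open>Keeps all running times in the form of a constant times a power of one parameter
  \<open>Z\<close>: each nesting of folds raises the exponent by one, and additive overheads are
  absorbed because \<open>1 \<le> Z\<close>.\<close>

lemma loop_bound:
  fixes l Z :: nat
  assumes "l \<le> Z" "1 \<le> Z" "B \<le> a * Z ^ k" "a + B1 + B2 + 42 \<le> C"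
  shows "B1 + B2 + l * (B + 22) + 20 \<le> C * Z ^ Suc k"
proof -
  have p: "1 \<le> Z ^ k" "1 \<le> Z ^ Suc k" using assms(2) by (auto intro: one_le_power)
  have "l * (B + 22) \<le> Z * (a * Z ^ k + 22 * Z ^ k)" using assms p by (intro mult_mono add_mono) auto
  also have "\<dots> = (a + 22) * Z ^ Suc k" by (simp add: algebra_simps)
  finally have "(B1 + B2 + 20) * 1 + l * (B + 22) \<le> (B1 + B2 + 20) * Z ^ Suc k + (a + 22) * Z ^ Suc k"
    using mult_le_mono2[OF p(2), of "B1 + B2 + 20"] by (rule add_mono[rotated])
  then have "B1 + B2 + l * (B + 22) + 20 \<le> (B1 + B2 + 20) * Z ^ Suc k + (a + 22) * Z ^ Suc k"
    by (simp only: mult_1_right mult_1_left ac_simps)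
  also have "\<dots> = (a + B1 + B2 + 42) * Z ^ Suc k" by (simp add: algebra_simps)
  also have "\<dots> \<le> C * Z ^ Suc k" using assms(4) by (rule mult_le_mono1)
  finally show ?thesis .
qed

lemma yields_fold:
  fixes Z :: nat
  assumes l: "yields (run l env) (return_pmf (enc_list e xs)) B1"
    and a: "yields (run i env) (return_pmf (r a)) B2"
    and "I xs a"
    and step: "\<And>x xs a. I (x # xs) a \<Longrightarrow>
      yields (run p (VPair (r a) (VPair (e x) env))) (map_pmf r (F x a)) B"
    and inv: "\<And>x xs a b. I (x # xs) a \<Longrightarrow> b \<in> set_pmf (F x a) \<Longrightarrow> I xs b"
    and bound: "length xs \<le> Z" "1 \<le> Z" "B \<le> B' * Z ^ k" "B' + B1 + B2 + 42 \<le> C" "K = Suc k"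
  shows "yields (run (fold_prog l i p) env) (map_pmf r (foldM F xs a)) (C * Z ^ K)"
proof -
  have "yields (run (Mk_Pair i Skip) env) (return_pmf (VPair (r a) env)) (B2 + 2)"
    using yields_Mk_Pair[OF a yields_returnI[of "run Skip env" env 1 1]] by (simp add: bind_return_pmf)
  from yields_Mk_Pair[OF l this]
  have 1: "yields (run (Mk_Pair l (Mk_Pair i Skip)) env)
      (return_pmf (VPair (enc_list e xs) (VPair (r a) env))) (B1 + B2 + 3)"
    by (rule yields_mono) (auto simp: bind_return_pmf)
  have 2: "yields (run (Seq (While Head (fold_body p)) (Seq Tail Head)) (VPair (enc_list e xs) (VPair (r a) env)))
     (bind_pmf (map_pmf (\<lambda>a. VPair VNil (VPair (r a) env)) (foldM F xs a))
       (\<lambda>v. return_pmf (head_val (tail_val v)))) ((length xs * (B + 22) + 2) + 3 + 1)"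
    by (rule yields_Seq, rule yields_fold_loop[where I = I and F = F])
      (use assms in \<open>auto intro!: yields_return\<close>)
  show ?thesis
    unfolding fold_prog_def
    by (rule yields_mono[OF yields_Seq_det[OF 1 2]])
      (use loop_bound[OF bound(1-4)] bound(5) in \<open>auto simp: map_pmf_def bind_return_pmf bind_assoc_pmf\<close>)
qed

lemma yields_fold_det:
  fixes Z :: nat
  assumes "yields (run l env) (return_pmf (enc_list e xs)) B1"
    and "yields (run i env) (return_pmf (r a)) B2"
    and "I xs a"
    and "\<And>x xs a. I (x # xs) a \<Longrightarrow>
      yields (run p (VPair (r a) (VPair (e x) env))) (return_pmf (r (g x a))) B"
    and "\<And>x xs a. I (x # xs) a \<Longrightarrow> I xs (g x a)"
    and "length xs \<le> Z" "1 \<le> Z" "B \<le> B' * Z ^ k" "B' + B1 + B2 + 42 \<le> C" "K = Suc k"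
  shows "yields (run (fold_prog l i p) env) (return_pmf (r (fold g xs a))) (C * Z ^ K)"
  using yields_fold[where I = I and F = "\<lambda>x a. return_pmf (g x a)" and e = e and r = r, OF assms(1-3) _ _ assms(6-10)] assms(4,5)
  by (simp add: foldM_return)

fun var :: "nat \<Rightarrow> prog" where
  "var 0 = Head"
| "var (Suc k) = Seq Tail (var k)"

section \<open>Distances in level trees\<close>

lemma walk_length_Cons: "p \<noteq> [] \<Longrightarrow> walk_length T (u # p) = edge_weight T u (hd p) + walk_length T p"
  by (cases p) (auto simp: walk_length_def)

lemma walk_length_snoc:
  "p \<noteq> [] \<Longrightarrow> walk_length T (p @ [v]) = walk_length T p + edge_weight T (last p) v"
proof (induction p)
  case (Cons x p)
  then show ?case
    by (cases "p = []") (auto simp: walk_length_Cons walk_length_def[of T "[_]"])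
qed simp

text \<open>Potential differences telescope along a walk. This is the dual certificate for shortest
  paths, used for the lower bound on tree distances.\<close>

lemma walk_length_ge_potential:
  assumes edge: "\<And>x y. tree_edge T x y \<Longrightarrow> \<phi> y - \<phi> x \<le> edge_weight T x y"
    and "p \<in> tree_walks T u v"
  shows "\<phi> v - \<phi> u \<le> walk_length T p"
proof -
  have "p \<noteq> [] \<Longrightarrow> successively (tree_edge T) p \<Longrightarrow> \<phi> (last p) - \<phi> (hd p) \<le> walk_length T p"
  proof (induction p)
    case (Cons x p)
    show ?case
    proof (cases "p = []")
      case True
      then show ?thesis by (simp add: walk_length_def)
    next
      case False
      then have "tree_edge T x (hd p)" "successively (tree_edge T) p"
        using Cons.prems by (cases p; simp)+
      with Cons.IH False edge[of x "hd p"] show ?thesis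
        by (simp add: walk_length_Cons)
    qed
  qed simp
  with assms(2) show ?thesis unfolding tree_walks_def by auto
qed

text \<open>The numbering makes the tree checkable locally: points below \<open>n\<close>, root
  \<open>n\<close>, inner vertices above it, each with a larger number than its parent. Hence
  inductions along parents are inductions on numbers, and \<open>child\<close> leaves the points as
  the only leaves.\<close>

locale level_tree =
  fixes lam :: real and n L m :: nat and par lev :: "nat \<Rightarrow> nat"
  assumes lam: "lam > 1" and n: "1 \<le> n" and L: "1 \<le> L" and nm: "n < m"
    and root: "par n = n" "lev n = L"
    and point: "v < n \<Longrightarrow> lev v = 0 \<and> n \<le> par v \<and> par v < m \<and> lev (par v) = 1"
    and inner: "n < v \<Longrightarrow> v < m \<Longrightarrow> n \<le> par v \<and> par v < v \<and> lev (par v) = Suc (lev v) \<and> 1 \<le> lev v"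
    and child: "n \<le> v \<Longrightarrow> v < m \<Longrightarrow> \<exists>x<m. x \<noteq> n \<and> par x = v"
begin

definition tree :: wtree where
  "tree = \<lparr>num_vertices = m, root_vertex = n, parent = par, weight = (\<lambda>v. if v = n then 0 else lam ^ lev v)\<rparr>"

lemma tree_simps [simp]:
  "num_vertices tree = m" "root_vertex tree = n" "parent tree = par"
  "weight tree v = (if v = n then 0 else lam ^ lev v)"
  by (simp_all add: tree_def)

lemma par_less: "v < m \<Longrightarrow> par v < m"
  using point[of v] inner[of v] root nm by (cases v n rule: linorder_cases) auto

lemma par_ge: "v < m \<Longrightarrow> n \<le> par v"
  using point[of v] inner[of v] root nm by (cases v n rule: linorder_cases) auto

lemma lev_par: "v < m \<Longrightarrow> v \<noteq> n \<Longrightarrow> lev (par v) = Suc (lev v)"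
  using point[of v] inner[of v] by (cases v n rule: linorder_cases) auto

lemma lev_le: "v < m \<Longrightarrow> lev v \<le> L \<and> (lev v = L \<longleftrightarrow> v = n)"
proof (induction v rule: less_induct)
  case (less v)
  show ?case
  proof (cases v n rule: linorder_cases)
    case greater
    with inner[of v] less.prems have "par v < v" "lev (par v) = Suc (lev v)" by auto
    moreover from this have "lev (par v) \<le> L" using less.IH[of "par v"] less.prems by auto
    ultimately show ?thesis using greater by auto
  qed (use point[of v] root L in auto)
qed

lemma funpow_par_less: "v < m \<Longrightarrow> (par ^^ k) v < m"
  by (induction k) (auto simp: par_less)

text \<open>The minimum appears because the root is its own parent, so that climbing further stays
  at level \<open>L\<close>.\<close>

lemma lev_funpow: "v < m \<Longrightarrow> lev ((par ^^ k) v) = min L (lev v + k)"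
proof (induction k)
  case 0
  then show ?case using lev_le by simp
next
  case (Suc k)
  let ?w = "(par ^^ k) v"
  have "?w < m" using Suc by (simp add: funpow_par_less)
  then show ?case
    using Suc lev_par[of ?w] lev_le[of ?w] root by (cases "?w = n") auto
qed

lemma funpow_eq_root_iff: "v < m \<Longrightarrow> (par ^^ k) v = n \<longleftrightarrow> L \<le> lev v + k"
  using lev_funpow[of v k] lev_le[of "(par ^^ k) v"] funpow_par_less[of v k] by auto

lemma depth_tree: "v < m \<Longrightarrow> depth tree v = L - lev v"
  unfolding depth_def tree_simps
  by (rule Least_equality) (auto simp: funpow_eq_root_iff)

lemma leaves_tree: "leaves tree = {..<n}"
proof -
  have "\<exists>x<m. x \<noteq> n \<and> par x = v" if "v < m" "\<not> v < n" for v using child that by auto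
  moreover have "par u \<noteq> v" if "u < m" "v < n" for u v using par_ge[OF that(1)] that by auto
  ultimately show ?thesis using nm unfolding leaves_def by fastforce
qed

lemma is_wtree_tree: "is_wtree tree"
  unfolding is_wtree_def tree_simps
  using nm root lam by (auto simp: par_less funpow_eq_root_iff intro!: exI[of _ L])

lemma is_hst_tree: "is_hst lam L tree"
proof -
  have "level L tree v = lev v" if "v < m" for v
    using lev_le[OF that] depth_tree[OF that] by (simp add: level_def)
  moreover have "depth tree v = L" if "v \<in> leaves tree" for v
    using that point[of v] depth_tree[of v] nm unfolding leaves_tree by auto
  ultimately show ?thesis
    unfolding is_hst_def using lam L is_wtree_tree by simp
qed

lemma tree_edge_cases:
  assumes "tree_edge tree x y"
  obtains (up) "x < m" "x \<noteq> n" "y = par x" "edge_weight tree x y = lam ^ lev x"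
  | (down) "y < m" "y \<noteq> n" "x = par y" "edge_weight tree x y = lam ^ lev y"
proof (cases "x \<noteq> n \<and> par x = y")
  case True
  then show ?thesis using assms that(1) by (auto simp: tree_edge_def edge_weight_def)
next
  case False
  then have "y < m" "y \<noteq> n" "x = par y" "edge_weight tree x y = lam ^ lev y"
    using assms unfolding tree_edge_def edge_weight_def tree_simps by auto
  then show ?thesis by (rule that(2))
qed

lemma edge_up: "x < m \<Longrightarrow> x \<noteq> n \<Longrightarrow> tree_edge tree x (par x) \<and> edge_weight tree x (par x) = lam ^ lev x"
  by (auto simp: tree_edge_def edge_weight_def par_less)

lemma edge_down: "x < m \<Longrightarrow> x \<noteq> n \<Longrightarrow> tree_edge tree (par x) x \<and> edge_weight tree (par x) x = lam ^ lev x"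
  \<comment> \<open>Levels rule out the upward branch of \<open>edge_weight\<close>: it would
    require \<open>par (par x) = x\<close>, although two steps to a parent raise the level by
    2.\<close>
  using lev_par[of x] lev_par[of "par x"] par_less[of x]
  by (auto simp: tree_edge_def edge_weight_def)

definition height :: "nat \<Rightarrow> real" where
  "height j = (\<Sum>i<j. lam ^ i)"

lemma height_Suc: "height (Suc j) = height j + lam ^ j"
  by (simp add: height_def)

text \<open>The walk grows by one edge at both ends as the induction passes from the parents to
  \<open>u\<close> and \<open>v\<close>; this is why the start level \<open>i\<close> is general.
  The bound is an inequality because the branches may meet earlier.\<close>

lemma walk_through_ancestor:
  assumes "u < m" "v < m" "lev u = i" "lev v = i" "(par ^^ k) u = (par ^^ k) v"
  shows "\<exists>p\<in>tree_walks tree u v. walk_length tree p \<le> 2 * (\<Sum>l=i..<i+k. lam ^ l)"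
  using assms
proof (induction k arbitrary: u v i)
  case 0
  then show ?case
    by (intro bexI[of _ "[u]"]) (auto simp: tree_walks_def walk_length_def)
next
  case (Suc k)
  show ?case
  proof (cases "u = v")
    case True
    have "0 \<le> (\<Sum>l=i..<i+Suc k. lam ^ l)" using lam by (intro sum_nonneg) simp
    with True show ?thesis
      by (intro bexI[of _ "[u]"]) (auto simp: tree_walks_def walk_length_def)
  next
    case False
    \<comment> \<open>Only the root has level \<open>L\<close>, so two different vertices of equal
      level are both below it.\<close>
    then have neq: "u \<noteq> n" "v \<noteq> n" using Suc.prems lev_le[of u] lev_le[of v] by auto
    have "(par ^^ k) (par u) = (par ^^ k) (par v)"
      using Suc.prems(5) by (simp add: funpow_swap1)
    then obtain p where p: "p \<in> tree_walks tree (par u) (par v)"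
      "walk_length tree p \<le> 2 * (\<Sum>l=Suc i..<Suc i+k. lam ^ l)"
      using Suc.IH[of "par u" "par v" "Suc i"] Suc.prems neq by (auto simp: par_less lev_par)
    have p': "p \<noteq> []" "hd p = par u" "last p = par v" "successively (tree_edge tree) p"
      using p by (auto simp: tree_walks_def)
    have eu: "tree_edge tree u (par u)" "edge_weight tree u (par u) = lam ^ i"
      and ev: "tree_edge tree (par v) v" "edge_weight tree (par v) v = lam ^ i"
      using edge_up[of u] edge_down[of v] Suc.prems neq by auto
    have "walk_length tree (u # p @ [v]) = 2 * lam ^ i + walk_length tree p"
      using p' eu ev by (simp add: walk_length_Cons walk_length_snoc)
    also have "\<dots> \<le> 2 * (\<Sum>l=i..<i+Suc k. lam ^ l)"
      using p(2) sum.atLeast_Suc_lessThan[of i "i + Suc k" "\<lambda>l. lam ^ l"]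
      by (simp del: sum.op_ivl_Suc)
    finally have "walk_length tree (u # p @ [v]) \<le> 2 * (\<Sum>l=i..<i+Suc k. lam ^ l)" .
    moreover have "u # p @ [v] \<in> tree_walks tree u v"
      using p' eu ev by (auto simp: tree_walks_def successively_Cons successively_append_iff)
    ultimately show ?thesis by blast
  qed
qed

lemma walk_length_nonneg: "p \<in> tree_walks tree u v \<Longrightarrow> 0 \<le> walk_length tree p"
  using walk_length_ge_potential[of tree "\<lambda>_. 0" p u v] lam
  by (fastforce elim: tree_edge_cases)

lemma tree_dist_le:
  assumes "u < n" "v < n" "(par ^^ j) u = (par ^^ j) v"
  shows "tree_dist tree u v \<le> 2 * height j"
proof -
  obtain p where p: "p \<in> tree_walks tree u v" "walk_length tree p \<le> 2 * height j"
    using walk_through_ancestor[of u v 0 j] assms point nm by (auto simp: height_def atLeast0LessThan)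
  have "tree_dist tree u v \<le> walk_length tree p"
    unfolding tree_dist_def
    by (rule cINF_lower[OF bdd_belowI2[of _ 0] p(1)]) (rule walk_length_nonneg)
  with p show ?thesis by simp
qed

lemma tree_walks_nonempty: "u < n \<Longrightarrow> v < n \<Longrightarrow> tree_walks tree u v \<noteq> {}"
  using walk_through_ancestor[of u v 0 L] point nm funpow_eq_root_iff[of u L] funpow_eq_root_iff[of v L]
  by auto

lemma tree_dist_nonneg: "u < n \<Longrightarrow> v < n \<Longrightarrow> 0 \<le> tree_dist tree u v"
  unfolding tree_dist_def by (rule cINF_greatest) (auto simp: tree_walks_nonempty walk_length_nonneg)

lemma tree_dist_refl: "u < n \<Longrightarrow> tree_dist tree u u = 0"
  using tree_dist_le[of u u 0] tree_dist_nonneg[of u u] by (simp add: height_def)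

text \<open>
  Lower bound: a potential that grows along edges by at most their weight, from \<open>0\<close> at \<open>u\<close> up the
  subtree of the ancestor \<open>A\<close> of \<open>u\<close> and from there on down all the branches outside it.
\<close>

lemma tree_dist_ge:
  assumes "u < n" "v < n" "Suc j \<le> L" "(par ^^ j) u \<noteq> (par ^^ j) v"
  shows "2 * height (Suc j) \<le> tree_dist tree u v"
proof -
  define A where "A = (par ^^ j) u"
  define below where "below x \<longleftrightarrow> lev x \<le> j \<and> (par ^^ (j - lev x)) x = A" for x
  define \<phi> where "\<phi> x = (if below x then height (lev x) else 2 * height (Suc j) - height (lev x))" for x
  have \<phi>_par: "\<phi> (par x) - \<phi> x \<le> lam ^ lev x \<and> \<phi> x - \<phi> (par x) \<le> lam ^ lev x"
    if x: "x < m" "x \<noteq> n" for x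
  proof -
    have lp: "lev (par x) = Suc (lev x)" using lev_par x by blast
    have pos: "lam ^ lev x > 0" using lam by simp
    have f: "(par ^^ (j - lev x)) x = (par ^^ (j - Suc (lev x))) (par x)" if "Suc (lev x) \<le> j"
      using that by (metis Suc_diff_le comp_apply diff_Suc_Suc funpow_Suc_right)
    \<comment> \<open>The edge above \<open>A\<close> is the only one that leaves the subtree. There
      the potential passes from \<open>height j\<close> to
      \<open>2 * height (Suc j) - height (Suc j)\<close>, a step of exactly \<open>lam ^ j\<close>,
      so the two branches of \<open>\<phi>\<close> fit together.\<close>
    consider "below x" "lev x = j" | "below x" "lev x < j" | "\<not> below x"
      unfolding below_def by force
    then show ?thesis
    proof cases
      case 1
      then have "\<not> below (par x)" unfolding below_def using lp by linarith
      with 1 lp pos show ?thesis by (simp add: \<phi>_def height_Suc)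
    next
      case 2
      then have "below (par x)" using f by (simp add: below_def lp)
      with 2 lp pos show ?thesis by (simp add: \<phi>_def height_Suc)
    next
      case 3
      then have "\<not> below (par x)" using f by (auto simp: below_def lp)
      with 3 lp pos show ?thesis by (simp add: \<phi>_def height_Suc)
    qed
  qed
  have "\<phi> y - \<phi> x \<le> edge_weight tree x y" if "tree_edge tree x y" for x y
    using that by (cases rule: tree_edge_cases) (use \<phi>_par in auto)
  then have "\<phi> v - \<phi> u \<le> walk_length tree p" if "p \<in> tree_walks tree u v" for p
    using walk_length_ge_potential that by blast
  moreover have "lev u = 0" "lev v = 0" using point assms by auto
  then have "\<phi> u = 0" "\<phi> v = 2 * height (Suc j)"
    using assms(4) by (auto simp: \<phi>_def below_def A_def height_def)
  ultimately show ?thesis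
    unfolding tree_dist_def
    by (intro cINF_greatest tree_walks_nonempty assms) auto
qed

end

section \<open>Tries\<close>

type_synonym trie = "nat \<times> (nat \<Rightarrow> nat) \<times> (nat \<Rightarrow> nat) \<times> (nat \<Rightarrow> nat)"

text \<open>
  A trie \<open>(m, par, cen, lev)\<close> has the points below \<open>n\<close> as leaves, the root \<open>n\<close> and inner vertices below
  \<open>m\<close>, each identified by its parent and the label \<open>cen\<close> of the edge to it. The root has label \<open>n\<close>, so
  that it is not found as a child; \<open>0\<close> stands for no child.
\<close>

definition find_child :: "nat \<Rightarrow> nat \<Rightarrow> nat \<Rightarrow> trie \<Rightarrow> nat" where
  "find_child n k cur = (\<lambda>(m, par, cen, lev).
     fold (\<lambda>i r. if par i = cur \<and> cen i = k then i else r) (rev [n..<m]) 0)"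

definition descend :: "nat \<Rightarrow> nat \<Rightarrow> nat \<Rightarrow> nat \<times> trie \<Rightarrow> nat \<times> trie" where
  "descend n k j = (\<lambda>(cur, m, par, cen, lev).
     let r = find_child n k cur (m, par, cen, lev) in
     if 0 < r then (r, m, par, cen, lev)
     else (m, Suc m, par(m := cur), cen(m := k), lev(m := j)))"

text \<open>The labels fix the path from the root down to level 1. The point itself is hung below
  that vertex without a lookup, so points with equal labels on all levels still become different
  leaves.\<close>

definition insert_point :: "nat \<Rightarrow> nat \<Rightarrow> (nat \<Rightarrow> nat \<Rightarrow> nat) \<Rightarrow> nat \<Rightarrow> trie \<Rightarrow> trie" where
  "insert_point n L c u t = (case fold (\<lambda>j. descend n (c j u) j) (rev [1..<L]) (n, t) of
     (cur, m, par, cen, lev) \<Rightarrow> (m, par(u := cur), cen, lev))"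

definition build_trie :: "nat \<Rightarrow> nat \<Rightarrow> (nat \<Rightarrow> nat \<Rightarrow> nat) \<Rightarrow> trie" where
  "build_trie n L c = fold (insert_point n L c) [0..<n]
     (Suc n, \<lambda>_. n, \<lambda>_. n, \<lambda>v. if v = n then L else 0)"

lemma find_child_cases:
  assumes "1 \<le> n"
  shows "(find_child n k cur (m, par, cen, lev) = 0 \<and> (\<forall>i\<in>{n..<m}. \<not> (par i = cur \<and> cen i = k))) \<or>
    (\<exists>i\<in>{n..<m}. par i = cur \<and> cen i = k \<and> find_child n k cur (m, par, cen, lev) = i)"
proof -
  have "(fold (\<lambda>i r. if P i then i else r) xs r = r \<and> (\<forall>i\<in>set xs. \<not> P i)) \<or>
      (\<exists>i\<in>set xs. P i \<and> fold (\<lambda>i r. if P i then i else r) xs r = i)" for P and r :: nat and xs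
    by (induction xs arbitrary: r) (auto split: if_splits)
  from this[of "\<lambda>i. par i = cur \<and> cen i = k" "rev [n..<m]" 0]
  show ?thesis by (auto simp: find_child_def)
qed

text \<open>The points below \<open>k\<close> have been inserted, and every inner vertex but possibly \<open>ex\<close> has a child.\<close>

fun trie_inv :: "nat \<Rightarrow> nat \<Rightarrow> (nat \<Rightarrow> nat \<Rightarrow> nat) \<Rightarrow> nat \<Rightarrow> nat \<Rightarrow> trie \<Rightarrow> bool" where
  "trie_inv n L c k ex (m, par, cen, lev) \<longleftrightarrow>
     n < m \<and> par n = n \<and> cen n = n \<and> lev n = L \<and> (\<forall>v<n. lev v = 0) \<and>
     (\<forall>v<k. n \<le> par v \<and> par v < m \<and> lev (par v) = 1) \<and>
     (\<forall>v. n < v \<longrightarrow> v < m \<longrightarrow> n \<le> par v \<and> par v < v \<and> lev (par v) = Suc (lev v) \<and> 1 \<le> lev v) \<and>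
     (\<forall>v w. n < v \<longrightarrow> v < m \<longrightarrow> n < w \<longrightarrow> w < m \<longrightarrow> par v = par w \<longrightarrow> cen v = cen w \<longrightarrow> v = w) \<and>
     (\<forall>v. n \<le> v \<longrightarrow> v < m \<longrightarrow> v \<noteq> ex \<longrightarrow> (\<exists>x<m. x \<noteq> n \<and> (x < k \<or> n < x) \<and> par x = v)) \<and>
     (\<forall>u<k. \<exists>nd. nd 0 = u \<and> nd L = n \<and> (\<forall>j<L. par (nd j) = nd (Suc j)) \<and>
        (\<forall>j. 1 \<le> j \<longrightarrow> j < L \<longrightarrow> n < nd j \<and> nd j < m \<and> cen (nd j) = c j u))"

text \<open>The state in the middle of an insertion: \<open>trie_inv\<close> records branches of
  finished points only, and this is the upper part, from level \<open>j\<close> on, of the branch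
  under construction.\<close>

fun trie_path :: "nat \<Rightarrow> nat \<Rightarrow> (nat \<Rightarrow> nat \<Rightarrow> nat) \<Rightarrow> nat \<Rightarrow> nat \<Rightarrow> nat \<times> trie \<Rightarrow> bool" where
  "trie_path n L c u j (cur, m, par, cen, lev) \<longleftrightarrow>
     n \<le> cur \<and> cur < m \<and> lev cur = j \<and>
     (\<exists>nd. nd j = cur \<and> nd L = n \<and> (\<forall>i. j \<le> i \<longrightarrow> i < L \<longrightarrow>
        par (nd i) = nd (Suc i) \<and> n < nd i \<and> nd i < m \<and> cen (nd i) = c i u))"

lemma trie_invD:
  assumes "trie_inv n L c k ex (m, par, cen, lev)"
  shows trie_inv_root: "n < m" "par n = n" "cen n = n" "lev n = L"
    and trie_inv_point: "v < n \<Longrightarrow> lev v = 0"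
      "v < k \<Longrightarrow> n \<le> par v \<and> par v < m \<and> lev (par v) = 1"
    and trie_inv_inner: "n < v \<Longrightarrow> v < m \<Longrightarrow>
      n \<le> par v \<and> par v < v \<and> lev (par v) = Suc (lev v) \<and> 1 \<le> lev v"
    and trie_inv_inj: "n < v \<Longrightarrow> v < m \<Longrightarrow> n < w \<Longrightarrow> w < m \<Longrightarrow> par v = par w \<Longrightarrow> cen v = cen w \<Longrightarrow> v = w"
    and trie_inv_child: "n \<le> v \<Longrightarrow> v < m \<Longrightarrow> v \<noteq> ex \<Longrightarrow> \<exists>x<m. x \<noteq> n \<and> (x < k \<or> n < x) \<and> par x = v"
    and trie_inv_branch: "u < k \<Longrightarrow> \<exists>nd. nd 0 = u \<and> nd L = n \<and> (\<forall>j<L. par (nd j) = nd (Suc j)) \<and>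
        (\<forall>j. 1 \<le> j \<longrightarrow> j < L \<longrightarrow> n < nd j \<and> nd j < m \<and> cen (nd j) = c j u)"
  using assms unfolding trie_inv.simps by blast+

declare trie_inv.simps [simp del] trie_path.simps [simp del]

text \<open>The permitted childless vertex moves with the current one: after the step
  \<open>cur\<close> has a child, and only the vertex just entered may lack one.\<close>

lemma descend_inv:
  assumes n: "1 \<le> n" and c: "c j u < n" and "1 \<le> j" "j < L" and k: "k < n"
    and inv: "trie_inv n L c k (fst s) (snd s)" and path: "trie_path n L c u (Suc j) s"
  shows "trie_inv n L c k (fst (descend n (c j u) j s)) (snd (descend n (c j u) j s)) \<and>
    trie_path n L c u j (descend n (c j u) j s)"
proof -
  obtain cur m par cen lev where s: "s = (cur, m, par, cen, lev)" by (cases s)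
  from path obtain nd where cur: "n \<le> cur" "cur < m" "lev cur = Suc j" and
    nd: "nd (Suc j) = cur" "nd L = n" "\<And>i. Suc j \<le> i \<Longrightarrow> i < L \<Longrightarrow>
        par (nd i) = nd (Suc i) \<and> n < nd i \<and> nd i < m \<and> cen (nd i) = c i u"
    unfolding s trie_path.simps by blast
  note inv = inv[unfolded s fst_conv snd_conv]
  note root = trie_inv_root[OF inv] and point = trie_inv_point[OF inv] and inner = trie_inv_inner[OF inv]
    and inj = trie_inv_inj[OF inv] and child = trie_inv_child[OF inv] and branch = trie_inv_branch[OF inv]
  consider (none) "find_child n (c j u) cur (m, par, cen, lev) = 0"
      "\<And>i. n \<le> i \<Longrightarrow> i < m \<Longrightarrow> par i = cur \<Longrightarrow> cen i = c j u \<Longrightarrow> False"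
    | (some) r where "n \<le> r" "r < m" "par r = cur" "cen r = c j u"
        "find_child n (c j u) cur (m, par, cen, lev) = r"
    using find_child_cases[OF n, of "c j u" cur m par cen lev] by auto
  then show ?thesis
  proof cases
    case some
    have "r \<noteq> n" using some(4) c root by auto
    then have r: "n < r" "0 < r" using some n by auto
    have D: "descend n (c j u) j s = (r, m, par, cen, lev)"
      using some r by (simp add: descend_def s)
    have ch: "\<exists>x<m. x \<noteq> n \<and> (x < k \<or> n < x) \<and> par x = v" if "n \<le> v" "v < m" "v \<noteq> r" for v
      using child[OF that(1,2)] some r by (cases "v = cur") auto
    have "trie_inv n L c k r (m, par, cen, lev)"
      using inv unfolding trie_inv.simps
      by (elim conjE, intro conjI) (assumption | (intro allI impI, rule ch; assumption))+
    moreover have "lev (par r) = Suc (lev r)" using inner some r by auto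
    then have "lev r = j" using some cur by simp
    have "trie_path n L c u j (r, m, par, cen, lev)"
      unfolding trie_path.simps
    proof (intro conjI exI[of _ "nd(j := r)"] allI impI)
      fix i assume i: "j \<le> i" "i < L"
      show "par ((nd(j := r)) i) = (nd(j := r)) (Suc i)" "n < (nd(j := r)) i"
        "(nd(j := r)) i < m" "cen ((nd(j := r)) i) = c i u"
        using i nd(1) nd(3)[of i] r some by (cases "i = j"; force)+
    qed (use some \<open>lev r = j\<close> \<open>j < L\<close> nd in auto)
    ultimately show ?thesis unfolding D by simp
  next
    case none
    define par' cen' lev' where "par' = par(m := cur)" "cen' = cen(m := c j u)" "lev' = lev(m := j)"
    note defs = this
    have D: "descend n (c j u) j s = (m, Suc m, par', cen', lev')"
      using none by (simp add: descend_def s defs)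
    note nm = root(1)
    have eq: "par' v = par v" "cen' v = cen v" "lev' v = lev v" if "v \<noteq> m" for v using that by (auto simp: defs)
    have new: "par' m = cur" "cen' m = c j u" "lev' m = j" by (auto simp: defs)
    have "trie_path n L c u j (m, Suc m, par', cen', lev')"
      unfolding trie_path.simps
    proof (intro conjI exI[of _ "nd(j := m)"] allI impI)
      fix i assume i: "j \<le> i" "i < L"
      have *: "Suc j \<le> i \<Longrightarrow> nd i \<noteq> m" using nd(3)[of i] i by auto
      show "par' ((nd(j := m)) i) = (nd(j := m)) (Suc i)" "n < (nd(j := m)) i"
        "(nd(j := m)) i < Suc m" "cen' ((nd(j := m)) i) = c i u"
        using i * nd(1) nd(3)[of i] nm new eq[of "nd i"] by (cases "i = j"; force)+
    qed (use nm new \<open>j < L\<close> nd in auto)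
    moreover have "trie_inv n L c k m (Suc m, par', cen', lev')"
      unfolding trie_inv.simps
    proof (intro conjI allI impI)
      fix v assume "v < k" then have v: "v < m" "n \<le> par v" "par v < m" "lev (par v) = 1"
        using point k nm by auto
      then show "n \<le> par' v" "par' v < Suc m" "lev' (par' v) = 1" using eq by auto
    next
      fix v assume v: "n < v" "v < Suc m"
      show "n \<le> par' v" "par' v < v" "lev' (par' v) = Suc (lev' v)" "1 \<le> lev' v"
      proof -
        have "n \<le> par' v \<and> par' v < v \<and> lev' (par' v) = Suc (lev' v) \<and> 1 \<le> lev' v"
        proof (cases "v = m")
          case True
          then show ?thesis using new cur eq(3)[of cur] \<open>1 \<le> j\<close> by auto
        next
          case False
          then have "n \<le> par v" "par v < v" "lev (par v) = Suc (lev v)" "1 \<le> lev v" using inner[of v] v by auto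
          with False v show ?thesis using eq by auto
        qed
        then show "n \<le> par' v" "par' v < v" "lev' (par' v) = Suc (lev' v)" "1 \<le> lev' v" by auto
      qed
    next
      fix v w assume vw: "n < v" "v < Suc m" "n < w" "w < Suc m" "par' v = par' w" "cen' v = cen' w"
      show "v = w"
      proof (cases "v = m \<or> w = m")
        case True
        then show ?thesis using vw none(2)[of v] none(2)[of w] new eq[of v] eq[of w]
          by (cases "v = m"; cases "w = m") auto
      next
        case False
        then show ?thesis using vw eq[of v] eq[of w] inj[of v w] by auto
      qed
    next
      fix v assume v: "n \<le> v" "v < Suc m" "v \<noteq> m"
      show "\<exists>x<Suc m. x \<noteq> n \<and> (x < k \<or> n < x) \<and> par' x = v"
      proof (cases "v = cur")
        case True
        then show ?thesis using new nm by (intro exI[of _ m]) auto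
      next
        case False
        then obtain x where "x < m" "x \<noteq> n" "x < k \<or> n < x" "par x = v" using child[of v] v by auto
        then show ?thesis using eq by (intro exI[of _ x]) auto
      qed
    next
      fix u' assume u': "u' < k"
      then obtain nd where nd: "nd 0 = u'" "nd L = n" "\<forall>j<L. par (nd j) = nd (Suc j)"
        "\<forall>j. 1 \<le> j \<longrightarrow> j < L \<longrightarrow> n < nd j \<and> nd j < m \<and> cen (nd j) = c j u'"
        using branch by blast
      have "nd i < m" if "i < L" for i using that nd u' k nm by (cases "i = 0") auto
      then have "nd i \<noteq> m" if "i < L" for i using that by blast
      then show "\<exists>nd. nd 0 = u' \<and> nd L = n \<and> (\<forall>j<L. par' (nd j) = nd (Suc j)) \<and>
          (\<forall>j. 1 \<le> j \<longrightarrow> j < L \<longrightarrow> n < nd j \<and> nd j < Suc m \<and> cen' (nd j) = c j u')"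
        using nd eq by (intro exI[of _ nd]) auto
    qed (use root point nm eq in auto)
    ultimately show ?thesis unfolding D by simp
  qed
qed

lemma fold_descend_inv:
  assumes n: "1 \<le> n" and c: "\<And>i. c i u < n" and k: "k < n" and "j < L" "1 \<le> L"
    and inv: "trie_inv n L c k n t"
  shows "trie_inv n L c k (fst (fold (\<lambda>j. descend n (c j u) j) (rev [L-j..<L]) (n, t)))
      (snd (fold (\<lambda>j. descend n (c j u) j) (rev [L-j..<L]) (n, t))) \<and>
    trie_path n L c u (L-j) (fold (\<lambda>j. descend n (c j u) j) (rev [L-j..<L]) (n, t))"
  using \<open>j < L\<close>
proof (induction j)
  case 0
  obtain m par cen lev where t: "t = (m, par, cen, lev)" by (cases t)
  moreover have "trie_path n L c u L (n, m, par, cen, lev)"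
    using trie_inv_root[OF inv[unfolded t]] by (auto simp: trie_path.simps intro!: exI[of _ "\<lambda>_. n"])
  ultimately show ?case using inv by simp
next
  case (Suc j)
  then have *: "Suc (L - Suc j) = L - j" "L - Suc j < L" "1 \<le> L - Suc j" by auto
  then have "rev [L - Suc j..<L] = rev [L - j..<L] @ [L - Suc j]"
    by (simp add: upt_conv_Cons)
  then show ?case
    using Suc descend_inv[OF n, of c "L - Suc j" u L k "fold (\<lambda>j. descend n (c j u) j) (rev [L-j..<L]) (n, t)"]
      c k * by simp
qed

text \<open>The point becomes the child that the last vertex of the descent may lack, so the
  exception can be handed back to the root, where the next descent starts.\<close>

lemma insert_point_inv:
  assumes n: "1 \<le> n" and c: "\<And>i. c i k < n" and k: "k < n" and "1 \<le> L"
    and inv: "trie_inv n L c k n t"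
  shows "trie_inv n L c (Suc k) n (insert_point n L c k t)"
proof -
  obtain cur m par cen lev where
    F: "fold (\<lambda>j. descend n (c j k) j) (rev [1..<L]) (n, t) = (cur, m, par, cen, lev)"
    by (cases "fold (\<lambda>j. descend n (c j k) j) (rev [1..<L]) (n, t)")
  have inv: "trie_inv n L c k cur (m, par, cen, lev)" and path: "trie_path n L c k 1 (cur, m, par, cen, lev)"
    using fold_descend_inv[where j = "L - 1" and u = k, OF n _ k _ _ inv] c F \<open>1 \<le> L\<close> by simp_all
  note root = trie_inv_root[OF inv] and point = trie_inv_point[OF inv] and inner = trie_inv_inner[OF inv]
    and inj = trie_inv_inj[OF inv] and child = trie_inv_child[OF inv] and branch = trie_inv_branch[OF inv]
  define par' where "par' = par(k := cur)"
  have eq: "par' v = par v" if "v \<noteq> k" for v using that by (simp add: par'_def)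
  have [simp]: "par' k = cur" by (simp add: par'_def)
  note nm = root(1)
  from path obtain nd where cur: "n \<le> cur" "cur < m" "lev cur = 1" and
    nd: "nd 1 = cur" "nd L = n" "\<And>i. 1 \<le> i \<Longrightarrow> i < L \<Longrightarrow>
        par (nd i) = nd (Suc i) \<and> n < nd i \<and> nd i < m \<and> cen (nd i) = c i k"
    unfolding trie_path.simps by blast
  have "trie_inv n L c (Suc k) n (m, par', cen, lev)"
    unfolding trie_inv.simps
  proof (intro conjI allI impI)
    fix v assume "v < Suc k"
    then have "n \<le> par' v \<and> par' v < m \<and> lev (par' v) = 1"
      using cur point(2)[of v] eq[of v] by (cases "v = k") auto
    then show "n \<le> par' v" "par' v < m" "lev (par' v) = 1" by auto
  next
    fix v assume v: "n < v" "v < m"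
    then have "n \<le> par v \<and> par v < v \<and> lev (par v) = Suc (lev v) \<and> 1 \<le> lev v" using inner by blast
    then show "n \<le> par' v" "par' v < v" "lev (par' v) = Suc (lev v)" "1 \<le> lev v" using v k eq by auto
  next
    fix v w assume vw: "n < v" "v < m" "n < w" "w < m" "par' v = par' w" "cen v = cen w"
    then show "v = w" using eq[of v] eq[of w] k inj[of v w] by auto
  next
    fix v assume v: "n \<le> v" "v < m" "v \<noteq> n"
    show "\<exists>x<m. x \<noteq> n \<and> (x < Suc k \<or> n < x) \<and> par' x = v"
    proof (cases "v = cur")
      case True
      then show ?thesis using nm k by (intro exI[of _ k]) auto
    next
      case False
      then obtain x where "x < m" "x \<noteq> n" "x < k \<or> n < x" "par x = v" using child[of v] v by auto
      then show ?thesis using eq k by (intro exI[of _ x]) auto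
    qed
  next
    fix u assume u: "u < Suc k"
    show "\<exists>nd. nd 0 = u \<and> nd L = n \<and> (\<forall>j<L. par' (nd j) = nd (Suc j)) \<and>
          (\<forall>j. 1 \<le> j \<longrightarrow> j < L \<longrightarrow> n < nd j \<and> nd j < m \<and> cen (nd j) = c j u)"
    proof (cases "u = k")
      case True
      define nd' where "nd' = nd(0 := k)"
      have nd': "nd' 0 = k" "\<And>j. 1 \<le> j \<Longrightarrow> nd' j = nd j" by (auto simp: nd'_def)
      have "par' (nd' j) = nd' (Suc j)" if "j < L" for j
      proof (cases "j = 0")
        case False
        then have "nd j \<noteq> k" using nd(3)[of j] that k by auto
        with False that show ?thesis using nd(3)[of j] nd'(2)[of j] nd'(2)[of "Suc j"] eq by auto
      qed (use nd nd' in auto)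
      moreover have "nd' L = n" using nd'(2)[of L] nd \<open>1 \<le> L\<close> by simp
      moreover have "n < nd' j \<and> nd' j < m \<and> cen (nd' j) = c j u" if "1 \<le> j" "j < L" for j
        using nd(3)[of j] nd'(2)[of j] that True by auto
      ultimately show ?thesis using nd'(1) True by (intro exI[of _ nd']) auto
    next
      case False
      then have "u < k" using u by simp
      then obtain nd where nd: "nd 0 = u" "nd L = n" "\<forall>j<L. par (nd j) = nd (Suc j)"
        "\<forall>j. 1 \<le> j \<longrightarrow> j < L \<longrightarrow> n < nd j \<and> nd j < m \<and> cen (nd j) = c j u"
        using branch by blast
      have "nd j \<noteq> k" if "j < L" for j
        using nd(1) nd(4)[rule_format, of j] \<open>u < k\<close> k that by (cases "j = 0") auto
      then show ?thesis using nd eq by (intro exI[of _ nd]) auto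
    qed
  qed (use root point nm k eq[of n] in auto)
  then show ?thesis using F by (simp add: insert_point_def par'_def)
qed

lemma build_trie_inv:
  assumes n: "1 \<le> n" and c: "\<And>i u. u < n \<Longrightarrow> c i u < n" and "1 \<le> L"
  shows "trie_inv n L c n n (build_trie n L c)"
proof -
  have "k \<le> n \<Longrightarrow> trie_inv n L c k n (fold (insert_point n L c) [0..<k]
     (Suc n, \<lambda>_. n, \<lambda>_. n, \<lambda>v. if v = n then L else 0))" for k
  proof (induction k)
    case (Suc k)
    then show ?case using insert_point_inv[OF n, of c k L] c \<open>1 \<le> L\<close> by simp
  qed (auto simp: trie_inv.simps)
  then show ?thesis by (simp add: build_trie_def)
qed

text \<open>The second claim has two directions. A shared ancestor gives shared ancestors above it
  and thus equal labels; conversely, two branches start together at the root and, as siblings have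
  different labels, cannot part while the labels agree. It starts at level 1 because the leaves are
  separate anyway.\<close>

lemma build_trie_level_tree:
  assumes "lam > 1" "1 \<le> n" "\<And>i u. u < n \<Longrightarrow> c i u < n" "1 \<le> L"
    and B: "build_trie n L c = (m, par, cen, lev)"
  shows "level_tree lam n L m par lev"
    and "\<And>u v j. u < n \<Longrightarrow> v < n \<Longrightarrow> 1 \<le> j \<Longrightarrow> j \<le> L \<Longrightarrow>
      (par ^^ j) u = (par ^^ j) v \<longleftrightarrow> (\<forall>i. j \<le> i \<longrightarrow> i < L \<longrightarrow> c i u = c i v)"
proof -
  have inv: "trie_inv n L c n n (m, par, cen, lev)"
    using build_trie_inv[of n c L] assms by simp
  note root = trie_inv_root[OF inv] and point = trie_inv_point[OF inv] and inner = trie_inv_inner[OF inv]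
    and inj = trie_inv_inj[OF inv]
  have path: "\<exists>nd. nd 0 = u \<and> nd L = n \<and> (\<forall>j<L. par (nd j) = nd (Suc j)) \<and>
        (\<forall>j. 1 \<le> j \<longrightarrow> j < L \<longrightarrow> n < nd j \<and> nd j < m \<and> cen (nd j) = c j u)" if "u < n" for u
    using trie_inv_branch[OF inv that] .
  have child: "\<exists>x<m. x \<noteq> n \<and> par x = v" if v: "n \<le> v" "v < m" for v
  proof (cases "v = n")
    case True
    \<comment> \<open>The root gets its child from the branch of point 0: the vertex at level
      \<open>L - 1\<close>, which is the point itself if \<open>L = 1\<close>.\<close>
    obtain nd where nd: "nd 0 = 0" "nd L = n" "\<forall>j<L. par (nd j) = nd (Suc j)"
        "\<forall>j. 1 \<le> j \<longrightarrow> j < L \<longrightarrow> n < nd j \<and> nd j < m \<and> cen (nd j) = c j 0"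
      using path[of 0] assms(2) by auto
    have "par (nd (L - 1)) = n" using nd(2,3) \<open>1 \<le> L\<close> by (metis Suc_diff_1 diff_less less_numeral_extra(1) less_le_trans zero_less_one)
    moreover have "nd (L - 1) < m \<and> nd (L - 1) \<noteq> n"
      using nd(1) nd(4)[rule_format, of "L - 1"] assms(2,4) v by (cases "L = 1") force+
    ultimately show ?thesis using True by auto
  next
    case False
    then show ?thesis using trie_inv_child[OF inv v] by auto
  qed
  show "level_tree lam n L m par lev"
    by unfold_locales (use assms(1,2,4) root point inner child in auto)
  fix u v j assume uv: "u < n" "v < n" "1 \<le> j" "j \<le> L"
  obtain a where a: "a 0 = u" "a L = n" "\<forall>j<L. par (a j) = a (Suc j)"
        "\<forall>j. 1 \<le> j \<longrightarrow> j < L \<longrightarrow> n < a j \<and> a j < m \<and> cen (a j) = c j u" using path[OF uv(1)] by auto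
  obtain b where b: "b 0 = v" "b L = n" "\<forall>j<L. par (b j) = b (Suc j)"
        "\<forall>j. 1 \<le> j \<longrightarrow> j < L \<longrightarrow> n < b j \<and> b j < m \<and> cen (b j) = c j v" using path[OF uv(2)] by auto
  have "i \<le> L \<Longrightarrow> (par ^^ i) u = a i \<and> (par ^^ i) v = b i" for i
    by (induction i) (use a b in auto)
  then have ab: "(par ^^ j) u = (par ^^ j) v \<longleftrightarrow> a j = b j" using uv by auto
  have 1: "a i = b i" if "a j = b j" "j \<le> i" "i \<le> L" for i
    using that(2,3,1) by (induction i rule: dec_induct) (use a b in \<open>auto\<close>, metis a(3) b(3) Suc_le_lessD)
  have 2: "a j = b j" if "\<forall>i. j \<le> i \<longrightarrow> i < L \<longrightarrow> c i u = c i v"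
    using \<open>j \<le> L\<close>
  proof (induction rule: inc_induct)
    case (step i)
    then show ?case using inj[of "a i" "b i"] a(3,4) b(3,4) that uv(3) by auto
  qed (use a b in simp)
  show "(par ^^ j) u = (par ^^ j) v \<longleftrightarrow> (\<forall>i. j \<le> i \<longrightarrow> i < L \<longrightarrow> c i u = c i v)"
    unfolding ab using 1 2 a(4) b(4) uv(3) by (metis less_imp_le le_trans)
qed

section \<open>Random bits and random permutations\<close>

lemma foldM_append: "foldM F (xs @ ys) a = bind_pmf (foldM F xs a) (foldM F ys)"
  by (induction xs arbitrary: a) (auto simp: bind_return_pmf bind_assoc_pmf intro!: bind_pmf_cong)

lemma foldM_single [simp]: "foldM F [x] = F x"
proof -
  have "foldM F [] = return_pmf" by (rule ext) simp
  then show ?thesis by (intro ext) (simp add: bind_return_pmf')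
qed

text \<open>Each new bit becomes the leading one, so that no power of two has to be carried
  along.\<close>

definition bit_step :: "'x \<Rightarrow> real \<Rightarrow> real pmf" where
  "bit_step _ b = map_pmf (\<lambda>c. (b + of_bool c) / 2) (bernoulli_pmf (1 / 2))"

definition random_bits :: "nat \<Rightarrow> real pmf" where
  "random_bits k = foldM bit_step [0..<k] 0"

lemma foldM_bit_step: "foldM bit_step xs b = foldM bit_step [0..<length xs] b"
proof (induction xs rule: rev_induct)
  case (snoc x xs)
  have "bit_step x = bit_step (length xs)" by (rule ext) (simp add: bit_step_def)
  with snoc show ?case by (simp add: foldM_append)
qed simp

lemma random_bits_0: "random_bits 0 = return_pmf 0"
  by (simp add: random_bits_def)

lemma random_bits_Suc: "random_bits (Suc k) =
  bind_pmf (bernoulli_pmf (1/2)) (\<lambda>c. map_pmf (\<lambda>b. (b + of_bool c) / 2) (random_bits k))"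
proof -
  have "random_bits (Suc k) = bind_pmf (random_bits k) (\<lambda>b. map_pmf (\<lambda>c. (b + of_bool c) / 2) (bernoulli_pmf (1/2)))"
    by (simp add: random_bits_def foldM_append bit_step_def[abs_def])
  also have "\<dots> = bind_pmf (random_bits k) (\<lambda>b. bind_pmf (bernoulli_pmf (1/2)) (\<lambda>c. return_pmf ((b + of_bool c) / 2)))"
    by (simp add: map_pmf_def)
  also have "\<dots> = bind_pmf (bernoulli_pmf (1/2)) (\<lambda>c. bind_pmf (random_bits k) (\<lambda>b. return_pmf ((b + of_bool c) / 2)))"
    by (rule bind_commute_pmf)
  finally show ?thesis by (simp add: map_pmf_def)
qed

lemma set_random_bits: "b \<in> set_pmf (random_bits k) \<Longrightarrow> 0 \<le> b \<and> b < 1"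
  by (induction k arbitrary: b) (fastforce simp: random_bits_0 random_bits_Suc)+

lemma finite_random_bits: "finite (set_pmf (random_bits k))"
  by (induction k) (auto simp: random_bits_0 random_bits_Suc)

lemma nn_integral_fair_coin:
  assumes "\<And>c. 0 \<le> g c"
  shows "(\<integral>\<^sup>+c. ennreal (g c) \<partial>bernoulli_pmf (1/2)) = ennreal ((g False + g True) / 2)"
proof -
  have "(\<integral>\<^sup>+c. ennreal (g c) \<partial>bernoulli_pmf (1/2)) = ennreal (measure_pmf.expectation (bernoulli_pmf (1/2)) g)"
    using assms by (intro nn_integral_eq_integral integrable_measure_pmf_finite) auto
  then show ?thesis by (simp add: field_simps)
qed

text \<open>Self-similarity: given the leading bit, the law is a copy of the previous one at half
  scale, on the left or the right half of the unit interval.\<close>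

lemma random_bits_cdf_Suc:
  "measure (random_bits (Suc k)) {..<y} =
    (measure (random_bits k) {..<2 * y} + measure (random_bits k) {..<2 * y - 1}) / 2"
proof -
  have "ennreal (measure (random_bits (Suc k)) {..<y}) =
     (\<integral>\<^sup>+c. ennreal (measure_pmf.prob (map_pmf (\<lambda>b. (b + of_bool c) / 2) (random_bits k)) {..<y}) \<partial>bernoulli_pmf (1/2))"
    unfolding random_bits_Suc measure_pmf.emeasure_eq_measure[symmetric] by simp
  also have "\<dots> = ennreal ((measure_pmf.prob (map_pmf (\<lambda>b. (b + of_bool False) / 2) (random_bits k)) {..<y} +
      measure_pmf.prob (map_pmf (\<lambda>b. (b + of_bool True) / 2) (random_bits k)) {..<y}) / 2)"
    by (rule nn_integral_fair_coin) simp
  also have "measure_pmf.prob (map_pmf (\<lambda>b. (b + of_bool False) / 2) (random_bits k)) {..<y} =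
      measure (random_bits k) {..<2 * y}"
    unfolding measure_map_pmf by (rule arg_cong[where f = "measure_pmf.prob _"]) auto
  also have "measure_pmf.prob (map_pmf (\<lambda>b. (b + of_bool True) / 2) (random_bits k)) {..<y} =
      measure (random_bits k) {..<2 * y - 1}"
    unfolding measure_map_pmf by (rule arg_cong[where f = "measure_pmf.prob _"]) auto
  finally show ?thesis by (simp add: ennreal_inj)
qed

lemma random_bits_cdf_low: "y \<le> 0 \<Longrightarrow> measure (random_bits k) {..<y} = 0"
  using set_random_bits[of _ k] by (subst measure_pmf_zero_iff) fastforce

lemma random_bits_cdf_high: "1 \<le> y \<Longrightarrow> measure (random_bits k) {..<y} = 1"
  using set_random_bits[of _ k] by (subst measure_pmf.prob_eq_1) (auto simp: AE_measure_pmf_iff intro: less_le_trans)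

text \<open>The probability is \<open>2 ^ k * y\<close> rounded up, divided by \<open>2 ^ k\<close>;
  half-open intervals make the error one-sided. In the induction only one half is undecided, the
  other contributes 0 or 1.\<close>

lemma random_bits_cdf:
  assumes "0 \<le> y" "y \<le> 1"
  shows "y \<le> measure (random_bits k) {..<y} \<and> measure (random_bits k) {..<y} \<le> y + 1 / 2 ^ k"
  using assms
proof (induction k arbitrary: y)
  case 0
  then show ?case by (auto simp: random_bits_0 indicator_def)
next
  case (Suc k)
  show ?case
  proof (cases "2 * y \<le> 1")
    case True
    with Suc.IH[of "2 * y"] Suc.prems random_bits_cdf_low[of "2 * y - 1" k] show ?thesis
      by (simp add: random_bits_cdf_Suc field_simps)
  next
    case False
    with Suc.IH[of "2 * y - 1"] Suc.prems random_bits_cdf_high[of "2 * y" k] show ?thesis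
      by (simp add: random_bits_cdf_Suc field_simps)
  qed
qed

text \<open>One-sidedness leaves a single error term for the two ends. That it vanishes for
  \<open>y = 0\<close> matters below: scales whose radii all lie above the interval then contribute
  nothing at all.\<close>

lemma random_bits_interval:
  assumes "0 \<le> x" "x \<le> y" "y \<le> 1"
  shows "measure (random_bits k) {x..<y} \<le> y - x + (if 0 < y then 1 / 2 ^ k else 0)"
proof -
  have "{x..<y} = {..<y} - {..<x}" by auto
  then have "measure (random_bits k) {x..<y} =
      measure (random_bits k) {..<y} - measure (random_bits k) {..<x}"
    by (simp only:) (rule measure_pmf.finite_measure_Diff, use assms in auto)
  then show ?thesis
    using random_bits_cdf[of x k] random_bits_cdf[of y k] random_bits_cdf_low[of y k] assms
    by (cases "0 < y") auto
qed

text \<open>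
  Insertion of \<open>x\<close> at a uniformly random position, by a scan that reverses the list: \<open>m\<close> counts the
  positions that are left. After the insertion \<open>m\<close> is at most \<open>0\<close>, and \<open>bernoulli_pmf\<close> clips the
  bias \<open>1 / m\<close> to \<open>0\<close>.
\<close>

definition insert_step :: "'a \<Rightarrow> 'a \<Rightarrow> 'a list \<times> real \<Rightarrow> ('a list \<times> real) pmf" where
  "insert_step x y = (\<lambda>(out, m). map_pmf (\<lambda>c. if c then (y # x # out, 0) else (y # out, m - 1))
     (bernoulli_pmf (1 / m)))"

definition random_insert :: "'a \<Rightarrow> 'a list \<Rightarrow> real \<Rightarrow> 'a list pmf" where
  "random_insert x ys m = map_pmf (\<lambda>(out, m). if 0 < m then x # out else out) (foldM (insert_step x) ys ([], m))"

lemma bernoulli_le_0: "p \<le> 0 \<Longrightarrow> bernoulli_pmf p = return_pmf False"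
  by (intro pmf_eqI) (simp add: bernoulli_pmf.rep_eq pmf.rep_eq[symmetric] split: bool.splits)

lemma foldM_insert_step_done:
  "m \<le> 0 \<Longrightarrow> map_pmf (\<lambda>(out, m). if 0 < m then x # out else out) (foldM (insert_step x) ys (out, m)) =
    return_pmf (rev ys @ out)"
  by (induction ys arbitrary: out m)
    (auto simp: insert_step_def bernoulli_le_0 bind_return_pmf divide_nonneg_nonpos)

text \<open>Sequential sampling: take the first of \<open>k + 2\<close> positions with probability
  \<open>1 / (k + 2)\<close>, otherwise choose uniformly among the other \<open>k + 1\<close>. The
  scan makes its decisions in this order.\<close>

lemma uniform_Suc:
  "pmf_of_set {..Suc k} = bind_pmf (bernoulli_pmf (1 / (real k + 2)))
     (\<lambda>c. if c then return_pmf 0 else map_pmf Suc (pmf_of_set {..k}))"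
proof (rule pmf_eqI)
  fix i
  have S: "map_pmf Suc (pmf_of_set {..k}) = pmf_of_set {1..Suc k}"
    by (subst map_pmf_of_set_inj) (auto simp: image_Suc_atMost)
  have e: "1 - 1 / (real k + 2) = (real k + 1) / (real k + 2)" by (simp add: field_simps)
  have e2: "(real k + 1) / ((1 + real k) * (real k + 2)) = 1 / (2 + real k)"
    using add_pos_nonneg[of 2 "real k * real k + real k * 3"] by (subst frac_eq_eq) (auto simp: algebra_simps)
  consider "i = 0" | "1 \<le> i" "i \<le> Suc k" | "Suc k < i" by linarith
  then show "pmf (pmf_of_set {..Suc k}) i = pmf (bind_pmf (bernoulli_pmf (1 / (real k + 2)))
     (\<lambda>c. if c then return_pmf 0 else map_pmf Suc (pmf_of_set {..k}))) i"
    unfolding S by cases (simp_all add: pmf_bind indicator_def e e2 add_nonneg_pos del: One_nat_def)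
qed

lemma foldM_insert_step:
  "map_pmf (\<lambda>(out, m). if 0 < m then x # out else out)
     (foldM (insert_step x) ys (out, real (length ys) + 1)) =
   map_pmf (\<lambda>i. rev (take i ys @ x # drop i ys) @ out) (pmf_of_set {..length ys})"
proof (induction ys arbitrary: out)
  case Nil
  have "pmf_of_set {..0::nat} = return_pmf 0" by (simp add: pmf_of_set_singleton atMost_0)
  then show ?case by simp
next
  case (Cons y ys)
  let ?f = "\<lambda>(out, m). if (0::real) < m then x # out else out"
  have e: "real (length ys) + 2 - 1 = real (length ys) + 1" by simp
  have "map_pmf ?f (foldM (insert_step x) (y # ys) (out, real (length (y # ys)) + 1)) =
      bind_pmf (bernoulli_pmf (1 / (real (length ys) + 2))) (\<lambda>c. map_pmf ?f (foldM (insert_step x) ys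
        (if c then (y # x # out, 0) else (y # out, real (length ys) + 1))))"
    by (simp add: insert_step_def map_bind_pmf bind_map_pmf add.commute e cong: if_cong)
  also have "\<dots> = bind_pmf (bernoulli_pmf (1 / (real (length ys) + 2))) (\<lambda>c.
      map_pmf (\<lambda>i. rev (take i (y # ys) @ x # drop i (y # ys)) @ out)
        (if c then return_pmf 0 else map_pmf Suc (pmf_of_set {..length ys})))"
  proof (intro bind_pmf_cong refl)
    fix c
    show "map_pmf ?f (foldM (insert_step x) ys (if c then (y # x # out, 0) else (y # out, real (length ys) + 1))) =
      map_pmf (\<lambda>i. rev (take i (y # ys) @ x # drop i (y # ys)) @ out)
        (if c then return_pmf 0 else map_pmf Suc (pmf_of_set {..length ys}))"
      using Cons.IH[of "y # out"] foldM_insert_step_done[of 0 x ys "y # x # out"]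
      by (cases c) (simp_all add: pmf.map_comp o_def)
  qed
  also have "\<dots> = map_pmf (\<lambda>i. rev (take i (y # ys) @ x # drop i (y # ys)) @ out) (pmf_of_set {..length (y # ys)})"
    unfolding length_Cons uniform_Suc map_bind_pmf ..
  finally show ?case .
qed

lemma random_insert:
  "random_insert x ys (real (length ys) + 1) =
    map_pmf (\<lambda>i. rev (take i ys @ x # drop i ys)) (pmf_of_set {..length ys})"
  using foldM_insert_step[of x ys "[]"] by (simp add: random_insert_def)

section \<open>Uniform permutations by repeated insertion\<close>

definition perm_step :: "'x \<Rightarrow> nat list \<times> nat \<Rightarrow> (nat list \<times> nat) pmf" where
  "perm_step _ = (\<lambda>(ys, k). map_pmf (\<lambda>zs. (zs, Suc k)) (random_insert k ys (real k + 1)))"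

text \<open>Inserting \<open>k\<close> is injective on pairs of a permutation and a position, and
  \<open>k! * (k + 1) = (k + 1)!\<close>, so it is a bijection that carries the uniform law over.
  The reversal made by the scan does not disturb this.\<close>

lemma uniform_bind_permutation:
  "bind_pmf (pmf_of_set (permutations_of_set {..<k})) (\<lambda>ys. random_insert k ys (real k + 1)) =
    pmf_of_set (permutations_of_set {..<Suc k})"
proof -
  let ?P = "permutations_of_set {..<k}"
  define g where "g = (\<lambda>(ys, i). rev (take i ys @ k # drop i ys))"
  have fin: "finite ?P" "?P \<noteq> {}" by auto
  have len: "length ys = k" if "ys \<in> ?P" for ys
    using that by (metis card_lessThan length_finite_permutations_of_set)
  have inj: "inj_on g (?P \<times> {..k})"
  proof (rule inj_onI)
    fix p q assume pq: "p \<in> ?P \<times> {..k}" "q \<in> ?P \<times> {..k}" "g p = g q"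
    obtain ys i zs j where p: "p = (ys, i)" and q: "q = (zs, j)" by (cases p, cases q) 
    have *: "ys \<in> ?P" "zs \<in> ?P" "i \<in> {..k}" "j \<in> {..k}" "g (ys, i) = g (zs, j)"
      using pq by (auto simp: p q)
    \<comment> \<open>As \<open>k\<close> does not occur in \<open>ys\<close>, cutting the new list
      at its first \<open>k\<close> recovers the two parts.\<close>
    have tw: "takeWhile (\<lambda>z. z \<noteq> k) (take i ys @ k # drop i ys) = take i ys \<and>
        dropWhile (\<lambda>z. z \<noteq> k) (take i ys @ k # drop i ys) = k # drop i ys" if "ys \<in> ?P" for ys i
    proof -
      have "\<forall>z\<in>set (take i ys). z \<noteq> k"
        using that in_set_takeD[of _ i ys] by (fastforce simp: permutations_of_set_def)
      then show ?thesis by (simp add: takeWhile_append2 dropWhile_append2)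
    qed
    have "take i ys @ k # drop i ys = take j zs @ k # drop j zs"
      using *(5) unfolding g_def prod.case rev_is_rev_conv .
    then have "take i ys = take j zs" "k # drop i ys = k # drop j zs"
      using tw[OF *(1), of i] tw[OF *(2), of j] by metis+
    then have "take i ys = take j zs" "drop i ys = drop j zs"
      by simp_all
    moreover from this have "min (length ys) i = min (length zs) j" by (metis length_take)
    ultimately show "p = q"
      unfolding p q using len *(1-4) by (metis append_take_drop_id atMost_iff min.absorb2)
  qed
  have "bind_pmf (pmf_of_set ?P) (\<lambda>ys. random_insert k ys (real k + 1)) =
      bind_pmf (pmf_of_set ?P) (\<lambda>ys. bind_pmf (pmf_of_set {..k}) (\<lambda>i. return_pmf (g (ys, i))))"
    using fin len random_insert[of k]
    by (intro bind_pmf_cong refl) (auto simp: g_def map_pmf_def)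
  also have "\<dots> = map_pmf g (pair_pmf (pmf_of_set ?P) (pmf_of_set {..k}))"
    by (simp add: pair_pmf_def map_bind_pmf)
  also have "pair_pmf (pmf_of_set ?P) (pmf_of_set {..k}) = pmf_of_set (?P \<times> {..k})"
    by (rule pmf_eqI) (use fin in \<open>auto simp: pmf_pair indicator_def card_cartesian_product algebra_simps\<close>)
  also from inj have "map_pmf g (pmf_of_set (?P \<times> {..k})) = pmf_of_set (g ` (?P \<times> {..k}))"
    using fin by (intro map_pmf_of_set_inj) auto
  also have "g ` (?P \<times> {..k}) = permutations_of_set {..<Suc k}"
  proof (rule card_subset_eq)
    show "g ` (?P \<times> {..k}) \<subseteq> permutations_of_set {..<Suc k}"
    proof (rule image_subsetI)
      fix p assume p: "p \<in> ?P \<times> {..k}"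
      obtain ys i where pe: "p = (ys, i)" by (cases p)
      from p have ys: "set ys = {..<k}" "distinct ys" by (auto simp: permutations_of_set_def pe)
      have un: "set (take i ys) \<union> set (drop i ys) = set ys" by (metis append_take_drop_id set_append)
      have "distinct (take i ys @ drop i ys)" using ys by simp
      then have disj: "distinct (take i ys)" "distinct (drop i ys)" "set (take i ys) \<inter> set (drop i ys) = {}"
        unfolding distinct_append by blast+
      have "k \<notin> set (take i ys) \<union> set (drop i ys)" unfolding un ys by simp
      then have "distinct (g (ys, i))" using disj by (auto simp: g_def)
      moreover have "set (g (ys, i)) = insert k (set (take i ys) \<union> set (drop i ys))" by (auto simp: g_def)
      then have "set (g (ys, i)) = {..<Suc k}" unfolding un ys lessThan_Suc .
      ultimately show "g p \<in> permutations_of_set {..<Suc k}" unfolding pe by (intro permutations_of_setI)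
    qed
    show "card (g ` (?P \<times> {..k})) = card (permutations_of_set {..<Suc k})"
      unfolding card_image[OF inj] card_cartesian_product by (simp add: algebra_simps)
  qed simp
  finally show ?thesis .
qed

lemma foldM_perm_step:
  "foldM perm_step xs ([], 0) =
    map_pmf (\<lambda>p. (p, length xs)) (pmf_of_set (permutations_of_set {..<length xs}))"
proof (induction xs rule: rev_induct)
  case Nil
  have "permutations_of_set {..<0::nat} = {[]}" by simp
  then show ?case by (simp add: pmf_of_set_singleton)
next
  case (snoc x xs)
  then show ?case
    unfolding length_append_singleton uniform_bind_permutation[symmetric]
    by (simp add: foldM_append perm_step_def map_pmf_def bind_assoc_pmf bind_return_pmf)
qed

section \<open>Cut probabilities\<close>

text \<open>\<open>\<pi> ! w\<close> is the priority of \<open>w\<close>. The label is the winning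
  priority instead of the winning point; for a permutation the two determine each other, and a
  maximum is simpler to compute than its argument.\<close>

definition center :: "(nat \<Rightarrow> nat \<Rightarrow> real) \<Rightarrow> nat \<Rightarrow> nat list \<Rightarrow> real \<Rightarrow> nat \<Rightarrow> nat" where
  "center d n \<pi> \<rho> u = Max {\<pi> ! w | w. w < n \<and> d u w \<le> \<rho>}"

definition top_in :: "nat set \<Rightarrow> nat \<Rightarrow> nat list set" where
  "top_in C w = {\<pi>. \<forall>w'\<in>C. \<pi> ! w' \<le> \<pi> ! w}"

text \<open>By symmetry: exchanging the priorities of \<open>a\<close> and \<open>b\<close> maps the
  permutations with \<open>a\<close> on top injectively to those with \<open>b\<close> on top. So
  the events for the members of \<open>C\<close> are equally likely, and they partition the
  permutations.\<close>

lemma permutation_top: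
  assumes C: "C \<subseteq> {..<n}" and w: "w \<in> C"
  shows "measure_pmf.prob (pmf_of_set (permutations_of_set {..<n})) (top_in C w) = 1 / card C"
proof -
  let ?P = "permutations_of_set {..<n}"
  have fin: "finite C" using C finite_subset by blast
  have P: "length \<pi> = n" "distinct \<pi>" "set \<pi> = {..<n}" if "\<pi> \<in> ?P" for \<pi>
    using that by (auto simp: permutations_of_set_def distinct_card[symmetric])
  have eq: "card (?P \<inter> top_in C a) \<le> card (?P \<inter> top_in C b)" if ab: "a \<in> C" "b \<in> C" for a b
  proof -
    define \<phi> where "\<phi> \<pi> = \<pi>[a := \<pi> ! b, b := \<pi> ! a]" for \<pi> :: "nat list"
    have less: "a < n" "b < n" using C ab by auto
    have nth: "\<phi> \<pi> ! i = (if i = b then \<pi> ! a else if i = a then \<pi> ! b else \<pi> ! i)"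
      if "\<pi> \<in> ?P" "i < n" for \<pi> i
      using that P(1)[OF that(1)] less by (auto simp: \<phi>_def nth_list_update)
    have PP: "\<phi> \<pi> \<in> ?P" if "\<pi> \<in> ?P" for \<pi>
      using that P[OF that] less unfolding \<phi>_def by (intro permutations_of_setI) auto
    have "\<phi> (\<phi> \<pi>) = \<pi>" if "\<pi> \<in> ?P" for \<pi>
      using P(1)[OF that] P(1)[OF PP[OF that]] P(1)[OF PP[OF PP[OF that]]] nth[OF that] nth[OF PP[OF that]] less
      by (intro nth_equalityI) auto
    then have inj: "inj_on \<phi> (?P \<inter> top_in C a)" by (intro inj_on_inverseI[of _ \<phi>]) auto
    have "\<phi> \<pi> \<in> top_in C b" if "\<pi> \<in> ?P" "\<pi> \<in> top_in C a" for \<pi>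
      unfolding top_in_def mem_Collect_eq
    proof
      fix w' assume w': "w' \<in> C"
      then show "\<phi> \<pi> ! w' \<le> \<phi> \<pi> ! b"
        using nth[OF that(1), of w'] nth[OF that(1), of b] less C that(2) ab unfolding top_in_def by auto
    qed
    then have "\<phi> ` (?P \<inter> top_in C a) \<subseteq> ?P \<inter> top_in C b" using PP by auto
    then show ?thesis using card_inj_on_le[OF inj] by simp
  qed
  have UN: "(\<Union>a\<in>C. ?P \<inter> top_in C a) = ?P"
  proof -
    have "\<exists>a\<in>C. \<pi> \<in> top_in C a" for \<pi> :: "nat list"
    proof -
      have "Max ((!) \<pi> ` C) \<in> (!) \<pi> ` C" using fin w by (intro Max_in) auto
      then obtain a where a: "a \<in> C" "Max ((!) \<pi> ` C) = \<pi> ! a" by auto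
      moreover have "\<pi> ! w' \<le> Max ((!) \<pi> ` C)" if "w' \<in> C" for w' using fin that by auto
      ultimately show ?thesis unfolding top_in_def by auto
    qed
    then show ?thesis by auto
  qed
  have disj: "(?P \<inter> top_in C a) \<inter> (?P \<inter> top_in C b) = {}" if "a \<in> C" "b \<in> C" "a \<noteq> b" for a b
  proof (rule ccontr)
    assume "(?P \<inter> top_in C a) \<inter> (?P \<inter> top_in C b) \<noteq> {}"
    then obtain \<pi> where \<pi>: "\<pi> \<in> ?P" "\<pi> \<in> top_in C a" "\<pi> \<in> top_in C b" by blast
    then have "\<pi> ! a = \<pi> ! b" using that unfolding top_in_def by (auto intro: antisym)
    then show False using P[OF \<pi>(1)] that C nth_eq_iff_index_eq[of \<pi> a b] by auto
  qed
  have "card ?P = (\<Sum>a\<in>C. card (?P \<inter> top_in C a))"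
    by (subst UN[symmetric], rule card_UN_disjoint) (use fin disj in auto)
  also have "\<dots> = (\<Sum>a\<in>C. card (?P \<inter> top_in C w))"
    using eq w by (intro sum.cong refl antisym) auto
  finally have "card ?P = card C * card (?P \<inter> top_in C w)" by simp
  moreover have "card ?P \<noteq> 0" by simp
  moreover have "?P \<noteq> {}" "finite ?P" by auto
  ultimately show ?thesis by (simp add: measure_pmf_of_set field_simps del: card_permutations_of_set)
qed

text \<open>Remove an element of largest value: its rank is \<open>card A\<close>, and the ranks of
  the others can only drop. Ties share the largest rank of their group, hence only an
  inequality.\<close>

lemma sum_inverse_rank_le_harm:
  fixes f :: "'a \<Rightarrow> real"
  assumes "finite A"
  shows "(\<Sum>w\<in>A. 1 / card {w'\<in>A. f w' \<le> f w}) \<le> (harm (card A) :: real)"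
  using assms
proof (induction "card A" arbitrary: A)
  case 0
  then show ?case by (simp add: harm_def)
next
  case (Suc k)
  then have ne: "A \<noteq> {}" by auto
  obtain a where a: "a \<in> A" "\<And>w. w \<in> A \<Longrightarrow> f w \<le> f a"
    using Max_in[of "f ` A"] Max_ge[of "f ` A"] Suc.prems ne by (metis (no_types, lifting) finite_imageI imageE image_eqI image_is_empty)
  let ?B = "A - {a}"
  have B: "card ?B = k" "finite ?B" using Suc a by auto
  have "(\<Sum>w\<in>A. 1 / card {w'\<in>A. f w' \<le> f w}) = 1 / card {w'\<in>A. f w' \<le> f a} + (\<Sum>w\<in>?B. 1 / card {w'\<in>A. f w' \<le> f w})"
    using a Suc.prems by (subst sum.remove[of A a]) auto
  also have "{w'\<in>A. f w' \<le> f a} = A" using a by auto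
  also have "(\<Sum>w\<in>?B. 1 / card {w'\<in>A. f w' \<le> f w}) \<le> (\<Sum>w\<in>?B. 1 / card {w'\<in>?B. f w' \<le> f w})"
  proof (rule sum_mono)
    fix w assume w: "w \<in> ?B"
    have "card {w'\<in>?B. f w' \<le> f w} \<le> card {w'\<in>A. f w' \<le> f w}"
      using Suc.prems by (intro card_mono) auto
    moreover have "0 < card {w'\<in>?B. f w' \<le> f w}"
      using w B by (subst card_gt_0_iff) auto
    ultimately show "1 / real (card {w'\<in>A. f w' \<le> f w}) \<le> 1 / real (card {w'\<in>?B. f w' \<le> f w})"
      by (simp add: frac_le)
  qed
  also have "\<dots> \<le> harm k" using Suc.hyps(1)[of ?B] B by simp
  finally show ?case using Suc.hyps(2)[symmetric] by (simp add: harm_Suc inverse_eq_divide add.commute)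
qed

lemma center_ge:
  assumes "w < n" "d u w \<le> \<rho>"
  shows "\<pi> ! w \<le> center d n \<pi> \<rho> u"
  unfolding center_def using assms by (intro Max_ge) auto

lemma center_in:
  assumes "w < n" "d u w \<le> \<rho>"
  obtains w' where "w' < n" "d u w' \<le> \<rho>" "center d n \<pi> \<rho> u = \<pi> ! w'"
proof -
  have "center d n \<pi> \<rho> u \<in> {\<pi> ! w | w. w < n \<and> d u w \<le> \<rho>}"
    unfolding center_def using assms by (intro Max_in) auto
  then show ?thesis using that by auto
qed

text \<open>The set \<open>C\<close> of centers in reach depends on \<open>\<rho>\<close>, which
  would block averaging over the radius. Every point at least as close to the pair as some
  \<open>w\<close> in \<open>C\<close> is itself in \<open>C\<close>, so \<open>1 / card C\<close>
  is at most the reciprocal rank of \<open>w\<close>, a weight free of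
  \<open>\<rho>\<close>.\<close>

lemma cut_probability:
  fixes d :: "nat \<Rightarrow> nat \<Rightarrow> real"
  assumes "u < n" "d u u \<le> \<rho>"
  shows "measure_pmf.prob (pmf_of_set (permutations_of_set {..<n})) {\<pi>. center d n \<pi> \<rho> u \<noteq> center d n \<pi> \<rho> v} \<le>
    (\<Sum>w<n. of_bool (min (d u w) (d v w) \<le> \<rho> \<and> \<rho> < max (d u w) (d v w)) *
      (1 / card {w'\<in>{..<n}. min (d u w') (d v w') \<le> min (d u w) (d v w)}))"
proof -
  let ?p = "measure_pmf.prob (pmf_of_set (permutations_of_set {..<n}))"
  define C where "C = {w. w < n \<and> min (d u w) (d v w) \<le> \<rho>}"
  define C1 where "C1 = {w\<in>C. \<rho> < max (d u w) (d v w)}"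
  have fin: "finite C" and sub: "C \<subseteq> {..<n}" and u: "u \<in> C" using assms by (auto simp: C_def)
  have incl: "{\<pi>. center d n \<pi> \<rho> u \<noteq> center d n \<pi> \<rho> v} \<subseteq> (\<Union>w\<in>C1. top_in C w)"
  proof (clarify, rule ccontr)
    fix \<pi> assume neq: "center d n \<pi> \<rho> u \<noteq> center d n \<pi> \<rho> v" and no: "\<pi> \<notin> (\<Union>w\<in>C1. top_in C w)"
    have "Max ((!) \<pi> ` C) \<in> (!) \<pi> ` C" using fin u by (intro Max_in) auto
    then obtain a where a: "a \<in> C" "Max ((!) \<pi> ` C) = \<pi> ! a" by auto
    have top: "\<pi> ! w' \<le> \<pi> ! a" if "w' \<in> C" for w' using fin that a(2)[symmetric] by auto
    then have "\<pi> \<in> top_in C a" by (auto simp: top_in_def)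
    with no a(1) have "\<not> \<rho> < max (d u a) (d v a)" by (auto simp: C1_def)
    with a(1) have both: "a < n" "d u a \<le> \<rho>" "d v a \<le> \<rho>" by (auto simp: C_def)
    have "center d n \<pi> \<rho> x = \<pi> ! a" if "x = u \<or> x = v" for x
    proof (rule antisym)
      have xa: "d x a \<le> \<rho>" using that both by auto
      show "\<pi> ! a \<le> center d n \<pi> \<rho> x" using both xa by (intro center_ge) auto
      obtain w' where "w' < n" "d x w' \<le> \<rho>" "center d n \<pi> \<rho> x = \<pi> ! w'" 
        using center_in[of a n d x \<rho> \<pi>] both(1) xa by blast
      then show "center d n \<pi> \<rho> x \<le> \<pi> ! a" using top[of w'] that by (auto simp: C_def)
    qed
    with neq show False by simp
  qed
  have "?p {\<pi>. center d n \<pi> \<rho> u \<noteq> center d n \<pi> \<rho> v} \<le> ?p (\<Union>w\<in>C1. top_in C w)"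
    by (rule measure_pmf.finite_measure_mono[OF incl]) simp
  also have "\<dots> \<le> (\<Sum>w\<in>C1. ?p (top_in C w))"
    using fin by (intro measure_pmf.finite_measure_subadditive_finite) (auto simp: C1_def)
  also have "\<dots> = (\<Sum>w\<in>C1. 1 / card C)"
    using permutation_top[OF sub] by (intro sum.cong refl) (auto simp: C1_def)
  also have "\<dots> \<le> (\<Sum>w\<in>C1. 1 / card {w'\<in>{..<n}. min (d u w') (d v w') \<le> min (d u w) (d v w)})"
  proof (rule sum_mono)
    fix w assume "w \<in> C1"
    then have w: "w \<in> C" by (simp add: C1_def)
    have "card {w'\<in>{..<n}. min (d u w') (d v w') \<le> min (d u w) (d v w)} \<le> card C"
      using fin w by (intro card_mono) (auto simp: C_def)
    moreover have "0 < card {w'\<in>{..<n}. min (d u w') (d v w') \<le> min (d u w) (d v w)}"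
      using w by (auto simp: card_gt_0_iff C_def intro!: exI[of _ w])
    ultimately show "1 / real (card C) \<le> 1 / real (card {w'\<in>{..<n}. min (d u w') (d v w') \<le> min (d u w) (d v w)})"
      by (simp add: frac_le)
  qed
  also have "\<dots> = (\<Sum>w<n. of_bool (w \<in> C1) * (1 / card {w'\<in>{..<n}. min (d u w') (d v w') \<le> min (d u w) (d v w)}))"
    by (rule sum.mono_neutral_cong_left) (auto simp: C1_def C_def)
  also have "\<dots> = (\<Sum>w<n. of_bool (min (d u w) (d v w) \<le> \<rho> \<and> \<rho> < max (d u w) (d v w)) *
      (1 / card {w'\<in>{..<n}. min (d u w') (d v w') \<le> min (d u w) (d v w)}))"
    by (intro sum.cong refl) (auto simp: C1_def C_def)
  finally show ?thesis .
qed

text \<open>The range is \<open>[s * lam ^ (j - 2), s * lam ^ (j - 1))\<close> with real exponents,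
  written as a quotient since \<open>j\<close> may be below 2. The shift by one scale ensures that
  points sharing a center at level \<open>j + 1\<close> are within \<open>2 * s * lam ^ j\<close>,
  which the tree distance of points separated at level \<open>j\<close> can pay for.\<close>

definition radius :: "real \<Rightarrow> real \<Rightarrow> real \<Rightarrow> nat \<Rightarrow> real" where
  "radius lam s b j = s * lam ^ j / lam\<^sup>2 * (1 + b * (lam - 1))"

lemma radius_bounds:
  assumes "lam > 1" "s > 0" "0 \<le> b" "b < 1"
  shows "0 < radius lam s b j" "radius lam s b (Suc j) \<le> s * lam ^ j"
proof -
  have "0 \<le> b * (lam - 1)" using assms by simp
  then show "0 < radius lam s b j" unfolding radius_def using assms
    by (intro mult_pos_pos divide_pos_pos add_pos_nonneg) auto
  have "b * (lam - 1) \<le> 1 * (lam - 1)" using assms by (intro mult_right_mono) auto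
  then have "1 + b * (lam - 1) \<le> lam" by (simp add: algebra_simps)
  then have "s * lam ^ Suc j / lam\<^sup>2 * (1 + b * (lam - 1)) \<le> s * lam ^ Suc j / lam\<^sup>2 * lam"
    using assms by (intro mult_left_mono) auto
  also have "\<dots> = s * lam ^ j" using assms by (simp add: power2_eq_square)
  finally show "radius lam s b (Suc j) \<le> s * lam ^ j" by (simp add: radius_def)
qed

text \<open>
  The intervals of the radii \<open>radius lam s b j\<close>, \<open>j = 1, 2, \<dots>\<close>, are adjacent, so the probabilities that a
  radius separates \<open>x\<close> from \<open>y\<close>, weighted by the scales, telescope to a multiple of \<open>y - x\<close>. The
  discretization contributes \<open>1 / 2 ^ k\<close> on each scale below \<open>y\<close>.
\<close>

lemma radius_separates:
  assumes lam: "lam > 1" and s: "s > 0" and xy: "0 \<le> x" "x \<le> y" "y - x \<le> \<delta>" "s \<le> \<delta>" "y \<le> s * 2 ^ k"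
  shows "(\<Sum>j=1..<L. s * lam ^ j * measure (random_bits k) {b. x \<le> radius lam s b j \<and> radius lam s b j < y})
    \<le> (lam\<^sup>2 + lam ^ 3) / (lam - 1) * \<delta>"
proof -
  define a where "a j = s * lam ^ j / lam\<^sup>2" for j
  \<comment> \<open>\<open>cl j\<close> clamps to the range of the radius of scale \<open>j\<close>;
    its increments are the lengths of the pieces into which these ranges cut the interval from
    \<open>x\<close> to \<open>y\<close>.\<close>
  define cl where "cl j z = min (max z (a j)) (a (Suc j))" for j z
  have a_pos: "a j > 0" for j using lam s by (simp add: a_def)
  have a_Suc: "a (Suc j) = lam * a j" for j by (simp add: a_def)
  have a_mono: "a j < a (Suc j)" for j using a_pos[of j] lam by (simp add: a_Suc)
  have width: "a (Suc j) - a j = a j * (lam - 1)" for j by (simp add: a_Suc algebra_simps)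
  have wpos: "a j * (lam - 1) > 0" for j using a_pos lam by simp
  have scale: "s * lam ^ j = lam\<^sup>2 * a j" for j using lam by (simp add: a_def)
  have one: "s * lam ^ j * measure (random_bits k) {b. x \<le> radius lam s b j \<and> radius lam s b j < y}
      \<le> lam\<^sup>2 / (lam - 1) * (cl j y - cl j x) + (if a j < y then lam\<^sup>2 * a j / 2 ^ k else 0)" for j
  proof -
    \<comment> \<open>\<open>t z\<close> is the bit value at which the radius reaches the clamped
      \<open>z\<close>. The weight \<open>lam ^ 2 * a j\<close> of the scale against the length
      \<open>a j * (lam - 1)\<close> of its range leaves the rate
      \<open>lam ^ 2 / (lam - 1)\<close>, the same for all scales.\<close>
    define t where "t z = (cl j z - a j) / (a j * (lam - 1))" for z
    have cl: "a j \<le> cl j z" "cl j z \<le> a (Suc j)" for z using a_mono[of j] by (auto simp: cl_def)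
    have t01: "0 \<le> t z" "t z \<le> 1" for z
      using cl[of z] wpos[of j] width[of j] unfolding t_def by (auto intro: divide_nonneg_pos)
    have tmono: "t x \<le> t y"
      unfolding t_def using wpos[of j] xy(2) by (intro divide_right_mono) (auto simp: cl_def)
    have radius: "radius lam s b j = a j + b * (a j * (lam - 1))" for b
      by (simp add: radius_def a_def algebra_simps add_divide_distrib diff_divide_distrib)
    have "measure (random_bits k) {b. x \<le> radius lam s b j \<and> radius lam s b j < y} \<le>
        measure (random_bits k) {t x..<t y}"
    proof (rule measure_pmf.finite_measure_mono_AE)
      show "AE b in random_bits k. b \<in> {b. x \<le> radius lam s b j \<and> radius lam s b j < y} \<longrightarrow> b \<in> {t x..<t y}"
        unfolding AE_measure_pmf_iff
      proof (intro ballI impI)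
        fix b assume "b \<in> set_pmf (random_bits k)" and b: "b \<in> {b. x \<le> radius lam s b j \<and> radius lam s b j < y}"
        then have b01: "0 \<le> b" "b < 1" using set_random_bits by blast+
        have "a j \<le> radius lam s b j" "radius lam s b j < a (Suc j)"
          using b01 wpos[of j] width[of j] mult_strict_right_mono[OF b01(2) wpos[of j]] unfolding radius by auto
        then have "cl j x \<le> radius lam s b j" "radius lam s b j < cl j y" using b by (auto simp: cl_def)
        then have "t x * (a j * (lam - 1)) \<le> b * (a j * (lam - 1))" "b * (a j * (lam - 1)) < t y * (a j * (lam - 1))"
          using wpos[of j] unfolding radius t_def by auto
        then show "b \<in> {t x..<t y}" using wpos[of j] by (simp add: mult_le_cancel_right_pos mult_less_cancel_right_pos)
      qed
    qed simp
    also have "\<dots> \<le> t y - t x + (if 0 < t y then 1 / 2 ^ k else 0)"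
      by (rule random_bits_interval) (use t01 tmono in auto)
    \<comment> \<open>If the whole range lies above \<open>y\<close>, then \<open>t y = 0\<close>
      and there is no rounding error.\<close>
    also have "\<dots> \<le> t y - t x + (if a j < y then 1 / 2 ^ k else 0)"
      using wpos[of j] a_mono[of j] by (auto simp: t_def cl_def)
    finally have "s * lam ^ j * measure (random_bits k) {b. x \<le> radius lam s b j \<and> radius lam s b j < y}
        \<le> lam\<^sup>2 * a j * (t y - t x + (if a j < y then 1 / 2 ^ k else 0))"
      unfolding scale using a_pos[of j] by (intro mult_left_mono) auto
    also have "\<dots> = lam\<^sup>2 * a j * (t y - t x) + (if a j < y then lam\<^sup>2 * a j / 2 ^ k else 0)"
      by (simp add: algebra_simps)
    also have "lam\<^sup>2 * a j * (t y - t x) = lam\<^sup>2 / (lam - 1) * (cl j y - cl j x)"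
    proof -
      have "t y - t x = (cl j y - cl j x) / (a j * (lam - 1))" by (simp add: t_def diff_divide_distrib)
      then show ?thesis using a_pos[of j] lam by simp
    qed
    finally show ?thesis .
  qed
  have tele: "(\<Sum>j=1..<L. cl j y - cl j x) \<le> y - x"
  proof -
    have "1 \<le> M \<Longrightarrow> (\<Sum>j=1..<M. cl j y - cl j x) = min (max y (a 1)) (a M) - min (max x (a 1)) (a M)" for M
    proof (induction M rule: dec_induct)
      case (step M)
      have "a 1 \<le> a M" using step(1) by (induction M rule: dec_induct) (use a_mono in \<open>auto intro: less_imp_le order_trans\<close>)
      then show ?case using step a_mono[of M] by (simp add: cl_def min_def max_def)
    qed (use xy in \<open>auto simp: min_def max_def\<close>)
    from this[of L] show ?thesis using xy by (cases "1 \<le> L") (auto simp: min_def max_def)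
  qed
  have geo0: "(\<Sum>j=1..<M. a j) \<le> a M / (lam - 1)" for M
  proof (induction M)
    case 0
    then show ?case using a_pos[of 0] lam by simp
  next
    case (Suc M)
    have "(\<Sum>j=1..<Suc M. a j) \<le> (\<Sum>j=1..<M. a j) + a M" using a_pos[of M] by (cases "1 \<le> M") auto
    also have "\<dots> \<le> a M / (lam - 1) + a M" using Suc by simp
    also have "\<dots> = a (Suc M) / (lam - 1)" using lam by (simp add: a_Suc field_simps)
    finally show ?case .
  qed
  \<comment> \<open>The scales below \<open>y\<close> form a geometric sum dominated by its last
    term, which is both below \<open>y\<close> and bounded by the last scale.\<close>
  have geo: "(\<Sum>j=1..<M. if a j < y then a j else 0) \<le> lam / (lam - 1) * min y (a M)" for M
  proof (induction M)
    case 0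
    then show ?case using xy a_pos[of 0] lam by simp
  next
    case (Suc M)
    have pos: "0 \<le> lam / (lam - 1) * min y (a (Suc M))" using xy a_pos[of "Suc M"] lam by simp
    have mono: "lam / (lam - 1) * min y (a M) \<le> lam / (lam - 1) * min y (a (Suc M))"
      using a_mono[of M] lam by (intro mult_left_mono) auto
    show ?case
    proof (cases "1 \<le> M \<and> a M < y")
      case True
      have "(\<Sum>j=1..<Suc M. if a j < y then a j else 0) \<le> (\<Sum>j=1..<M. a j) + a M"
        using True by (auto intro!: sum_mono simp: less_imp_le[OF a_pos])
      also have "\<dots> \<le> a M / (lam - 1) + a M" using geo0[of M] by simp
      also have "\<dots> = lam / (lam - 1) * a M" using lam by (simp add: field_simps)
      also have "\<dots> \<le> lam / (lam - 1) * min y (a (Suc M))"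
        using True a_mono[of M] lam by (intro mult_left_mono) auto
      finally show ?thesis .
    next
      case False
      then have "(\<Sum>j=1..<Suc M. if a j < y then a j else 0) = (\<Sum>j=1..<M. if a j < y then a j else 0)"
        by (cases "1 \<le> M") auto
      with Suc mono show ?thesis by simp
    qed
  qed
  have "(\<Sum>j=1..<L. s * lam ^ j * measure (random_bits k) {b. x \<le> radius lam s b j \<and> radius lam s b j < y})
     \<le> (\<Sum>j=1..<L. lam\<^sup>2 / (lam - 1) * (cl j y - cl j x) + (if a j < y then lam\<^sup>2 * a j / 2 ^ k else 0))"
    by (rule sum_mono) (rule one)
  also have "\<dots> = lam\<^sup>2 / (lam - 1) * (\<Sum>j=1..<L. cl j y - cl j x) + lam\<^sup>2 / 2 ^ k * (\<Sum>j=1..<L. if a j < y then a j else 0)"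
    by (simp add: sum.distrib sum_distrib_left if_distrib[of "\<lambda>z. _ * z"] cong: if_cong)
  also have "\<dots> \<le> lam\<^sup>2 / (lam - 1) * \<delta> + lam\<^sup>2 / 2 ^ k * (lam / (lam - 1) * (s * 2 ^ k))"
  \<comment> \<open>Here the precision is spent: the scales below \<open>y\<close> sum to
    \<open>O(s * 2 ^ k)\<close>, and the rounding error per unit is
    \<open>1 / 2 ^ k\<close>.\<close>
  proof (intro add_mono mult_left_mono)
    have "(\<Sum>j=1..<L. if a j < y then a j else 0) \<le> lam / (lam - 1) * min y (a L)" by (rule geo)
    also have "\<dots> \<le> lam / (lam - 1) * (s * 2 ^ k)" using lam xy by (intro mult_left_mono) auto
    finally show "(\<Sum>j=1..<L. if a j < y then a j else 0) \<le> lam / (lam - 1) * (s * 2 ^ k)" .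
  qed (use tele xy lam in auto)
  also have "lam\<^sup>2 / 2 ^ k * (lam / (lam - 1) * (s * 2 ^ k)) = lam ^ 3 / (lam - 1) * s"
    by (simp add: power2_eq_square power3_eq_cube)
  also have "lam\<^sup>2 / (lam - 1) * \<delta> + lam ^ 3 / (lam - 1) * s \<le> lam\<^sup>2 / (lam - 1) * \<delta> + lam ^ 3 / (lam - 1) * \<delta>"
    using lam xy by (intro add_left_mono mult_left_mono) auto
  also have "\<dots> = (lam\<^sup>2 + lam ^ 3) / (lam - 1) * \<delta>" by (simp add: add_divide_distrib algebra_simps)
  finally show ?thesis .
qed

section \<open>The program\<close>

abbreviation random_perm :: "nat \<Rightarrow> nat list pmf" where
  "random_perm n \<equiv> pmf_of_set (permutations_of_set {..<n})"

abbreviation bin :: "arith \<Rightarrow> prog \<Rightarrow> prog \<Rightarrow> prog" where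
  "bin a p q \<equiv> Seq (Mk_Pair p q) (Arith a)"

abbreviation less_prog :: "prog \<Rightarrow> prog \<Rightarrow> prog" where
  "less_prog p q \<equiv> Seq (Mk_Pair p q) Less"

lemma var_simps [simp]: "var 1 = Seq Tail Head" "var (numeral k) = Seq Tail (var (pred_numeral k))"
  by (simp_all add: numeral_eq_Suc)

fun tails :: "nat \<Rightarrow> prog" where
  "tails 0 = Skip"
| "tails (Suc k) = Seq Tail (tails k)"

lemma yields_coin:
  assumes "run g x = return_spmf (VNum p, t)" "\<And>c. yields (run (if c then p1 else p2) x) (K c) B"
  shows "yields (run (Cond (Seq g Flip) p1 p2) x) (bind_pmf (bernoulli_pmf p) K) (t + B + 3)"
proof -
  have 1: "yields (run (Seq g Flip) x) (map_pmf bool_val (bernoulli_pmf p)) (t + 1 + 1)"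
    by (rule yields_Seq_det[OF yields_returnI[OF assms(1) order_refl refl]])
      (use yields_Flip[of "VNum p"] in simp)
  have "yields (run (Cond (Seq g Flip) p1 p2) x)
      (bind_pmf (map_pmf bool_val (bernoulli_pmf p)) (\<lambda>c. K (c \<noteq> VNil))) (t + 1 + 1 + B + 1)"
  proof (rule yields_Cond[OF 1])
    fix c
    show "yields (run (if c = VNil then p2 else p1) x) (K (c \<noteq> VNil)) B"
      using assms(2)[of "c \<noteq> VNil"] by (cases "c = VNil") simp_all
  qed
  moreover have "bind_pmf (map_pmf bool_val (bernoulli_pmf p)) (\<lambda>c. K (c \<noteq> VNil)) = bind_pmf (bernoulli_pmf p) K"
    unfolding bind_map_pmf by (rule bind_pmf_cong) (auto simp: bool_val_def)
  ultimately show ?thesis by (simp add: yields_mono)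
qed

lemma enc_list_map: "enc_list e (map h xs) = enc_list (\<lambda>x. e (h x)) xs"
  by (induction xs) auto

subsection \<open>Extreme distances\<close>

definition scan_body :: prog where
  "scan_body = Mk_Pair
     (Cond (less_prog (Const 0) (var 1))
       (Cond (less_prog (var 1) (Seq Head Head)) (var 1) (Seq Head Head)) (Seq Head Head))
     (Cond (less_prog (Seq Head Tail) (var 1)) (var 1) (Seq Head Tail))"

definition scan_prog :: prog where
  "scan_prog = fold_prog Head (Mk_Pair (Const 1) (Const 1)) (fold_prog (var 1) (var 0) scan_body)"

definition scan_step :: "real \<Rightarrow> real \<times> real \<Rightarrow> real \<times> real" where
  "scan_step x = (\<lambda>(s, D). (if 0 < x \<and> x < s then x else s, if D < x then x else D))"

text \<open>
  It suffices that the first component is at most the least positive distance and the second at least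
  the diameter; the initial value \<open>1\<close> covers the case of a single point.
\<close>

definition extremes :: "nat \<Rightarrow> (nat \<Rightarrow> nat \<Rightarrow> real) \<Rightarrow> real \<times> real" where
  "extremes n d = fold (\<lambda>u. fold (\<lambda>v. scan_step (d u v)) [0..<n]) [0..<n] (1, 1)"

definition enc_pair :: "real \<times> real \<Rightarrow> val" where
  "enc_pair = (\<lambda>(x, y). VPair (VNum x) (VNum y))"

lemma yields_scan_body:
  "yields (run scan_body (VPair (enc_pair a) (VPair (VNum x) env))) (return_pmf (enc_pair (scan_step x a))) 60"
proof (cases a)
  case (Pair s D)
  show ?thesis unfolding Pair
    by (cases "0 < x"; cases "x < s"; cases "D < x")
      (simp_all add: scan_body_def scan_step_def enc_pair_def bool_val_def yields_return)
qed

lemma yields_scan: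
  assumes "n \<le> Z" "1 \<le> Z"
  shows "yields (run scan_prog (VPair (enc_metric n d) env)) (return_pmf (enc_pair (extremes n d))) (200 * Z ^ 2)"
proof -
  have inner: "yields (run (fold_prog (var 1) (var 0) scan_body)
      (VPair (enc_pair a) (VPair (enc_list (\<lambda>v. VNum (d u v)) [0..<n]) env')))
      (return_pmf (enc_pair (fold (\<lambda>v. scan_step (d u v)) [0..<n] a))) (106 * Z ^ 1)"
    for a u env'
    by (rule yields_fold_det[where I = "\<lambda>_ _. True" and B = 60 and B' = 60 and k = 0 and ?B1.0 = 3 and ?B2.0 = 1])
      (use assms in \<open>auto intro!: yields_return yields_scan_body\<close>)
  show ?thesis
    unfolding scan_prog_def extremes_def enc_metric_def
    by (rule yields_fold_det[where I = "\<lambda>_ _. True" and B = "106 * Z ^ 1" and B' = 106 and k = 1 and ?B1.0 = 1 and ?B2.0 = 3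
        and r = enc_pair and e = "\<lambda>u. enc_list (\<lambda>v. VNum (d u v)) [0..<n]"])
      (use inner assms in \<open>simp_all add: enc_pair_def yields_return del: var_simps var.simps\<close>)
qed

subsection \<open>The list of scales\<close>

definition levels_body :: "real \<Rightarrow> real \<Rightarrow> prog" where
  "levels_body lam mu = Mk_Pair (Mk_Pair (Seq Tail Head) Head)
     (Mk_Pair (bin Mul (Const lam) (Seq Tail Head)) (bin Div (Seq Tail Tail) (Const mu)))"

definition levels_loop :: "real \<Rightarrow> real \<Rightarrow> prog" where
  "levels_loop lam mu = While (less_prog (Const 1) (Seq Tail Tail)) (levels_body lam mu)"

definition levels_prog :: "real \<Rightarrow> real \<Rightarrow> prog" where
  "levels_prog lam mu = Seq (Mk_Pair Nil_Const (Mk_Pair (Const lam) (bin Div (Seq Head Tail) (Seq Head Head))))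
     (Seq (levels_loop lam mu) Head)"

text \<open>For \<open>q \<ge> 1\<close> this is the logarithm of \<open>q\<close> to base
  \<open>mu\<close>, rounded up. It is given as the number of divisions until a loop stops because
  the machine cannot round.\<close>

definition num_levels :: "real \<Rightarrow> real \<Rightarrow> nat" where
  "num_levels mu q = (LEAST k. q / mu ^ k \<le> 1)"

definition enc_levels :: "real \<Rightarrow> nat \<Rightarrow> val" where
  "enc_levels lam L = enc_list (\<lambda>j. VNum (lam ^ j)) (rev [1..<L])"

lemma num_levels:
  assumes "mu > 1"
  shows "q \<le> mu ^ num_levels mu q" "k < num_levels mu q \<Longrightarrow> mu ^ k < q"
proof -
  obtain k0 where "q < mu ^ k0" using real_arch_pow[OF assms] by blast
  then have "q / mu ^ k0 \<le> 1" using assms by (simp add: field_simps)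
  then have "\<exists>k. q / mu ^ k \<le> 1" ..
  from LeastI_ex[OF this] show "q \<le> mu ^ num_levels mu q"
    using assms by (simp add: num_levels_def field_simps)
  show "mu ^ k < q" if "k < num_levels mu q"
    using not_less_Least[of k "\<lambda>k. q / mu ^ k \<le> 1"] that assms by (simp add: num_levels_def field_simps)
qed

lemma yields_levels_loop:
  assumes "\<And>i. i < k \<Longrightarrow> 1 < q / mu ^ i" "q / mu ^ k \<le> 1"
  shows "\<exists>y. yields (run (levels_loop lam mu)
      (VPair (enc_levels lam (Suc i)) (VPair (VNum (lam ^ Suc i)) (VNum q))))
    (return_pmf (VPair (enc_levels lam (Suc (i + k))) y)) (k * 40 + 20)"
  using assms unfolding levels_loop_def
proof (induction k arbitrary: q i)
  case 0
  then show ?case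
    by (intro exI, intro yields_mono[OF yields_While_stop[where r = 7]]) (auto simp: bool_val_def)
next
  case (Suc k)
  let ?S = "VPair (enc_levels lam (Suc i)) (VPair (VNum (lam ^ Suc i)) (VNum q))"
  let ?S' = "VPair (enc_levels lam (Suc (Suc i))) (VPair (VNum (lam ^ Suc (Suc i))) (VNum (q / mu)))"
  have q: "1 < q" using Suc.prems(1)[of 0] by simp
  obtain y where y: "yields (run (While (less_prog (Const 1) (Seq Tail Tail)) (levels_body lam mu)) ?S')
    (return_pmf (VPair (enc_levels lam (Suc (Suc i + k))) y)) (k * 40 + 20)"
    using Suc.IH[of "q / mu" "Suc i"] Suc.prems(1)[of "Suc _"] Suc.prems(2)
    by (metis Suc_mono divide_divide_eq_left power_Suc)
  have "yields (run (levels_body lam mu) ?S) (return_pmf ?S') 30"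
    by (rule yields_returnI) (auto simp: levels_body_def enc_levels_def)
  from yields_While_step[OF _ _ this, of "less_prog (Const 1) (Seq Tail Tail)" "VNum 1" 7
      "\<lambda>_. return_pmf (VPair (enc_levels lam (Suc (Suc i + k))) y)" "k * 40 + 20"] y q
  show ?case
    by (intro exI[of _ y]) (auto simp: bool_val_def bind_return_pmf simp del: run.simps(8,9) elim!: yields_mono)
qed

lemma yields_levels:
  assumes "mu > 1" "Suc (num_levels mu (snd a / fst a)) \<le> Z"
  shows "yields (run (levels_prog lam mu) (VPair (enc_pair a) env))
    (return_pmf (enc_levels lam (Suc (num_levels mu (snd a / fst a))))) (100 * Z)"
proof -
  define q where "q = snd a / fst a"
  let ?q = q and ?k = "num_levels mu q"
  have "1 < q / mu ^ i" if "i < ?k" for i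
    using num_levels(2)[OF assms(1) that] assms(1) by (simp add: less_divide_eq_1_pos)
  moreover have "q / mu ^ ?k \<le> 1"
    using num_levels(1)[OF assms(1), of q] assms(1) by (simp add: divide_le_eq_1_pos)
  ultimately obtain y where y: "yields (run (levels_loop lam mu)
      (VPair (enc_levels lam (Suc 0)) (VPair (VNum (lam ^ Suc 0)) (VNum ?q))))
    (return_pmf (VPair (enc_levels lam (Suc (0 + ?k))) y)) (?k * 40 + 20)"
    using yields_levels_loop[of ?k ?q mu lam 0] by blast
  have 1: "yields (run (Mk_Pair Nil_Const (Mk_Pair (Const lam) (bin Div (Seq Head Tail) (Seq Head Head))))
      (VPair (enc_pair a) env)) (return_pmf (VPair (enc_levels lam (Suc 0)) (VPair (VNum (lam ^ Suc 0)) (VNum ?q)))) 20"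
    by (rule yields_returnI) (auto simp: enc_levels_def enc_pair_def q_def split: prod.splits)
  have 2: "yields (run Head (VPair (enc_levels lam (Suc (0 + ?k))) y)) (return_pmf (enc_levels lam (Suc ?k))) 1"
    by (simp add: yields_return)
  show ?thesis unfolding levels_prog_def q_def[symmetric]
    by (rule yields_mono[OF yields_Seq_det[OF 1 yields_Seq_det[OF y 2]]]) (use assms(2) in \<open>auto simp: q_def\<close>)
qed

subsection \<open>Random bits and the random permutation\<close>

definition bits_body :: prog where
  "bits_body = Cond (Seq (Const (1/2)) Flip) (bin Div (bin Add Head (Const 1)) (Const 2)) (bin Div Head (Const 2))"

text \<open>The list of scales serves as loop counter, which couples the precision
  \<open>2 ^ (L - 1)\<close> to the depth.\<close>

definition bits_prog :: prog where
  "bits_prog = fold_prog Head (Const 0) bits_body"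

lemma yields_bits:
  assumes "L \<le> Z" "1 \<le> L"
  shows "yields (run bits_prog (VPair (enc_levels lam L) env)) (map_pmf VNum (random_bits (L - 1))) (100 * Z)"
proof -
  have body: "yields (run bits_body (VPair (VNum b) env')) (map_pmf VNum (bit_step x b)) 14" for b env' and x :: nat
  proof -
    have "yields (run bits_body (VPair (VNum b) env'))
       (bind_pmf (bernoulli_pmf (1/2)) (\<lambda>c. return_pmf (VNum ((b + of_bool c) / 2)))) (1 + 10 + 3)"
      unfolding bits_body_def
    proof (rule yields_coin)
      fix c show "yields (run (if c then bin Div (bin Add Head (Const 1)) (Const 2) else bin Div Head (Const 2))
          (VPair (VNum b) env')) (return_pmf (VNum ((b + of_bool c) / 2))) 10"
        by (cases c) (simp_all add: yields_return)
    qed simp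
    then show ?thesis by (rule yields_mono) (simp_all add: bit_step_def map_pmf_def bind_assoc_pmf bind_return_pmf)
  qed
  have "yields (run bits_prog (VPair (enc_levels lam L) env)) (map_pmf VNum (foldM bit_step (rev [1..<L]) 0)) (100 * Z ^ 1)"
    unfolding bits_prog_def enc_levels_def
    by (rule yields_fold[where I = "\<lambda>_ _. True" and r = VNum and F = bit_step and e = "\<lambda>j. VNum (lam ^ j)"
        and B = 14 and B' = 14 and k = 0 and ?B1.0 = 1 and ?B2.0 = 1])
      (use body assms in \<open>simp_all add: yields_return\<close>)
  then show ?thesis
    unfolding random_bits_def foldM_bit_step[of "rev [1..<L]"] length_rev length_upt by simp
qed

definition insert_body :: prog where
  "insert_body = Cond (Seq (bin Div (Const 1) (Seq Head Tail)) Flip)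
     (Mk_Pair (Mk_Pair (var 1) (Mk_Pair (Seq (var 2) Tail) (Seq Head Head))) (Const 0))
     (Mk_Pair (Mk_Pair (var 1) (Seq Head Head)) (bin Sub (Seq Head Tail) (Const 1)))"

definition perm_body :: prog where
  "perm_body = let_prog (fold_prog (Seq Head Head) (Mk_Pair Nil_Const (bin Add (Seq Head Tail) (Const 1))) insert_body)
     (Mk_Pair (Cond (less_prog (Const 0) (Seq Head Tail)) (Mk_Pair (Seq (var 1) Tail) (Seq Head Head)) (Seq Head Head))
       (bin Add (Seq (var 1) Tail) (Const 1)))"

text \<open>The rows of the metric serve as counter for the \<open>n\<close> insertions; their
  contents are ignored.\<close>

definition perm_prog :: prog where
  "perm_prog = fold_prog (var 3) (Mk_Pair Nil_Const (Const 0)) perm_body"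

definition enc_perm :: "nat list \<times> nat \<Rightarrow> val" where
  "enc_perm = (\<lambda>(ys, k). VPair (enc_list enc_nat ys) (enc_nat k))"

lemma yields_insert_body:
  "yields (run insert_body (VPair (VPair (enc_list enc_nat out) (VNum m)) (VPair (enc_nat y)
      (VPair (VPair z (enc_nat k)) env))))
    (map_pmf (\<lambda>(out, m). VPair (enc_list enc_nat out) (VNum m)) (insert_step k y (out, m))) 40"
proof -
  let ?env = "VPair (VPair (enc_list enc_nat out) (VNum m)) (VPair (enc_nat y) (VPair (VPair z (enc_nat k)) env))"
  let ?r = "\<lambda>(out, m). VPair (enc_list enc_nat out) (VNum m)"
  have "yields (run insert_body ?env) (bind_pmf (bernoulli_pmf (1 / m))
      (\<lambda>c. return_pmf (?r (if c then (y # k # out, 0) else (y # out, m - 1))))) (7 + 30 + 3)"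
    unfolding insert_body_def
  proof (rule yields_coin)
    fix c show "yields (run (if c then Mk_Pair (Mk_Pair (var 1) (Mk_Pair (Seq (var 2) Tail) (Seq Head Head))) (Const 0)
       else Mk_Pair (Mk_Pair (var 1) (Seq Head Head)) (bin Sub (Seq Head Tail) (Const 1))) ?env)
       (return_pmf (?r (if c then (y # k # out, 0) else (y # out, m - 1)))) 30"
      by (cases c) (simp_all add: yields_return)
  qed simp
  then show ?thesis
    by (rule yields_mono) (simp_all add: insert_step_def map_pmf_def bind_assoc_pmf bind_return_pmf)
qed

lemma yields_perm_body:
  assumes "length ys \<le> Z" "1 \<le> Z"
  shows "yields (run perm_body (VPair (enc_perm (ys, k)) env)) (map_pmf enc_perm (perm_step x (ys, k))) (200 * Z)"
proof -
  let ?r = "\<lambda>(out, m). VPair (enc_list enc_nat out) (VNum m)"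
  have 1: "yields (run (fold_prog (Seq Head Head) (Mk_Pair Nil_Const (bin Add (Seq Head Tail) (Const 1))) insert_body)
      (VPair (enc_perm (ys, k)) env)) (map_pmf ?r (foldM (insert_step k) ys ([], real k + 1)))
      (125 * Z ^ 1)"
  proof (rule yields_fold[where I = "\<lambda>_ _. True" and B = 40 and B' = 40 and k = 0])
    show "yields (run (Seq Head Head) (VPair (enc_perm (ys, k)) env)) (return_pmf (enc_list enc_nat ys)) 3"
      by (simp add: enc_perm_def yields_return)
    show "yields (run (Mk_Pair Nil_Const (bin Add (Seq Head Tail) (Const 1))) (VPair (enc_perm (ys, k)) env))
       (return_pmf (case ([], real k + 1) of (out, m) \<Rightarrow> VPair (enc_list enc_nat out) (VNum m))) 20"
      by (simp add: enc_perm_def enc_nat_def yields_return)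
    fix y and a :: "nat list \<times> real"
    show "yields (run insert_body (VPair (?r a) (VPair (enc_nat y) (VPair (enc_perm (ys, k)) env))))
       (map_pmf ?r (insert_step k y a)) 40"
      using yields_insert_body by (cases a) (simp add: enc_perm_def)
  qed (use assms in auto)
  let ?fin = "Mk_Pair (Cond (less_prog (Const 0) (Seq Head Tail)) (Mk_Pair (Seq (var 1) Tail) (Seq Head Head)) (Seq Head Head))
       (bin Add (Seq (var 1) Tail) (Const 1))"
  have 2: "yields (run ?fin (VPair (?r a) (VPair (enc_perm (ys, k)) env)))
      (return_pmf (enc_perm (if 0 < snd a then k # fst a else fst a, Suc k))) 50" for a :: "nat list \<times> real"
    by (cases a; cases "0 < snd a")
      (simp_all add: enc_perm_def enc_nat_def yields_return bool_val_def add.commute)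
  have "yields (run perm_body (VPair (enc_perm (ys, k)) env))
     (bind_pmf (foldM (insert_step k) ys ([], real k + 1))
       (\<lambda>a. return_pmf (enc_perm (if 0 < snd a then k # fst a else fst a, Suc k))))
     (125 * Z ^ 1 + 50 + 3)"
    unfolding perm_body_def by (rule yields_let_map[OF 1]) (rule 2)
  then show ?thesis
  proof (rule yields_mono)
    show "125 * Z ^ 1 + 50 + 3 \<le> 200 * Z" using assms by simp
    show "bind_pmf (foldM (insert_step k) ys ([], real k + 1))
       (\<lambda>a. return_pmf (enc_perm (if 0 < snd a then k # fst a else fst a, Suc k))) =
       map_pmf enc_perm (perm_step x (ys, k))"
      by (simp add: perm_step_def random_insert_def map_pmf_def bind_assoc_pmf bind_return_pmf case_prod_beta)
  qed
qed

lemma yields_perm: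
  assumes "n \<le> Z" "1 \<le> Z"
  shows "yields (run perm_prog (VPair b (VPair ws (VPair a (VPair (enc_metric n d) env)))))
    (map_pmf (\<lambda>p. enc_perm (p, n)) (random_perm n)) (300 * Z ^ 2)"
proof -
  have "yields (run perm_prog (VPair b (VPair ws (VPair a (VPair (enc_metric n d) env)))))
    (map_pmf enc_perm (foldM perm_step [0..<n] ([], 0))) (300 * Z ^ 2)"
    unfolding perm_prog_def enc_metric_def
  proof (rule yields_fold[where I = "\<lambda>xs a. length (fst a) = snd a \<and> snd a + length xs = n"
      and B = "200 * Z" and B' = 200 and k = 1 and ?B1.0 = 7 and ?B2.0 = 5])
    show "yields (run (var 3) (VPair b (VPair ws (VPair a (VPair (enc_list (\<lambda>u. enc_list (\<lambda>v. VNum (d u v)) [0..<n]) [0..<n]) env)))))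
      (return_pmf (enc_list (\<lambda>u. enc_list (\<lambda>v. VNum (d u v)) [0..<n]) [0..<n])) 7"
      by (simp add: yields_return)
    fix x :: nat and xs and a :: "nat list \<times> nat"
    assume I: "length (fst a) = snd a \<and> snd a + length (x # xs) = n"
    show "yields (run perm_body (VPair (enc_perm a) (VPair (enc_list (\<lambda>v. VNum (d x v)) [0..<n])
       (VPair b (VPair ws (VPair a' (VPair (enc_list (\<lambda>u. enc_list (\<lambda>v. VNum (d u v)) [0..<n]) [0..<n]) env)))))))
       (map_pmf enc_perm (perm_step x a)) (200 * Z)" for a'
      using yields_perm_body[of "fst a" Z "snd a"] I assms by simp
    fix a'' assume "a'' \<in> set_pmf (perm_step x a)"
    then have "fst a'' \<in> set_pmf (random_insert (snd a) (fst a) (real (length (fst a)) + 1))" "snd a'' = Suc (snd a)"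
      using I by (auto simp: perm_step_def case_prod_beta)
    then show "length (fst a'') = snd a'' \<and> snd a'' + length xs = n"
      using I unfolding random_insert by auto
  qed (use assms in \<open>auto simp: enc_perm_def enc_nat_def yields_return\<close>)
  then show ?thesis by (simp add: foldM_perm_step pmf.map_comp o_def)
qed

subsection \<open>Tries\<close>

lemma enc_list_cong: "(\<And>x. x \<in> set xs \<Longrightarrow> e x = e' x) \<Longrightarrow> enc_list e xs = enc_list e' xs"
  by (induction xs) auto

text \<open>A fold runs over one list only. The row of distances travels in the accumulator and
  loses its head at each step, in lockstep with the priorities.\<close>

definition center_body :: prog where
  "center_body = Mk_Pair (Seq (Seq Head Head) Tail)
     (Cond (less_prog (var 2) (Seq (Seq Head Head) Head)) (Seq Head Tail)
       (Cond (less_prog (Seq Head Tail) (var 1)) (var 1) (Seq Head Tail)))"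

definition center_prog :: prog where
  "center_prog = fold_prog (Seq (var 5) Head) (Mk_Pair (var 4) (Const 0)) center_body"

definition center_step :: "real \<Rightarrow> nat \<Rightarrow> real list \<times> nat \<Rightarrow> real list \<times> nat" where
  "center_step \<rho> p = (\<lambda>(xs, best). (tl xs, if \<rho> < hd xs then best else if best < p then p else best))"

lemma fold_center_step:
  assumes "length \<pi> = length xs"
  shows "fold (center_step \<rho>) \<pi> (xs, best) = ([], Max (insert best {\<pi> ! w | w. w < length \<pi> \<and> xs ! w \<le> \<rho>}))"
  using assms
proof (induction \<pi> arbitrary: xs best)
  case (Cons p \<pi>)
  then obtain x xs' where xs: "xs = x # xs'" "length \<pi> = length xs'" by (cases xs) auto
  let ?S = "{\<pi> ! w | w. w < length \<pi> \<and> xs' ! w \<le> \<rho>}"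
  have S: "{(p # \<pi>) ! w | w. w < length (p # \<pi>) \<and> xs ! w \<le> \<rho>} = (if x \<le> \<rho> then insert p ?S else ?S)"
  proof -
    have "{(p # \<pi>) ! w | w. w < length (p # \<pi>) \<and> xs ! w \<le> \<rho>} =
        {y. \<exists>w<Suc (length \<pi>). y = (p # \<pi>) ! w \<and> xs ! w \<le> \<rho>}" by auto
    then show ?thesis unfolding Ex_less_Suc2 by (auto simp: xs)
  qed
  have fin: "finite ?S" by simp
  have mx: "Max (insert (max a b) T) = Max (insert a (insert b T))" if "finite T" for a b :: nat and T
    using that by (cases "T = {}") (auto simp: max.assoc)
  have "fold (center_step \<rho>) (p # \<pi>) (xs, best) =
      ([], Max (insert (if \<rho> < x then best else if best < p then p else best) ?S))"
  proof -
    have "center_step \<rho> p (x # xs', best) = (xs', if \<rho> < x then best else if best < p then p else best)"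
      by (simp add: center_step_def)
    then show ?thesis using Cons.IH[OF xs(2)] by (simp add: xs(1))
  qed
  also have "(if \<rho> < x then best else if best < p then p else best) = (if x \<le> \<rho> then max best p else best)"
    by (auto simp: max_def)
  finally show ?case unfolding S using mx[OF fin] by auto
qed simp

text \<open>The initial value 0 does not affect a maximum of natural numbers over a nonempty set;
  \<open>w\<close> shows that the set is nonempty.\<close>

lemma fold_center:
  assumes "length \<pi> = n" "w < n" "d u w \<le> \<rho>"
  shows "fold (center_step \<rho>) \<pi> (map (d u) [0..<n], 0) = ([], center d n \<pi> \<rho> u)"
proof -
  have S: "{\<pi> ! w | w. w < length \<pi> \<and> map (d u) [0..<n] ! w \<le> \<rho>} = {\<pi> ! w | w. w < n \<and> d u w \<le> \<rho>}"
    using assms(1) by auto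
  have "{\<pi> ! w | w. w < n \<and> d u w \<le> \<rho>} \<noteq> {}" using assms by blast
  then have "Max (insert 0 {\<pi> ! w | w. w < n \<and> d u w \<le> \<rho>}) = Max {\<pi> ! w | w. w < n \<and> d u w \<le> \<rho>}"
    by (subst Max_insert) auto
  then show ?thesis
    using fold_center_step[of \<pi> "map (d u) [0..<n]" \<rho> 0] assms(1) unfolding S center_def by simp
qed

lemma yields_center_body:
  "yields (run center_body (VPair (VPair (enc_list VNum (y # ys)) (enc_nat best))
     (VPair (enc_nat p) (VPair (VNum \<rho>) env))))
   (return_pmf (case center_step \<rho> p (y # ys, best) of (xs, c) \<Rightarrow> VPair (enc_list VNum xs) (enc_nat c))) 40"
  by (cases "\<rho> < y"; cases "best < p")
    (simp_all add: center_body_def center_step_def enc_nat_def bool_val_def yields_return)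

lemma yields_center:
  assumes "length \<pi> = n" "w < n" "d u w \<le> \<rho>" "n \<le> Z" "1 \<le> Z"
  shows "yields (run center_prog (VPair (VNum \<rho>) (VPair z0 (VPair z1 (VPair z2
      (VPair (enc_list (\<lambda>v. VNum (d u v)) [0..<n]) (VPair (enc_perm (\<pi>, k)) env)))))))
    (return_pmf (VPair VNil (enc_nat (center d n \<pi> \<rho> u)))) (200 * Z)"
proof -
  let ?env = "VPair (VNum \<rho>) (VPair z0 (VPair z1 (VPair z2
      (VPair (enc_list (\<lambda>v. VNum (d u v)) [0..<n]) (VPair (enc_perm (\<pi>, k)) env)))))"
  let ?r = "\<lambda>(xs, c). VPair (enc_list VNum xs) (enc_nat c)"
  have "yields (run center_prog ?env) (return_pmf (?r (fold (center_step \<rho>) \<pi> (map (d u) [0..<n], 0))))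
      (200 * Z ^ 1)"
    unfolding center_prog_def
  proof (rule yields_fold_det[where I = "\<lambda>ps a. length (fst a) = length ps" and B = 40 and B' = 40 and k = 0])
    show "yields (run (Seq (var 5) Head) ?env) (return_pmf (enc_list enc_nat \<pi>)) 20"
      by (simp add: enc_perm_def yields_return)
    show "yields (run (Mk_Pair (var 4) (Const 0)) ?env) (return_pmf (?r (map (d u) [0..<n], 0))) 20"
      by (simp add: enc_list_map enc_nat_def yields_return)
    fix p :: nat and ps and a :: "real list \<times> nat"
    assume "length (fst a) = length (p # ps)"
    then obtain y ys c where a: "a = (y # ys, c)" "length ys = length ps"
      by (cases a; cases "fst a") auto
    show "yields (run center_body (VPair (?r a) (VPair (enc_nat p) ?env))) (return_pmf (?r (center_step \<rho> p a))) 40"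
      using yields_center_body[of y ys c p \<rho>] by (simp add: a)
    show "length (fst (center_step \<rho> p a)) = length ps" using a by (simp add: center_step_def)
  qed (use assms in simp_all)
  then show ?thesis using fold_center[of \<pi> n w d u \<rho>, OF assms(1-3)] by simp
qed

abbreviation if_eq :: "prog \<Rightarrow> prog \<Rightarrow> prog \<Rightarrow> prog \<Rightarrow> prog" where
  "if_eq a b p q \<equiv> Cond (less_prog a b) q (Cond (less_prog b a) q p)"

definition lookup_body :: prog where
  "lookup_body = if_eq (Seq (var 1) (Seq Tail Head)) (Seq (var 4) Head)
     (if_eq (Seq (var 1) (Seq Tail (Seq Tail Head))) (Seq (var 2) Tail) (Seq (var 1) Head) (var 0)) (var 0)"

definition lookup_prog :: prog where
  "lookup_prog = fold_prog (Seq (var 2) Tail) (Const 0) lookup_body"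

text \<open>With the newest vertex in front, creation is consing, and the number of the next vertex
  is one more than that of the head entry. Weights are stored instead of levels, as the output needs
  them.\<close>

definition enc_entries :: "real \<Rightarrow> nat \<Rightarrow> trie \<Rightarrow> val" where
  "enc_entries lam n = (\<lambda>(m, par, cen, lev). enc_list (\<lambda>i. VPair (enc_nat i) (VPair (enc_nat (par i))
     (VPair (enc_nat (cen i)) (VNum (if i = n then 0 else lam ^ lev i))))) (rev [n..<m]))"

lemma yields_lookup_body:
  "yields (run lookup_body (VPair (enc_nat r) (VPair (VPair (enc_nat i) (VPair (enc_nat p) (VPair (enc_nat c) w)))
     (VPair (VPair z1 (enc_nat k)) (VPair z2 (VPair (VPair (enc_nat cur) z3) env))))))
   (return_pmf (enc_nat (if p = cur \<and> c = k then i else r))) 110"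
  by (cases p cur rule: linorder_cases; cases c k rule: linorder_cases)
    (simp_all add: lookup_body_def enc_nat_def bool_val_def yields_return)

lemma yields_lookup:
  assumes "m \<le> n + Z" "1 \<le> Z"
  shows "yields (run lookup_prog (VPair (VPair z1 (enc_nat k)) (VPair z2
      (VPair (VPair (enc_nat cur) (enc_entries lam n (m, par, cen, lev))) env))))
    (return_pmf (enc_nat (find_child n k cur (m, par, cen, lev)))) (200 * Z)"
proof -
  let ?e = "\<lambda>i. VPair (enc_nat i) (VPair (enc_nat (par i)) (VPair (enc_nat (cen i)) (VNum (if i = n then 0 else lam ^ lev i))))"
  have "yields (run lookup_prog (VPair (VPair z1 (enc_nat k)) (VPair z2
      (VPair (VPair (enc_nat cur) (enc_list ?e (rev [n..<m]))) env))))
    (return_pmf (enc_nat (fold (\<lambda>i r. if par i = cur \<and> cen i = k then i else r) (rev [n..<m]) 0))) (200 * Z ^ 1)"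
    unfolding lookup_prog_def
    by (rule yields_fold_det[where I = "\<lambda>_ _. True" and r = enc_nat and e = ?e and B = 110 and B' = 110 and k = 0 and ?B1.0 = 20 and ?B2.0 = 1])
      (rule yields_lookup_body TrueI | use assms in \<open>simp add: yields_return enc_nat_def[of 0]\<close>)+
  then show ?thesis by (simp add: find_child_def enc_entries_def)
qed

definition radius_prog :: "real \<Rightarrow> prog" where
  "radius_prog lam = bin Mul (bin Div (bin Mul (Seq (var 7) Head) (var 1)) (Const (lam\<^sup>2)))
     (bin Add (Const 1) (bin Mul (var 5) (Const (lam - 1))))"

definition new_child :: prog where
  "new_child = Cond (less_prog (Const 0) (var 0)) (Mk_Pair (var 0) (Seq (var 3) Tail))
     (let_prog (bin Add (Seq (var 3) (Seq Tail (Seq Head Head))) (Const 1))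
       (Mk_Pair (var 0) (Mk_Pair (Mk_Pair (var 0) (Mk_Pair (Seq (var 4) Head) (Mk_Pair (Seq (var 2) Tail) (var 5))))
         (Seq (var 4) Tail))))"

text \<open>Environment from the top: node, scale, state of the outer fold, row of distances,
  permutation, \<open>b\<close>, scales, extreme distances. Each \<open>let_prog\<close> shifts
  these indices by one.\<close>

definition level_body :: "real \<Rightarrow> prog" where
  "level_body lam = let_prog (radius_prog lam) (let_prog center_prog (let_prog lookup_prog new_child))"

definition enc_node :: "real \<Rightarrow> nat \<Rightarrow> nat \<times> trie \<Rightarrow> val" where
  "enc_node lam n = (\<lambda>(cur, t). VPair (enc_nat cur) (enc_entries lam n t))"

lemma enc_entries_new:
  assumes "n < m"
  shows "enc_entries lam n (Suc m, par(m := cur), cen(m := k), lev(m := j)) =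
    VPair (VPair (enc_nat m) (VPair (enc_nat cur) (VPair (enc_nat k) (VNum (lam ^ j)))))
      (enc_entries lam n (m, par, cen, lev))"
  using assms by (auto simp: enc_entries_def intro: enc_list_cong)

lemma yields_new_child:
  assumes "n < m" "r = find_child n k cur (m, par, cen, lev)"
  shows "yields (run new_child (VPair (enc_nat r) (VPair (VPair z1 (enc_nat k)) (VPair z2
      (VPair (enc_node lam n (cur, m, par, cen, lev)) (VPair (VNum (lam ^ j)) env))))))
    (return_pmf (enc_node lam n (descend n k j (cur, m, par, cen, lev)))) 90"
proof (cases "0 < r")
  case True
  then show ?thesis using assms(2)
    by (simp add: new_child_def descend_def enc_node_def bool_val_def enc_nat_def yields_return)
next
  case False
  obtain m' where m: "m = Suc m'" "n \<le> m'" using assms(1) by (cases m) auto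
  have "head_val (head_val (enc_entries lam n (m, par, cen, lev))) = enc_nat m'"
    by (simp add: enc_entries_def m)
  then show ?thesis using False assms
    by (simp add: new_child_def descend_def enc_node_def bool_val_def enc_nat_def m(1) add.commute
        enc_entries_new[OF assms(1), unfolded m(1)] yields_return)
qed

lemma descend_size: "fst t \<le> fst (snd (descend n k j (cur, t))) \<and> fst (snd (descend n k j (cur, t))) \<le> Suc (fst t)"
  by (cases t) (auto simp: descend_def Let_def)

lemma yields_level_body:
  assumes "n < m" "m \<le> n + Z ^ 2" "n \<le> Z" "1 \<le> Z" "length \<pi> = n" "u < n" "d u u \<le> radius lam s b j"
  shows "yields (run (level_body lam) (VPair (enc_node lam n (cur, m, par, cen, lev)) (VPair (VNum (lam ^ j)) (VPair z
      (VPair (enc_list (\<lambda>v. VNum (d u v)) [0..<n]) (VPair (enc_perm (\<pi>, k)) (VPair (VNum b) (VPair ws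
      (VPair (enc_pair (s, D)) env)))))))))
    (return_pmf (enc_node lam n (descend n (center d n \<pi> (radius lam s b j) u) j (cur, m, par, cen, lev)))) (600 * Z ^ 2)"
proof -
  let ?env = "VPair (enc_node lam n (cur, m, par, cen, lev)) (VPair (VNum (lam ^ j)) (VPair z
      (VPair (enc_list (\<lambda>v. VNum (d u v)) [0..<n]) (VPair (enc_perm (\<pi>, k)) (VPair (VNum b) (VPair ws
      (VPair (enc_pair (s, D)) env)))))))"
  let ?\<rho> = "radius lam s b j"
  have 1: "yields (run (radius_prog lam) ?env) (return_pmf (VNum ?\<rho>)) 60"
    by (rule yields_returnI) (auto simp: radius_prog_def radius_def enc_pair_def)
  have 2: "yields (run center_prog (VPair (VNum ?\<rho>) ?env)) (return_pmf (VPair VNil (enc_nat (center d n \<pi> ?\<rho> u)))) (200 * Z)"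
    using assms by (intro yields_center) auto
  have 3: "yields (run lookup_prog (VPair (VPair VNil (enc_nat (center d n \<pi> ?\<rho> u))) (VPair (VNum ?\<rho>) ?env)))
      (return_pmf (enc_nat (find_child n (center d n \<pi> ?\<rho> u) cur (m, par, cen, lev)))) (200 * Z ^ 2)"
    using yields_lookup[of m n "Z ^ 2"] assms by (simp add: enc_node_def)
  have 4: "yields (run new_child (VPair (enc_nat (find_child n (center d n \<pi> ?\<rho> u) cur (m, par, cen, lev)))
      (VPair (VPair VNil (enc_nat (center d n \<pi> ?\<rho> u))) (VPair (VNum ?\<rho>) ?env))))
    (return_pmf (enc_node lam n (descend n (center d n \<pi> ?\<rho> u) j (cur, m, par, cen, lev)))) 90"
    by (rule yields_new_child[OF assms(1) refl])
  have "Z \<le> Z ^ 2" "1 \<le> Z ^ 2" using assms(4) by (simp_all add: power2_eq_square)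
  then show ?thesis unfolding level_body_def
    by (intro yields_mono[OF yields_let_det[OF 1 yields_let_det[OF 2 yields_let_det[OF 3 4]]]]) auto
qed

definition point_body :: "real \<Rightarrow> prog" where
  "point_body lam = let_prog (fold_prog (var 4) (Mk_Pair (Seq (var 2) Tail) (Seq Head Tail)) (level_body lam))
     (Mk_Pair (Mk_Pair (Seq Head Head) (Seq (var 1) Head)) (Seq Head Tail))"

definition trie_prog :: "real \<Rightarrow> prog" where
  "trie_prog lam = fold_prog (var 4) (Mk_Pair Nil_Const (Mk_Pair (Mk_Pair (Seq Head Tail) (Mk_Pair (Seq Head Tail)
     (Mk_Pair (Seq Head Tail) (Const 0)))) Nil_Const)) (point_body lam)"

definition enc_state :: "real \<Rightarrow> nat \<Rightarrow> nat \<times> trie \<Rightarrow> val" where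
  "enc_state lam n = (\<lambda>(k, t). VPair (enc_list (\<lambda>u. enc_nat (fst (snd t) u)) (rev [0..<k])) (enc_entries lam n t))"

lemma fold_descend_size:
  "fst (snd ct) \<le> fst (snd (fold (\<lambda>j. descend n (c j) j) js ct)) \<and>
    fst (snd (fold (\<lambda>j. descend n (c j) j) js ct)) \<le> fst (snd ct) + length js"
proof (induction js arbitrary: ct)
  case (Cons j js)
  show ?case using Cons[of "descend n (c j) j ct"] descend_size[of "snd ct" n "c j" j "fst ct"] by simp
qed simp

lemma insert_point_size:
  "fst t \<le> fst (insert_point n L c u t)" "fst (insert_point n L c u t) \<le> fst t + (L - 1)"
  using fold_descend_size[of "(n, t)" n "\<lambda>j. c j u" "rev [1..<L]"]
  by (simp_all add: insert_point_def case_prod_beta)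

lemma yields_point_body:
  assumes "n < fst t" "fst t + (L - 1) \<le> n + Z ^ 2" "n \<le> Z" "L \<le> Z" "1 \<le> Z" "length \<pi> = n" "u < n"
    "\<And>j. d u u \<le> radius lam s b j"
  shows "yields (run (point_body lam) (VPair (enc_state lam n (u, t))
      (VPair (enc_list (\<lambda>v. VNum (d u v)) [0..<n]) (VPair (enc_perm (\<pi>, n)) (VPair (VNum b) (VPair (enc_levels lam L)
      (VPair (enc_pair (s, D)) env)))))))
    (return_pmf (enc_state lam n (Suc u, insert_point n L (\<lambda>j. center d n \<pi> (radius lam s b j)) u t))) (800 * Z ^ 3)"
proof -
  let ?env = "VPair (enc_state lam n (u, t))
      (VPair (enc_list (\<lambda>v. VNum (d u v)) [0..<n]) (VPair (enc_perm (\<pi>, n)) (VPair (VNum b) (VPair (enc_levels lam L)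
      (VPair (enc_pair (s, D)) env)))))"
  define c where "c j = center d n \<pi> (radius lam s b j)" for j
  obtain cur m par cen lev where F: "fold (\<lambda>j. descend n (c j u) j) (rev [1..<L]) (n, t) = (cur, m, par, cen, lev)"
    by (cases "fold (\<lambda>j. descend n (c j u) j) (rev [1..<L]) (n, t)")
  have 1: "yields (run (fold_prog (var 4) (Mk_Pair (Seq (var 2) Tail) (Seq Head Tail)) (level_body lam)) ?env)
      (return_pmf (enc_node lam n (fold (\<lambda>j. descend n (c j u) j) (rev [1..<L]) (n, t))))
      (700 * Z ^ 3)"
  proof (rule yields_fold_det[where I = "\<lambda>js ct. n < fst (snd ct) \<and> fst (snd ct) + length js \<le> n + Z ^ 2"
      and B = "600 * Z ^ 2" and B' = 600 and k = 2 and ?B1.0 = 9 and ?B2.0 = 11])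
    show "yields (run (var 4) ?env) (return_pmf (enc_list (\<lambda>j. VNum (lam ^ j)) (rev [1..<L]))) 9"
      by (simp add: enc_levels_def yields_return)
    show "yields (run (Mk_Pair (Seq (var 2) Tail) (Seq Head Tail)) ?env) (return_pmf (enc_node lam n (n, t))) 11"
      by (simp add: enc_perm_def enc_state_def enc_node_def yields_return)
    show "n < fst (snd (n, t)) \<and> fst (snd (n, t)) + length (rev [1..<L]) \<le> n + Z ^ 2" using assms by simp
    fix j :: nat and js and ct :: "nat \<times> trie"
    assume I: "n < fst (snd ct) \<and> fst (snd ct) + length (j # js) \<le> n + Z ^ 2"
    obtain cur m par cen lev where ct: "ct = (cur, m, par, cen, lev)" by (cases ct)
    show "yields (run (level_body lam) (VPair (enc_node lam n ct) (VPair (VNum (lam ^ j)) ?env)))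
       (return_pmf (enc_node lam n (descend n (c j u) j ct))) (600 * Z ^ 2)"
      unfolding ct c_def by (rule yields_level_body) (use I assms in \<open>auto simp: ct\<close>)
    show "n < fst (snd (descend n (c j u) j ct)) \<and> fst (snd (descend n (c j u) j ct)) + length js \<le> n + Z ^ 2"
      using I descend_size[of "snd ct" n "c j u" j "fst ct"] by auto
  qed (use assms in auto)
  have 2: "yields (run (Mk_Pair (Mk_Pair (Seq Head Head) (Seq (var 1) Head)) (Seq Head Tail))
      (VPair (enc_node lam n (cur, m, par, cen, lev)) ?env))
      (return_pmf (enc_state lam n (Suc u, (m, par(u := cur), cen, lev)))) 20"
  proof -
    have "enc_list (\<lambda>v. enc_nat (fst (snd t) v)) (rev [0..<u]) = enc_list (\<lambda>v. enc_nat ((par(u := cur)) v)) (rev [0..<u])"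
    proof (rule enc_list_cong)
      fix v assume "v \<in> set (rev [0..<u])"
      then have v: "v < u" by simp
      \<comment> \<open>Descents write parents only at fresh vertices, so the parents of earlier
        points, already encoded, remain valid.\<close>
      have "fst (snd (snd (fold (\<lambda>j. descend n (c j u) j) js ct))) v = fst (snd (snd ct)) v"
        if "v < fst (snd ct)" for js ct
        using that
      proof (induction js arbitrary: ct)
        case (Cons j js)
        have "fst (snd (snd (descend n (c j u) j ct))) v = fst (snd (snd ct)) v"
          using Cons.prems by (cases ct) (auto simp: descend_def Let_def)
        then show ?case using Cons descend_size[of "snd ct" n "c j u" j "fst ct"] by simp
      qed simp
      from this[of "(n, t)" "rev [1..<L]", unfolded F] show "enc_nat (fst (snd t) v) = enc_nat ((par(u := cur)) v)"
        using v assms(1,7) by simp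
    qed
    moreover have "enc_entries lam n (m, par, cen, lev) = enc_entries lam n (m, par(u := cur), cen, lev)"
      using assms(7) by (auto simp: enc_entries_def intro: enc_list_cong)
    ultimately show ?thesis by (simp add: enc_state_def enc_node_def yields_return)
  qed
  have "1 \<le> Z ^ 3" using assms(5) by simp
  then have "700 * Z ^ 3 + 20 + 3 \<le> 800 * Z ^ 3" by linarith
  moreover have "insert_point n L (\<lambda>j. center d n \<pi> (radius lam s b j)) u t = (m, par(u := cur), cen, lev)"
    unfolding c_def[abs_def, symmetric] insert_point_def F by simp
  ultimately show ?thesis unfolding point_body_def
    by (intro yields_mono[OF yields_let_det[OF 1[unfolded F] 2]]) (simp_all only:)
qed

lemma yields_trie:
  assumes "n \<le> Z" "L \<le> Z" "1 \<le> n" "1 \<le> L" "length \<pi> = n" "\<And>u j. u < n \<Longrightarrow> d u u \<le> radius lam s b j"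
  shows "yields (run (trie_prog lam) (VPair (enc_perm (\<pi>, n)) (VPair (VNum b) (VPair (enc_levels lam L)
      (VPair (enc_pair (s, D)) (VPair (enc_metric n d) env))))))
    (return_pmf (enc_state lam n (n, build_trie n L (\<lambda>j. center d n \<pi> (radius lam s b j))))) (1000 * Z ^ 4)"
proof -
  let ?env = "VPair (enc_perm (\<pi>, n)) (VPair (VNum b) (VPair (enc_levels lam L)
      (VPair (enc_pair (s, D)) (VPair (enc_metric n d) env))))"
  define c where "c j = center d n \<pi> (radius lam s b j)" for j
  define t0 :: trie where "t0 = (Suc n, \<lambda>_. n, \<lambda>_. n, \<lambda>v. if v = n then L else 0)"
  have nL: "Suc n + n * (L - 1) \<le> n + Z ^ 2"
  proof -
    have "1 + n * (L - 1) \<le> n * L" using assms(3,4) by (cases L) auto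
    also have "\<dots> \<le> Z * Z" using assms by (intro mult_mono) auto
    finally show ?thesis by (simp add: power2_eq_square)
  qed
  have 1: "yields (run (trie_prog lam) ?env)
      (return_pmf (enc_state lam n (fold (\<lambda>u (k, t). (Suc k, insert_point n L c u t)) [0..<n] (0, t0))))
      (1000 * Z ^ 4)"
    unfolding trie_prog_def
  \<comment> \<open>The invariant reserves \<open>L - 1\<close> vertices for each point still to be
    inserted, so the size of the trie is under control at every step, not only at the end.\<close>
  proof (rule yields_fold_det[where I = "\<lambda>us (k, t). us = [k..<n] \<and> n < fst t \<and> fst t + length us * (L - 1) \<le> n + Z ^ 2"
      and B = "800 * Z ^ 3" and B' = 800 and k = 3 and ?B1.0 = 9 and ?B2.0 = 30])
    show "yields (run (var 4) ?env) (return_pmf (enc_list (\<lambda>u. enc_list (\<lambda>v. VNum (d u v)) [0..<n]) [0..<n])) 9"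
      by (simp add: enc_metric_def yields_return)
    show "yields (run (Mk_Pair Nil_Const (Mk_Pair (Mk_Pair (Seq Head Tail) (Mk_Pair (Seq Head Tail)
       (Mk_Pair (Seq Head Tail) (Const 0)))) Nil_Const)) ?env) (return_pmf (enc_state lam n (0, t0))) 30"
      by (simp add: enc_state_def enc_entries_def t0_def enc_perm_def yields_return)
    show "case (0, t0) of (k, t) \<Rightarrow> [0..<n] = [k..<n] \<and> n < fst t \<and> fst t + length [0..<n] * (L - 1) \<le> n + Z ^ 2"
      using nL by (simp add: t0_def)
    fix u us and kt :: "nat \<times> trie"
    assume I: "case kt of (k, t) \<Rightarrow> u # us = [k..<n] \<and> n < fst t \<and> fst t + length (u # us) * (L - 1) \<le> n + Z ^ 2"
    obtain k t where kt: "kt = (k, t)" by (cases kt)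
    from I have I: "u # us = [k..<n]" "n < fst t" "fst t + length (u # us) * (L - 1) \<le> n + Z ^ 2"
      unfolding kt prod.case by blast+
    from I(1)[symmetric] have k: "k < n" "u = k" "us = [Suc k..<n]" by (auto simp: upt_eq_Cons_conv)
    show "yields (run (point_body lam) (VPair (enc_state lam n kt) (VPair (enc_list (\<lambda>v. VNum (d u v)) [0..<n]) ?env)))
       (return_pmf (enc_state lam n (case kt of (k, t) \<Rightarrow> (Suc k, insert_point n L c u t)))) (800 * Z ^ 3)"
    proof -
      have sz: "fst t + (L - 1) \<le> n + Z ^ 2" using I(3) by simp
      have "u < n" "1 \<le> Z" using k assms by auto
      from yields_point_body[OF I(2) sz assms(1,2) this(2) assms(5) this(1), of d lam s b D "VPair (enc_metric n d) env"]
      show ?thesis using assms(6)[OF \<open>u < n\<close>] k(2) by (simp add: kt c_def[abs_def])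
    qed
    show "case (case kt of (k, t) \<Rightarrow> (Suc k, insert_point n L c u t)) of
        (k, t) \<Rightarrow> us = [k..<n] \<and> n < fst t \<and> fst t + length us * (L - 1) \<le> n + Z ^ 2"
    proof -
      have "fst t + (L - 1) + length us * (L - 1) \<le> n + Z ^ 2" using I(3) by simp
      then have "fst (insert_point n L c u t) + length us * (L - 1) \<le> n + Z ^ 2"
        using insert_point_size(2)[of n L c u t] by linarith
      then show ?thesis using I(2) k(3) insert_point_size(1)[of t n L c u] by (simp add: kt)
    qed
  qed (use assms in auto)
  have "fold (\<lambda>u (k, t). (Suc k, insert_point n L c u t)) us (k, t) = (k + length us, fold (insert_point n L c) us t)"
    for us k t by (induction us arbitrary: k t) auto
  then have 2: "fold (\<lambda>u (k, t). (Suc k, insert_point n L c u t)) [0..<n] (0, t0) = (n, build_trie n L c)"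
    by (simp add: build_trie_def t0_def)
  from 1[unfolded 2] show ?thesis unfolding c_def[abs_def] .
qed

subsection \<open>Output of the tree\<close>

text \<open>The entries come newest first, so consing them one by one yields increasing numbers, as
  \<open>enc_wtree\<close> requires. The points are put in front afterwards.\<close>

definition inner_out :: prog where
  "inner_out = fold_prog (Seq Head Tail) Nil_Const
     (Mk_Pair (Mk_Pair (Seq (var 1) (Seq Tail Head)) (Seq (var 1) (Seq Tail (Seq Tail Tail)))) (var 0))"

definition point_out :: prog where
  "point_out = fold_prog (Seq (var 1) Head) (var 0) (Mk_Pair (Mk_Pair (var 1) (Const 1)) (var 0))"

definition out_prog :: prog where
  "out_prog = let_prog inner_out (let_prog point_out (Mk_Pair (Seq (var 3) Tail) (var 0)))"

definition trie_tree :: "real \<Rightarrow> nat \<Rightarrow> trie \<Rightarrow> wtree" where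
  "trie_tree lam n = (\<lambda>(m, par, cen, lev). level_tree.tree lam n m par lev)"

lemma fold_VPair: "fold (\<lambda>x. VPair (h x)) (rev xs) (enc_list h ys) = enc_list h (xs @ ys)"
  by (simp add: enc_list_def foldr_conv_fold)

lemma fold_VPair_Nil: "fold (\<lambda>x. VPair (h x)) (rev xs) VNil = enc_list h xs"
  using fold_VPair[of h xs "[]"] by simp

lemma yields_out:
  assumes inv: "trie_inv n L c n ex (m, par, cen, lev)" and lt: "level_tree lam n L m par lev"
    and "m \<le> n + Z ^ 2" "n \<le> Z" "1 \<le> Z"
  shows "yields (run out_prog (VPair (enc_state lam n (n, m, par, cen, lev)) (VPair (enc_perm (\<pi>, n)) env)))
    (return_pmf (enc_wtree (trie_tree lam n (m, par, cen, lev)))) (500 * Z ^ 2)"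
proof -
  interpret level_tree lam n L m par lev by (rule lt)
  let ?env = "VPair (enc_state lam n (n, m, par, cen, lev)) (VPair (enc_perm (\<pi>, n)) env)"
  let ?e = "\<lambda>i. VPair (enc_nat i) (VPair (enc_nat (par i)) (VPair (enc_nat (cen i)) (VNum (if i = n then 0 else lam ^ lev i))))"
  define h where "h v = VPair (enc_nat (par v)) (VNum (if v = n then 0 else lam ^ lev v))" for v
  have Z2: "Z \<le> Z ^ 2" "1 \<le> Z ^ 2" using assms(5) by (simp_all add: power2_eq_square)
  have 1: "yields (run inner_out ?env) (return_pmf (fold (\<lambda>x. VPair (h x)) (rev [n..<m]) VNil)) (100 * (Z ^ 2) ^ 1)"
    unfolding inner_out_def
    by (rule yields_fold_det[where I = "\<lambda>_ _. True" and r = "\<lambda>v. v" and e = ?e and B = 30 and B' = 30 and k = 0 and ?B1.0 = 3 and ?B2.0 = 1])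
      (use assms(3) Z2 in \<open>simp_all add: yields_return h_def enc_state_def enc_entries_def\<close>)
  have 2: "yields (run point_out (VPair (enc_list h [n..<m]) ?env))
     (return_pmf (fold (\<lambda>x. VPair (VPair (enc_nat (par x)) (VNum 1))) (rev [0..<n]) (enc_list h [n..<m]))) (100 * Z ^ 1)"
    unfolding point_out_def
    by (rule yields_fold_det[where I = "\<lambda>_ _. True" and r = "\<lambda>v. v" and e = "\<lambda>u. enc_nat (par u)" and B = 30 and B' = 30 and k = 0 and ?B1.0 = 10 and ?B2.0 = 1])
      (use assms(4,5) in \<open>simp_all add: yields_return enc_state_def\<close>)
  have "fold (\<lambda>x. VPair (VPair (enc_nat (par x)) (VNum 1))) (rev [0..<n]) (enc_list h [n..<m]) =
      fold (\<lambda>x. VPair (h x)) (rev [0..<n]) (enc_list h [n..<m])"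
    by (rule fold_cong) (use point in \<open>auto simp: h_def fun_eq_iff\<close>)
  also have "\<dots> = enc_list h [0..<m]"
    using nm upt_add_eq_append[of 0 n "m - n"] by (simp add: fold_VPair)
  finally have 3: "fold (\<lambda>x. VPair (VPair (enc_nat (par x)) (VNum 1))) (rev [0..<n]) (enc_list h [n..<m]) =
      enc_list h [0..<m]" .
  have 4: "yields (run (Mk_Pair (Seq (var 3) Tail) (var 0)) (VPair (enc_list h [0..<m]) (VPair (enc_list h [n..<m]) ?env)))
      (return_pmf (VPair (enc_nat n) (enc_list h [0..<m]))) 20"
    by (simp add: enc_perm_def yields_return)
  have "100 * (Z ^ 2) ^ 1 + (100 * Z ^ 1 + 20 + 3) + 3 \<le> 500 * Z ^ 2" using Z2 by simp
  then show ?thesis unfolding out_prog_def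
    by (intro yields_mono[OF yields_let_det[OF 1[unfolded fold_VPair_Nil] yields_let_det[OF 2[unfolded 3] 4]]])
      (auto simp: enc_wtree_def trie_tree_def h_def[abs_def])
qed

subsection \<open>The reduction\<close>

text \<open>Hands the given program the tree, the rescaled facility cost and the client counts, the
  last being what remains of the environment after eight tails. The tree is kept for the
  output.\<close>

definition finish_prog :: "prog \<Rightarrow> prog" where
  "finish_prog P = Mk_Pair (Seq (Mk_Pair (var 0) (Mk_Pair (bin Div (var 7) (Seq (var 5) Head)) (tails 8))) P) (var 0)"

definition tree_prog :: "real \<Rightarrow> prog \<Rightarrow> prog" where
  "tree_prog lam P = let_prog (trie_prog lam) (let_prog out_prog (finish_prog P))"

definition reduction_prog :: "real \<Rightarrow> real \<Rightarrow> prog \<Rightarrow> prog" where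
  "reduction_prog lam mu P =
     let_prog scan_prog (let_prog (levels_prog lam mu) (let_prog bits_prog (let_prog perm_prog (tree_prog lam P))))"

definition random_tree :: "real \<Rightarrow> nat \<Rightarrow> nat \<Rightarrow> real \<Rightarrow> (nat \<Rightarrow> nat \<Rightarrow> real) \<Rightarrow> real \<Rightarrow> nat list \<Rightarrow> wtree" where
  "random_tree lam n L s d b \<pi> = trie_tree lam n (build_trie n L (\<lambda>j. center d n \<pi> (radius lam s b j)))"

lemma tails8: "tails 8 = Seq Tail (Seq Tail (Seq Tail (Seq Tail (Seq Tail (Seq Tail (Seq Tail (Seq Tail Skip)))))))"
  by (simp add: numeral_eq_Suc)

lemma build_trie_size: "1 \<le> L \<Longrightarrow> 1 \<le> n \<Longrightarrow> fst (build_trie n L c) \<le> n + n * L"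
proof -
  assume "1 \<le> L" "1 \<le> n"
  have "fst (fold (insert_point n L c) us t) \<le> fst t + length us * (L - 1)" for us t
  proof (induction us arbitrary: t)
    case (Cons u us)
    show ?case using Cons.IH[of "insert_point n L c u t"] insert_point_size(2)[of n L c u t] by simp
  qed simp
  from this[of "[0..<n]" "(Suc n, \<lambda>_. n, \<lambda>_. n, \<lambda>v. if v = n then L else 0)"]
  have "fst (build_trie n L c) \<le> Suc n + n * (L - 1)" by (simp add: build_trie_def)
  also have "\<dots> \<le> n + n * L" using \<open>1 \<le> L\<close> \<open>1 \<le> n\<close> by (cases L) auto
  finally show ?thesis .
qed

lemma center_less:
  assumes "\<pi> \<in> permutations_of_set {..<n}" "w < n" "d u w \<le> \<rho>"
  shows "center d n \<pi> \<rho> u < n"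
proof -
  obtain w' where "w' < n" "center d n \<pi> \<rho> u = \<pi> ! w'" using center_in[of w n d u \<rho> \<pi>] assms by blast
  moreover have "length \<pi> = n" "set \<pi> = {..<n}"
    using assms(1) by (auto simp: permutations_of_set_def distinct_card[symmetric])
  ultimately show ?thesis using nth_mem[of w' \<pi>] by auto
qed

lemma yields_reduction:
  fixes d :: "nat \<Rightarrow> nat \<Rightarrow> real"
  assumes lam: "lam > 1" and mu: "mu > 1" and ext: "extremes n d = (s, D)" and s: "s > 0"
    and L: "L = Suc (num_levels mu (D / s))" and Z: "n \<le> Z" "L \<le> Z" "1 \<le> n" and d0: "\<And>u. u < n \<Longrightarrow> d u u = 0"
    and P: "\<And>b \<pi>. b \<in> set_pmf (random_bits (L - 1)) \<Longrightarrow> \<pi> \<in> permutations_of_set {..<n} \<Longrightarrow>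
      yields (run P (VPair (enc_wtree (random_tree lam n L s d b \<pi>)) (VPair (VNum (f / s)) N))) (M b \<pi>) B"
  shows "yields (run (reduction_prog lam mu P) (VPair (enc_metric n d) (VPair (VNum f) N)))
    (bind_pmf (random_bits (L - 1)) (\<lambda>b. bind_pmf (random_perm n)
      (\<lambda>\<pi>. map_pmf (\<lambda>v. VPair v (enc_wtree (random_tree lam n L s d b \<pi>))) (M b \<pi>)))) (B + 3000 * Z ^ 4)"
proof -
  let ?env0 = "VPair (enc_metric n d) (VPair (VNum f) N)"
  let ?env1 = "VPair (enc_pair (s, D)) ?env0"
  let ?env2 = "VPair (enc_levels lam L) ?env1"
  have Z1: "1 \<le> Z" using Z by simp
  have 1: "yields (run scan_prog ?env0) (return_pmf (enc_pair (s, D))) (200 * Z ^ 2)"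
    using yields_scan[OF Z(1) Z1, of d] by (simp add: ext)
  have 2: "yields (run (levels_prog lam mu) ?env1) (return_pmf (enc_levels lam L)) (100 * Z)"
    using yields_levels[OF mu, of "(s, D)" Z lam] Z by (simp add: L)
  have 3: "yields (run bits_prog ?env2) (map_pmf VNum (random_bits (L - 1))) (100 * Z)"
    using Z L by (intro yields_bits) auto
  have main: "yields (run (tree_prog lam P) (VPair (enc_perm (\<pi>, n)) (VPair (VNum b) ?env2)))
     (map_pmf (\<lambda>v. VPair v (enc_wtree (random_tree lam n L s d b \<pi>))) (M b \<pi>)) (B + 1600 * Z ^ 4)"
    if b: "b \<in> set_pmf (random_bits (L - 1))" and \<pi>: "\<pi> \<in> permutations_of_set {..<n}" for b \<pi>
  proof -
    let ?env4 = "VPair (enc_perm (\<pi>, n)) (VPair (VNum b) ?env2)"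
    define c where "c j = center d n \<pi> (radius lam s b j)" for j
    have rad: "d u u \<le> radius lam s b j" if "u < n" for u j
      using d0[OF that] radius_bounds(1)[OF lam s, of b j] set_random_bits[OF b] by simp
    have len: "length \<pi> = n" using \<pi> by (metis card_lessThan length_finite_permutations_of_set)
    have c: "c j u < n" if "u < n" for j u
      unfolding c_def using center_less[OF \<pi> that, of d u] rad[OF that] by blast
    obtain m par cen lev where t: "build_trie n L c = (m, par, cen, lev)" by (cases "build_trie n L c")
    have L1: "1 \<le> L" using L by simp
    have inv: "trie_inv n L c n n (m, par, cen, lev)" using build_trie_inv[of n c L] c L1 Z by (simp add: t)
    have lt: "level_tree lam n L m par lev" by (rule build_trie_level_tree(1)[OF lam Z(3) _ L1 t]) (rule c)
    have nL: "n * L \<le> Z ^ 2" unfolding power2_eq_square using Z by (intro mult_mono) auto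
    have m: "m \<le> n + Z ^ 2" using build_trie_size[OF L1 Z(3), of c] nL by (simp add: t)
    have 5: "yields (run (trie_prog lam) ?env4) (return_pmf (enc_state lam n (n, m, par, cen, lev))) (1000 * Z ^ 4)"
      using yields_trie[where n = n and Z = Z and L = L and \<pi> = \<pi> and d = d and lam = lam and s = s and b = b and D = D]
        Z L1 len rad by (simp add: t[unfolded c_def[abs_def]])
    have tree: "trie_tree lam n (m, par, cen, lev) = random_tree lam n L s d b \<pi>"
      by (simp add: random_tree_def t[unfolded c_def[abs_def]])
    have 6: "yields (run out_prog (VPair (enc_state lam n (n, m, par, cen, lev)) ?env4))
       (return_pmf (enc_wtree (random_tree lam n L s d b \<pi>))) (500 * Z ^ 2)"
      unfolding tree[symmetric] by (rule yields_out[OF inv lt m Z(1) Z1])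
    let ?env6 = "VPair (enc_wtree (random_tree lam n L s d b \<pi>)) (VPair (enc_state lam n (n, m, par, cen, lev)) ?env4)"
    have 7: "yields (run (Mk_Pair (var 0) (Mk_Pair (bin Div (var 7) (Seq (var 5) Head)) (tails 8))) ?env6)
       (return_pmf (VPair (enc_wtree (random_tree lam n L s d b \<pi>)) (VPair (VNum (f / s)) N))) 60"
      by (rule yields_returnI) (auto simp: enc_pair_def tails8)
    have 8: "yields (run (finish_prog P) ?env6)
       (bind_pmf (M b \<pi>) (\<lambda>v. map_pmf (VPair v) (return_pmf (enc_wtree (random_tree lam n L s d b \<pi>)))))
       ((60 + B + 1) + 1 + 1)"
      unfolding finish_prog_def by (intro yields_Mk_Pair yields_Seq_det[OF 7] P b \<pi>) (simp add: yields_return)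
    have "Z ^ 2 \<le> Z ^ 4" "1 \<le> Z ^ 4" using Z1 by (auto intro: power_increasing)
    then show ?thesis unfolding tree_prog_def
      by (intro yields_mono[OF yields_let_det[OF 5 yields_let_det[OF 6 8]]]) (auto simp: map_pmf_def bind_return_pmf)
  qed
  have 4: "yields (run perm_prog (VPair (VNum b) ?env2))
    (map_pmf (\<lambda>p. enc_perm (p, n)) (random_perm n)) (300 * Z ^ 2)" for b
    by (rule yields_perm[OF Z(1) Z1])
  have fin: "set_pmf (random_perm n) = permutations_of_set {..<n}" by simp
  have 9: "yields (run (let_prog bits_prog (let_prog perm_prog (tree_prog lam P))) ?env2)
    (bind_pmf (random_bits (L - 1)) (\<lambda>b. bind_pmf (random_perm n)
      (\<lambda>\<pi>. map_pmf (\<lambda>v. VPair v (enc_wtree (random_tree lam n L s d b \<pi>))) (M b \<pi>))))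
    (100 * Z + (300 * Z ^ 2 + (B + 1600 * Z ^ 4) + 3) + 3)"
    by (intro yields_let_map[OF 3] yields_let_map[OF 4] main) (simp_all add: fin)
  have "Z \<le> Z ^ 4" "Z ^ 2 \<le> Z ^ 4" "1 \<le> Z ^ 4" using Z1 by (auto intro: power_increasing self_le_power)
  then show ?thesis unfolding reduction_prog_def
    by (intro yields_mono[OF yields_let_det[OF 1 yields_let_det[OF 2 9]]]) auto
qed

section \<open>Distortion of the random tree\<close>

lemma fold_fold_concat: "fold (\<lambda>u. fold g (h u)) us = fold g (concat (map h us))"
  by (induction us) (auto simp: fun_eq_iff)

lemma extremes_fold:
  "extremes n d = fold scan_step (concat (map (\<lambda>u. map (d u) [0..<n]) [0..<n])) (1, 1)"
proof -
  have "fold (\<lambda>v. scan_step (d u v)) [0..<n] = fold scan_step (map (d u) [0..<n])" for u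
    by (simp add: fold_map comp_def)
  then show ?thesis by (simp add: extremes_def fold_fold_concat)
qed

lemma fold_scan_step:
  assumes "fold scan_step xs (s0, D0) = (s, D)" "0 < s0"
  shows "0 < s" "s \<le> s0" "D0 \<le> D" "\<And>x. x \<in> set xs \<Longrightarrow> 0 < x \<Longrightarrow> s \<le> x" "\<And>x. x \<in> set xs \<Longrightarrow> x \<le> D"
    "s = s0 \<or> s \<in> set xs" "D = D0 \<or> D \<in> set xs"
proof -
  have "0 < s \<and> s \<le> s0 \<and> D0 \<le> D \<and> (\<forall>x\<in>set xs. 0 < x \<longrightarrow> s \<le> x) \<and> (\<forall>x\<in>set xs. x \<le> D) \<and>
    (s = s0 \<or> s \<in> set xs) \<and> (D = D0 \<or> D \<in> set xs)"
    using assms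
  proof (induction xs arbitrary: s0 D0)
    case (Cons x xs)
    obtain s1 D1 where 1: "scan_step x (s0, D0) = (s1, D1)" by (cases "scan_step x (s0, D0)")
    then have 2: "0 < s1" "s1 \<le> s0" "D0 \<le> D1" "0 < x \<Longrightarrow> s1 \<le> x" "x \<le> D1" "s1 = s0 \<or> s1 = x" "D1 = D0 \<or> D1 = x"
      using Cons.prems(2) by (auto simp: scan_step_def split: if_splits)
    have "fold scan_step xs (s1, D1) = (s, D)" using Cons.prems(1) 1 by simp
    from Cons.IH[OF this 2(1)] have IH: "0 < s \<and> s \<le> s1 \<and> D1 \<le> D \<and> (\<forall>x\<in>set xs. 0 < x \<longrightarrow> s \<le> x) \<and> (\<forall>x\<in>set xs. x \<le> D) \<and>
      (s = s1 \<or> s \<in> set xs) \<and> (D = D1 \<or> D \<in> set xs)" .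
    with 2 show ?case by auto
  qed auto
  then show "0 < s" "s \<le> s0" "D0 \<le> D" "\<And>x. x \<in> set xs \<Longrightarrow> 0 < x \<Longrightarrow> s \<le> x" "\<And>x. x \<in> set xs \<Longrightarrow> x \<le> D"
    "s = s0 \<or> s \<in> set xs" "D = D0 \<or> D \<in> set xs" by blast+
qed

lemma extremes:
  assumes "extremes n d = (s, D)"
  shows "0 < s" "s \<le> 1" "1 \<le> D" "\<And>u v. u < n \<Longrightarrow> v < n \<Longrightarrow> 0 < d u v \<Longrightarrow> s \<le> d u v"
    "\<And>u v. u < n \<Longrightarrow> v < n \<Longrightarrow> d u v \<le> D"
    "s = 1 \<or> (\<exists>u<n. \<exists>v<n. s = d u v)" "D = 1 \<or> (\<exists>u<n. \<exists>v<n. D = d u v)"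
proof -
  let ?xs = "concat (map (\<lambda>u. map (d u) [0..<n]) [0..<n])"
  have set: "set ?xs = {d u v | u v. u < n \<and> v < n}" by auto blast
  note * = fold_scan_step[of ?xs 1 1 s D, unfolded extremes_fold[symmetric], OF assms zero_less_one]
  show "0 < s" "s \<le> 1" "1 \<le> D" by (rule *)+
  show "s \<le> d u v" if "u < n" "v < n" "0 < d u v" for u v using *(4)[of "d u v"] that unfolding set by blast
  show "d u v \<le> D" if "u < n" "v < n" for u v using *(5)[of "d u v"] that unfolding set by blast
  show "s = 1 \<or> (\<exists>u<n. \<exists>v<n. s = d u v)" "D = 1 \<or> (\<exists>u<n. \<exists>v<n. D = d u v)"
    using *(6,7) unfolding set by blast+
qed

lemma nn_integral_indicators:
  fixes p :: "'a pmf"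
  assumes "finite (set_pmf p)" "finite J" "0 \<le> a" "\<And>j. j \<in> J \<Longrightarrow> 0 \<le> w j"
  shows "(\<integral>\<^sup>+x. ennreal (a + (\<Sum>j\<in>J. w j * indicator (A j) x)) \<partial>p) =
    ennreal (a + (\<Sum>j\<in>J. w j * measure_pmf.prob p (A j)))"
proof -
  have int: "integrable (measure_pmf p) f" for f :: "'a \<Rightarrow> real"
    by (rule integrable_measure_pmf_finite[OF assms(1)])
  have "(\<integral>\<^sup>+x. ennreal (a + (\<Sum>j\<in>J. w j * indicator (A j) x)) \<partial>p) =
      ennreal (\<integral>x. a + (\<Sum>j\<in>J. w j * indicator (A j) x) \<partial>p)"
    using assms by (intro nn_integral_eq_integral int AE_I2 add_nonneg_nonneg sum_nonneg mult_nonneg_nonneg) auto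
  also have "(\<integral>x. a + (\<Sum>j\<in>J. w j * indicator (A j) x) \<partial>p) = a + (\<Sum>j\<in>J. w j * measure_pmf.prob p (A j))"
    by (simp add: int Bochner_Integration.integral_add Bochner_Integration.integral_sum)
  finally show ?thesis .
qed

text \<open>The 2 pays for the two leaf edges, \<open>2 * lam / (lam - 1)\<close> for the geometric
  series of edges below a separating level, the next factor comes from
  \<open>radius_separates\<close>, and the harmonic number from the ranks.\<close>

definition distortion :: "real \<Rightarrow> nat \<Rightarrow> real" where
  "distortion lam n = 2 + 2 * lam / (lam - 1) * ((lam\<^sup>2 + lam ^ 3) / (lam - 1)) * harm n"

text \<open>
  The base \<open>mu\<close> ensures that both \<open>lam ^ (L - 1)\<close> and the precision \<open>2 ^ (L - 1)\<close> of the random bits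
  are at least the aspect ratio \<open>D / s\<close>.
\<close>

locale frt =
  fixes lam mu :: real and n L :: nat and d :: "nat \<Rightarrow> nat \<Rightarrow> real" and s D :: real
  assumes lam: "lam > 1" and mu_def: "mu = min 2 lam" and n: "1 \<le> n" and metric: "Metric_space {..<n} d"
    and ext: "extremes n d = (s, D)" and L_def: "L = Suc (num_levels mu (D / s))"
begin

interpretation Metric_space "{..<n}" d by (rule metric)

lemma mu: "mu > 1" using lam by (simp add: mu_def)

lemma s: "s > 0" by (rule extremes(1)[OF ext])

lemma s_le: "u < n \<Longrightarrow> v < n \<Longrightarrow> u \<noteq> v \<Longrightarrow> s \<le> d u v"
  using extremes(4)[OF ext, of u v] zero[of u v] nonneg[of u v] by (simp add: less_le)

lemma le_D: "u < n \<Longrightarrow> v < n \<Longrightarrow> d u v \<le> D"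
  by (rule extremes(5)[OF ext])

lemma D_le: "mu \<le> c \<Longrightarrow> D \<le> s * c ^ (L - 1)"
proof -
  assume "mu \<le> c"
  have "D / s \<le> mu ^ (L - 1)" using num_levels(1)[OF mu, of "D / s"] by (simp add: L_def)
  also have "\<dots> \<le> c ^ (L - 1)" using \<open>mu \<le> c\<close> mu by (intro power_mono) auto
  finally show ?thesis using s by (simp add: field_simps)
qed

definition label :: "real \<Rightarrow> nat list \<Rightarrow> nat \<Rightarrow> nat \<Rightarrow> nat" where
  "label b \<pi> j = center d n \<pi> (radius lam s b j)"

abbreviation "T b \<pi> \<equiv> random_tree lam n L s d b \<pi>"

context
  fixes b :: real and \<pi> :: "nat list"
  assumes b: "0 \<le> b" "b < 1" and \<pi>: "\<pi> \<in> permutations_of_set {..<n}"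
begin

lemma radius_pos: "0 < radius lam s b j"
  by (rule radius_bounds(1)[OF lam s b])

lemma label_less: "u < n \<Longrightarrow> label b \<pi> j u < n"
  unfolding label_def by (rule center_less[OF \<pi>, of u]) (use radius_pos[of j] in auto)

lemma random_tree_obtain:
  obtains m par lev where "level_tree lam n L m par lev" "T b \<pi> = level_tree.tree lam n m par lev"
    "\<forall>u<n. \<forall>v<n. \<forall>j. 1 \<le> j \<longrightarrow> j \<le> L \<longrightarrow>
      (par ^^ j) u = (par ^^ j) v \<longleftrightarrow> (\<forall>i. j \<le> i \<longrightarrow> i < L \<longrightarrow> label b \<pi> i u = label b \<pi> i v)"
    "m \<le> n + n * L"
proof -
  obtain m par cen lev where B: "build_trie n L (label b \<pi>) = (m, par, cen, lev)"
    by (cases "build_trie n L (label b \<pi>)")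
  have L1: "1 \<le> L" by (simp add: L_def)
  note lt = build_trie_level_tree[where c = "label b \<pi>", OF lam n label_less L1 B]
  show ?thesis
  proof (rule that)
    show "level_tree lam n L m par lev" by (rule lt(1))
    show "T b \<pi> = level_tree.tree lam n m par lev"
      using B by (simp add: random_tree_def trie_tree_def label_def[abs_def])
    show "m \<le> n + n * L" using build_trie_size[OF L1 n, of "label b \<pi>"] by (simp add: B)
  qed (use lt(2) in blast)
qed

lemma hst_random_tree: "is_hst lam L (T b \<pi>)" "leaves (T b \<pi>) = {..<n}"
proof -
  obtain m par lev where lt: "level_tree lam n L m par lev" "T b \<pi> = level_tree.tree lam n m par lev"
    using random_tree_obtain by metis
  show "is_hst lam L (T b \<pi>)" "leaves (T b \<pi>) = {..<n}"
    unfolding lt(2) using level_tree.is_hst_tree[OF lt(1)] level_tree.leaves_tree[OF lt(1)] by auto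
qed

text \<open>Both bounds are read off the highest level \<open>J\<close> at which the labels differ:
  distinct points first meet at level \<open>J + 1\<close>. Below, a common center there compares
  \<open>d\<close> with \<open>lam ^ J\<close>; above, the single term at \<open>J\<close> is
  relaxed to a sum over all separating levels, whose expectation is accessible level by
  level.\<close>

lemma tree_dist_random_tree:
  assumes "u < n" "v < n"
  shows "0 \<le> tree_dist (T b \<pi>) u v" "tree_dist (T b \<pi>) u u = 0" "d u v \<le> s * tree_dist (T b \<pi>) u v"
    "tree_dist (T b \<pi>) u v \<le> 2 + (\<Sum>j=1..<L. 2 * lam / (lam - 1) * lam ^ j * of_bool (label b \<pi> j u \<noteq> label b \<pi> j v))"
proof -
  obtain m par lev where lt: "level_tree lam n L m par lev" and T: "T b \<pi> = level_tree.tree lam n m par lev"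
    and par': "\<forall>u<n. \<forall>v<n. \<forall>j. 1 \<le> j \<longrightarrow> j \<le> L \<longrightarrow>
      (par ^^ j) u = (par ^^ j) v \<longleftrightarrow> (\<forall>i. j \<le> i \<longrightarrow> i < L \<longrightarrow> label b \<pi> i u = label b \<pi> i v)"
    by (rule random_tree_obtain)
  note par = par'[rule_format]
  interpret level_tree lam n L m par lev by (rule lt)
  show "0 \<le> tree_dist (T b \<pi>) u v" "tree_dist (T b \<pi>) u u = 0"
    unfolding T using tree_dist_nonneg tree_dist_refl assms by auto
  \<comment> \<open>Level 0 is always included: it carries no labels, but distinct leaves are
    separated there.\<close>
  define S where "S = insert 0 {j. 1 \<le> j \<and> j < L \<and> label b \<pi> j u \<noteq> label b \<pi> j v}"
  define J where "J = Max S"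
  have fin: "finite S" by (simp add: S_def)
  have J: "J \<in> S" unfolding J_def using fin by (intro Max_in) (auto simp: S_def)
  have J_max: "j \<le> J" if "j \<in> S" for j unfolding J_def using fin that by auto
  have JL: "Suc J \<le> L" using J L by (auto simp: S_def)
  have eq: "label b \<pi> i u = label b \<pi> i v" if "J < i" "i < L" for i
    using J_max[of i] that by (auto simp: S_def)
  have upper: "(par ^^ Suc J) u = (par ^^ Suc J) v"
    using par[OF assms, of "Suc J"] JL eq by auto
  have height: "height (Suc j) \<le> lam / (lam - 1) * lam ^ j" for j
  proof -
    have "(lam - 1) * height (Suc j) \<le> lam ^ Suc j"
      unfolding height_def using power_diff_1_eq[of lam "Suc j"] by (simp add: lessThan_Suc_atMost)
    then show ?thesis using lam by (simp add: field_simps)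
  qed
  have height_ge: "lam ^ j \<le> height (Suc j)" for j
    unfolding height_def using lam by (simp add: sum_nonneg)
  show "tree_dist (T b \<pi>) u v \<le> 2 + (\<Sum>j=1..<L. 2 * lam / (lam - 1) * lam ^ j * of_bool (label b \<pi> j u \<noteq> label b \<pi> j v))"
    (is "_ \<le> 2 + ?sum")
  proof -
    have nonneg: "0 \<le> 2 * lam / (lam - 1) * lam ^ j * of_bool P" for j P using lam by simp
    have "tree_dist (T b \<pi>) u v \<le> 2 * height (Suc J)" unfolding T by (rule tree_dist_le[OF assms upper])
    also have "\<dots> \<le> 2 + ?sum"
    proof (cases "J = 0")
      case True
      have "0 \<le> ?sum" by (intro sum_nonneg nonneg)
      with True show ?thesis by (simp add: height_def)
    next
      case False
      have "2 * height (Suc J) \<le> 2 * lam / (lam - 1) * lam ^ J" using height[of J] by simp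
      also have "\<dots> = 2 * lam / (lam - 1) * lam ^ J * of_bool (label b \<pi> J u \<noteq> label b \<pi> J v)"
        using False J by (auto simp: S_def)
      also have "\<dots> \<le> ?sum"
        using False J nonneg by (intro member_le_sum) (auto simp: S_def)
      finally show ?thesis by simp
    qed
    finally show ?thesis .
  qed
  show "d u v \<le> s * tree_dist (T b \<pi>) u v"
  proof (cases "u = v")
    case True
    then show ?thesis using assms tree_dist_refl by (simp add: T)
  next
    case False
    have "(par ^^ J) u \<noteq> (par ^^ J) v"
    proof (cases "J = 0")
      case True
      with False show ?thesis by simp
    next
      case J0: False
      then have "label b \<pi> J u \<noteq> label b \<pi> J v" "J < L" using J by (auto simp: S_def)
      then show ?thesis using par[OF assms, of J] J0 by auto
    qed
    then have "2 * height (Suc J) \<le> tree_dist (T b \<pi>) u v"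
      unfolding T by (rule tree_dist_ge[OF assms JL])
    moreover have "lam ^ J \<le> height (Suc J)" by (rule height_ge)
    ultimately have ge: "2 * (s * lam ^ J) \<le> s * tree_dist (T b \<pi>) u v" using s by simp
    have "d u v \<le> 2 * (s * lam ^ J)"
    \<comment> \<open>At the root there are no labels to compare; there the diameter bound takes the
      place of a common center.\<close>
    proof (cases "Suc J = L")
      case True
      have "d u v \<le> D" using le_D assms by simp
      also have "D \<le> s * lam ^ J" using D_le[of lam] True mu_def by (auto simp: L_def)
      also have "\<dots> \<le> 2 * (s * lam ^ J)" using s lam by simp
      finally show ?thesis .
    next
      case False
      then have "label b \<pi> (Suc J) u = label b \<pi> (Suc J) v" using eq[of "Suc J"] JL by simp
      moreover obtain w where w: "w < n" "d u w \<le> radius lam s b (Suc J)" "label b \<pi> (Suc J) u = \<pi> ! w"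
        unfolding label_def
        by (rule center_in[of u n d u "radius lam s b (Suc J)" \<pi>]) (use assms radius_pos[of "Suc J"] in auto)
      moreover obtain w' where w': "w' < n" "d v w' \<le> radius lam s b (Suc J)" "label b \<pi> (Suc J) v = \<pi> ! w'"
        unfolding label_def
        by (rule center_in[of v n d v "radius lam s b (Suc J)" \<pi>]) (use assms radius_pos[of "Suc J"] in auto)
      moreover have "length \<pi> = n" "distinct \<pi>"
        using \<pi> by (auto simp: permutations_of_set_def distinct_card[symmetric])
      ultimately have "w' = w" by (simp add: nth_eq_iff_index_eq)
      with w' have "d u v \<le> radius lam s b (Suc J) + radius lam s b (Suc J)"
        using triangle[of u w v] w assms commute[of w v] by simp
      with radius_bounds(2)[OF lam s b, of J] show ?thesis by simp
    qed
    with ge show ?thesis by simp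
  qed
qed

end

text \<open>The priorities are averaged first, for fixed \<open>b\<close>, leaving indicators of
  radii with weights free of \<open>b\<close>. After averaging over \<open>b\<close>, the sums are
  exchanged: for each center the scales telescope, and the reciprocal ranks are left
  outside.\<close>

lemma expected_tree_dist:
  assumes "u < n" "v < n"
  shows "(\<integral>\<^sup>+b. \<integral>\<^sup>+\<pi>. ennreal (s * tree_dist (T b \<pi>) u v) \<partial>random_perm n \<partial>random_bits (L - 1))
    \<le> ennreal (distortion lam n * d u v)"
proof (cases "u = v")
  case True
  have "(\<integral>\<^sup>+b. \<integral>\<^sup>+\<pi>. ennreal (s * tree_dist (T b \<pi>) u v) \<partial>random_perm n \<partial>random_bits (L - 1)) =
      (\<integral>\<^sup>+b. \<integral>\<^sup>+\<pi>. 0 \<partial>random_perm n \<partial>random_bits (L - 1))"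
  proof (rule nn_integral_cong_AE, rule AE_pmfI)
    fix b assume b: "b \<in> set_pmf (random_bits (L - 1))"
    show "(\<integral>\<^sup>+\<pi>. ennreal (s * tree_dist (T b \<pi>) u v) \<partial>random_perm n) =
        (\<integral>\<^sup>+\<pi>. 0 \<partial>random_perm n)"
    proof (rule nn_integral_cong_AE, rule AE_pmfI)
      fix \<pi> assume "\<pi> \<in> set_pmf (random_perm n)"
      then show "ennreal (s * tree_dist (T b \<pi>) u v) = 0"
        using tree_dist_random_tree(2)[of b \<pi> u u] set_random_bits[OF b] assms True by simp
    qed
  qed
  then show ?thesis by simp
next
  case False
  let ?P = "random_perm n" and ?Q = "random_bits (L - 1)"
  define \<delta> where "\<delta> = d u v"
  define c where "c = 2 * lam / (lam - 1)"
  define m where "m w = min (d u w) (d v w)" for w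
  define M where "M w = max (d u w) (d v w)" for w
  define rk where "rk w = 1 / real (card {w'\<in>{..<n}. m w' \<le> m w})" for w
  define Cut where "Cut b j = {\<pi>. label b \<pi> j u \<noteq> label b \<pi> j v}" for b j
  define Sep where "Sep j w = {b. m w \<le> radius lam s b j \<and> radius lam s b j < M w}" for j w
  have c: "0 \<le> c" using lam by (simp add: c_def)
  have rk: "0 \<le> rk w" for w by (simp add: rk_def)
  have wt: "0 \<le> c * (s * lam ^ j)" for j using c s lam by simp
  \<comment> \<open>For distinct points \<open>s \<le> \<delta>\<close> absorbs both additive terms,
    the two leaf edges and the rounding of \<open>b\<close>.\<close>
  have \<delta>: "s \<le> \<delta>" unfolding \<delta>_def using s_le[OF assms False] .
  have inner: "(\<integral>\<^sup>+\<pi>. ennreal (s * tree_dist (T b \<pi>) u v) \<partial>?P) \<le>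
      ennreal (2 * s + (\<Sum>jw\<in>{1..<L}\<times>{..<n}. (c * (s * lam ^ fst jw) * rk (snd jw)) * indicator (Sep (fst jw) (snd jw)) b))"
    if b: "b \<in> set_pmf ?Q" for b
  proof -
    have b01: "0 \<le> b" "b < 1" using set_random_bits[OF b] by auto
    have "(\<integral>\<^sup>+\<pi>. ennreal (s * tree_dist (T b \<pi>) u v) \<partial>?P) \<le>
        (\<integral>\<^sup>+\<pi>. ennreal (2 * s + (\<Sum>j\<in>{1..<L}. (c * (s * lam ^ j)) * indicator (Cut b j) \<pi>)) \<partial>?P)"
    proof (intro nn_integral_mono_AE AE_pmfI ennreal_leI)
      fix \<pi> assume "\<pi> \<in> set_pmf ?P"
      then have "tree_dist (T b \<pi>) u v \<le> 2 + (\<Sum>j=1..<L. 2 * lam / (lam - 1) * lam ^ j * of_bool (label b \<pi> j u \<noteq> label b \<pi> j v))"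
        using tree_dist_random_tree(4)[of b \<pi> u v] b01 assms by simp
      then have "s * tree_dist (T b \<pi>) u v \<le> s * (2 + (\<Sum>j=1..<L. c * lam ^ j * of_bool (label b \<pi> j u \<noteq> label b \<pi> j v)))"
        using s unfolding c_def by (intro mult_left_mono) auto
      also have "\<dots> = 2 * s + (\<Sum>j\<in>{1..<L}. (c * (s * lam ^ j)) * indicator (Cut b j) \<pi>)"
        unfolding distrib_left sum_distrib_left Cut_def indicator_def
        by (intro arg_cong2[where f = "(+)"] sum.cong) auto
      finally show "s * tree_dist (T b \<pi>) u v \<le> 2 * s + (\<Sum>j\<in>{1..<L}. (c * (s * lam ^ j)) * indicator (Cut b j) \<pi>)" .
    qed
    also have "\<dots> = ennreal (2 * s + (\<Sum>j\<in>{1..<L}. (c * (s * lam ^ j)) * measure ?P (Cut b j)))"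
      using s wt by (intro nn_integral_indicators) auto
    also have "\<dots> \<le> ennreal (2 * s + (\<Sum>j\<in>{1..<L}. (c * (s * lam ^ j)) * (\<Sum>w<n. of_bool (m w \<le> radius lam s b j \<and> radius lam s b j < M w) * rk w)))"
    proof (intro ennreal_leI add_left_mono sum_mono mult_left_mono wt)
      fix j
      have "d u u \<le> radius lam s b j" using radius_bounds(1)[OF lam s b01, of j] assms by simp
      from cut_probability[where d = d and u = u and v = v, OF assms(1) this]
      show "measure ?P (Cut b j) \<le> (\<Sum>w<n. of_bool (m w \<le> radius lam s b j \<and> radius lam s b j < M w) * rk w)"
        unfolding Cut_def label_def m_def M_def rk_def .
    qed
    also have "(\<Sum>j\<in>{1..<L}. (c * (s * lam ^ j)) * (\<Sum>w<n. of_bool (m w \<le> radius lam s b j \<and> radius lam s b j < M w) * rk w)) =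
        (\<Sum>jw\<in>{1..<L}\<times>{..<n}. (c * (s * lam ^ fst jw) * rk (snd jw)) * indicator (Sep (fst jw) (snd jw)) b)"
      unfolding sum_distrib_left sum.cartesian_product Sep_def indicator_def
      by (intro sum.cong) auto
    finally show ?thesis .
  qed
  have "(\<integral>\<^sup>+b. \<integral>\<^sup>+\<pi>. ennreal (s * tree_dist (T b \<pi>) u v) \<partial>?P \<partial>?Q) \<le>
      (\<integral>\<^sup>+b. ennreal (2 * s + (\<Sum>jw\<in>{1..<L}\<times>{..<n}. (c * (s * lam ^ fst jw) * rk (snd jw)) * indicator (Sep (fst jw) (snd jw)) b)) \<partial>?Q)"
    by (intro nn_integral_mono_AE AE_pmfI inner)
  also have "\<dots> = ennreal (2 * s + (\<Sum>jw\<in>{1..<L}\<times>{..<n}. (c * (s * lam ^ fst jw) * rk (snd jw)) * measure ?Q (Sep (fst jw) (snd jw))))"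
    using s c lam rk by (intro nn_integral_indicators finite_random_bits mult_nonneg_nonneg) auto
  also have "\<dots> \<le> ennreal (distortion lam n * d u v)"
  proof (rule ennreal_leI)
    have sep: "(\<Sum>j=1..<L. s * lam ^ j * measure ?Q (Sep j w)) \<le> (lam\<^sup>2 + lam ^ 3) / (lam - 1) * \<delta>" if "w < n" for w
      unfolding Sep_def
    proof (rule radius_separates[OF lam s])
      show "0 \<le> m w" "m w \<le> M w" by (auto simp: m_def M_def)
      show "M w - m w \<le> \<delta>"
        using triangle[of u v w] triangle[of v u w] that assms commute[of u v] by (auto simp: m_def M_def \<delta>_def)
      show "s \<le> \<delta>" by (rule \<delta>)
      have "M w \<le> D" using le_D assms that by (simp add: M_def)
      also have "D \<le> s * 2 ^ (L - 1)" by (rule D_le) (simp add: mu_def)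
      finally show "M w \<le> s * 2 ^ (L - 1)" .
    qed
    have "(\<Sum>jw\<in>{1..<L}\<times>{..<n}. (c * (s * lam ^ fst jw) * rk (snd jw)) * measure ?Q (Sep (fst jw) (snd jw))) =
        (\<Sum>j\<in>{1..<L}. \<Sum>w<n. (c * (s * lam ^ j) * rk w) * measure ?Q (Sep j w))"
      unfolding sum.cartesian_product by (intro sum.cong) auto
    also have "\<dots> = (\<Sum>w<n. \<Sum>j\<in>{1..<L}. (c * (s * lam ^ j) * rk w) * measure ?Q (Sep j w))"
      by (rule sum.swap)
    also have "\<dots> = c * (\<Sum>w<n. rk w * (\<Sum>j=1..<L. s * lam ^ j * measure ?Q (Sep j w)))"
      by (simp add: sum_distrib_left mult_ac)
    also have "\<dots> \<le> c * (\<Sum>w<n. rk w * ((lam\<^sup>2 + lam ^ 3) / (lam - 1) * \<delta>))"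
      using c rk sep by (intro mult_left_mono sum_mono) auto
    also have "\<dots> = c * ((lam\<^sup>2 + lam ^ 3) / (lam - 1) * \<delta>) * (\<Sum>w<n. rk w)"
      unfolding sum_distrib_right[symmetric] by (simp only: mult_ac)
    also have "\<dots> \<le> c * ((lam\<^sup>2 + lam ^ 3) / (lam - 1) * \<delta>) * harm n"
    proof (intro mult_left_mono)
      show "(\<Sum>w<n. rk w) \<le> harm n"
        unfolding rk_def using sum_inverse_rank_le_harm[of "{..<n}" m] by simp
    qed (use c \<delta> s lam in auto)
    finally show "2 * s + (\<Sum>jw\<in>{1..<L}\<times>{..<n}. (c * (s * lam ^ fst jw) * rk (snd jw)) * measure ?Q (Sep (fst jw) (snd jw)))
        \<le> distortion lam n * d u v"
      using \<delta> unfolding distortion_def c_def[symmetric] \<delta>_def[symmetric] by (simp add: algebra_simps)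
  qed
  finally show ?thesis .
qed

end

section \<open>Costs\<close>

text \<open>A vanishing denominator is harmless: a finite bound on \<open>X / 0\<close> forces
  \<open>X = 0\<close>.\<close>

lemma ratio_leD:
  fixes X Y a :: ennreal
  assumes "X / Y \<le> a" "Y \<noteq> \<top>" "a \<noteq> \<top>"
  shows "X \<le> a * Y"
proof (cases "Y = 0")
  case True
  with assms show ?thesis by (auto split: if_splits simp: top_unique)
next
  case False
  have "X = X / Y * Y"
    using False assms(2) by (simp add: ennreal_divide_times less_top)
  also have "\<dots> \<le> a * Y" using assms(1) by (intro mult_right_mono) auto
  finally show ?thesis .
qed

lemma ratio_leI:
  fixes X Y a :: ennreal
  assumes "X \<le> a * Y" "Y \<noteq> \<top>"
  shows "X / Y \<le> a"
proof (cases "Y = 0")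
  case True
  with assms show ?thesis by simp
next
  case False
  have "X / Y \<le> a * Y / Y" using assms(1) by (rule divide_right_mono_ennreal)
  also have "\<dots> = a" using False assms(2) by (intro mult_divide_eq_ennreal) auto
  finally show ?thesis .
qed

lemma dist_set_attained:
  assumes "finite S" "S \<noteq> {}"
  obtains x where "x \<in> S" "dist_set d v S = ennreal (d v x)"
proof -
  have "Min ((\<lambda>x. ennreal (d v x)) ` S) \<in> (\<lambda>x. ennreal (d v x)) ` S" using assms by (intro Min_in) auto
  then show ?thesis using that assms by (auto simp: dist_set_def Min_Inf)
qed

lemma dist_set_le: "x \<in> S \<Longrightarrow> dist_set d v S \<le> ennreal (d v x)"
  unfolding dist_set_def by (rule INF_lower)

lemma ufl_opt_attained:
  obtains S where "S \<subseteq> {..<n}" "ufl_opt n d f N = ufl_cost n d f N S"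
proof -
  have "Min (ufl_cost n d f N ` Pow {..<n}) \<in> ufl_cost n d f N ` Pow {..<n}" by (intro Min_in) auto
  moreover have "Min (ufl_cost n d f N ` Pow {..<n}) = ufl_opt n d f N"
    unfolding ufl_opt_def by (rule Min_Inf) auto
  ultimately show ?thesis using that by auto
qed

lemma ufl_opt_le: "S \<subseteq> {..<n} \<Longrightarrow> ufl_opt n d f N \<le> ufl_cost n d f N S"
  unfolding ufl_opt_def by (rule INF_lower) simp

lemma ufl_opt_finite: "ufl_opt n d f N \<noteq> \<top>"
proof -
  have "dist_set d v {..<n} < \<top>" if "v < n" for v
    using dist_set_le[of v "{..<n}" d v] that by (simp add: le_less_trans[OF _ ennreal_less_top])
  then have "ufl_cost n d f N {..<n} < \<top>"
    unfolding ufl_cost_def by (auto simp: ennreal_mult_less_top of_nat_less_top)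
  then show ?thesis using ufl_opt_le[of "{..<n}" n d f N] by auto
qed

definition random_hst :: "real \<Rightarrow> nat \<Rightarrow> nat \<Rightarrow> real \<Rightarrow> (nat \<Rightarrow> nat \<Rightarrow> real) \<Rightarrow> wtree pmf" where
  "random_hst lam n L s d = bind_pmf (random_bits (L - 1))
     (\<lambda>b. map_pmf (random_tree lam n L s d b) (random_perm n))"

context frt
begin

lemma set_random_hst:
  assumes "t \<in> set_pmf (random_hst lam n L s d)"
  obtains b \<pi> where "t = T b \<pi>" "0 \<le> b" "b < 1" "\<pi> \<in> permutations_of_set {..<n}" "b \<in> set_pmf (random_bits (L - 1))"
  using assms set_random_bits unfolding random_hst_def by auto

lemma random_hst:
  assumes t: "t \<in> set_pmf (random_hst lam n L s d)"
  shows "is_hst lam L t" "leaves t = {..<n}"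
    "\<And>u v. u < n \<Longrightarrow> v < n \<Longrightarrow> 0 \<le> tree_dist t u v \<and> d u v \<le> s * tree_dist t u v"
proof -
  obtain b \<pi> where b: "t = T b \<pi>" "0 \<le> b" "b < 1" "\<pi> \<in> permutations_of_set {..<n}"
    by (rule set_random_hst[OF t])
  show "is_hst lam L t" "leaves t = {..<n}" unfolding b(1) by (rule hst_random_tree[OF b(2-4)])+
  show "0 \<le> tree_dist t u v \<and> d u v \<le> s * tree_dist t u v" if "u < n" "v < n" for u v
    using tree_dist_random_tree(1,3)[OF b(2-4) that] by (simp add: b(1))
qed

lemma expected_random_hst:
  assumes "u < n" "v < n"
  shows "(\<integral>\<^sup>+t. ennreal (s * tree_dist t u v) \<partial>random_hst lam n L s d) \<le> ennreal (distortion lam n * d u v)"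
  using expected_tree_dist[OF assms] by (simp add: random_hst_def)

lemma distortion_ge_1: "1 \<le> distortion lam n"
proof -
  have "0 \<le> 2 * lam / (lam - 1) * ((lam\<^sup>2 + lam ^ 3) / (lam - 1)) * harm n"
    using lam by (intro mult_nonneg_nonneg divide_nonneg_nonneg harm_nonneg) auto
  then show ?thesis by (simp add: distortion_def)
qed

lemma dist_set_random_hst:
  assumes t: "t \<in> set_pmf (random_hst lam n L s d)" and "v < n" "S \<subseteq> {..<n}"
  shows "dist_set d v S \<le> ennreal s * dist_set (tree_dist t) v S"
proof (cases "S = {}")
  case True
  then show ?thesis using s by (simp add: dist_set_def ennreal_mult_top)
next
  case False
  have "finite S" using assms finite_subset by blast
  then obtain x where x: "x \<in> S" "dist_set (tree_dist t) v S = ennreal (tree_dist t v x)"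
    using dist_set_attained[of S "tree_dist t" v] False by blast
  have "x < n" using x assms by auto
  have "dist_set d v S \<le> ennreal (d v x)" by (rule dist_set_le[OF x(1)])
  also have "\<dots> \<le> ennreal (s * tree_dist t v x)"
    using random_hst(3)[OF t assms(2) \<open>x < n\<close>] by (intro ennreal_leI) auto
  also have "\<dots> = ennreal s * dist_set (tree_dist t) v S"
    using s by (simp add: x(2) ennreal_mult')
  finally show ?thesis .
qed

lemma scaled_facility_cost: "ennreal s * (of_nat k * ennreal (f / s)) = of_nat k * ennreal f"
proof -
  have "ennreal s * ennreal (f / s) = ennreal f" using s by (simp add: ennreal_mult'[symmetric])
  then show ?thesis by (metis mult.left_commute)
qed

lemma ufl_cost_random_hst:
  assumes t: "t \<in> set_pmf (random_hst lam n L s d)" and "S \<subseteq> {..<n}"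
  shows "ufl_cost n d f N S \<le> ennreal s * ufl_cost n (tree_dist t) (f / s) N S"
proof -
  have "of_nat (N v) * dist_set d v S \<le> ennreal s * (of_nat (N v) * dist_set (tree_dist t) v S)" if "v < n" for v
    using mult_left_mono[OF dist_set_random_hst[OF t that assms(2)], of "of_nat (N v)"] by (simp add: mult.left_commute)
  then show ?thesis
    unfolding ufl_cost_def distrib_left scaled_facility_cost sum_distrib_left
    by (intro add_left_mono sum_mono) auto
qed

text \<open>The minimum over \<open>S\<close> is bounded by the facility that is nearest in
  \<open>d\<close>. It is chosen before the tree is drawn, so the bound for a single pair
  applies.\<close>

lemma expected_dist_set:
  assumes "v < n" "S \<subseteq> {..<n}"
  shows "(\<integral>\<^sup>+t. ennreal s * dist_set (tree_dist t) v S \<partial>random_hst lam n L s d) \<le> ennreal (distortion lam n) * dist_set d v S"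
proof (cases "S = {}")
  case True
  have "ennreal (distortion lam n) * dist_set d v S = \<top>"
    using distortion_ge_1 True by (simp add: dist_set_def ennreal_mult_top)
  then show ?thesis by simp
next
  case False
  have "finite S" using assms finite_subset by blast
  then obtain x where x: "x \<in> S" "dist_set d v S = ennreal (d v x)"
    using dist_set_attained[of S d v] False by blast
  have "(\<integral>\<^sup>+t. ennreal s * dist_set (tree_dist t) v S \<partial>random_hst lam n L s d) \<le>
      (\<integral>\<^sup>+t. ennreal (s * tree_dist t v x) \<partial>random_hst lam n L s d)"
    using s by (intro nn_integral_mono) (auto simp: ennreal_mult' intro: mult_left_mono dist_set_le[OF x(1)])
  also have "\<dots> \<le> ennreal (distortion lam n * d v x)" using assms x by (intro expected_random_hst) auto
  also have "\<dots> = ennreal (distortion lam n) * dist_set d v S"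
    using distortion_ge_1 by (simp add: x(2) ennreal_mult')
  finally show ?thesis .
qed

lemma expected_ufl_cost:
  assumes "S \<subseteq> {..<n}"
  shows "(\<integral>\<^sup>+t. ennreal s * ufl_cost n (tree_dist t) (f / s) N S \<partial>random_hst lam n L s d) \<le>
    ennreal (distortion lam n) * ufl_cost n d f N S"
proof -
  let ?H = "random_hst lam n L s d"
  have "(\<integral>\<^sup>+t. ennreal s * ufl_cost n (tree_dist t) (f / s) N S \<partial>?H) =
      (\<integral>\<^sup>+t. of_nat (card S) * ennreal f + (\<Sum>v<n. of_nat (N v) * (ennreal s * dist_set (tree_dist t) v S)) \<partial>?H)"
    unfolding ufl_cost_def distrib_left scaled_facility_cost sum_distrib_left
    by (simp add: mult.left_commute)
  also have "\<dots> = of_nat (card S) * ennreal f + (\<Sum>v<n. of_nat (N v) * (\<integral>\<^sup>+t. ennreal s * dist_set (tree_dist t) v S \<partial>?H))"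
    by (subst nn_integral_add) (auto simp: nn_integral_sum nn_integral_cmult)
  also have "\<dots> \<le> ennreal (distortion lam n) * (of_nat (card S) * ennreal f) +
      (\<Sum>v<n. of_nat (N v) * (ennreal (distortion lam n) * dist_set d v S))"
  proof (intro add_mono sum_mono mult_left_mono)
    have "1 * (of_nat (card S) * ennreal f) \<le> ennreal (distortion lam n) * (of_nat (card S) * ennreal f)"
      using distortion_ge_1 by (intro mult_right_mono) (simp_all add: ennreal_1[symmetric] ennreal_leI del: ennreal_1)
    then show "of_nat (card S) * ennreal f \<le> ennreal (distortion lam n) * (of_nat (card S) * ennreal f)" by simp
  qed (use assms expected_dist_set in auto)
  also have "\<dots> = ennreal (distortion lam n) * ufl_cost n d f N S"
    unfolding ufl_cost_def distrib_left sum_distrib_left by (simp add: mult.left_commute)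
  finally show ?thesis .
qed

end

section \<open>Sizes\<close>

lemma val_size_enc_list: "val_size (enc_list e xs) = (\<Sum>x\<leftarrow>xs. val_size (e x) + 1) + 1"
  by (induction xs) auto

lemma val_size_enc_list_ge: "x \<in> set xs \<Longrightarrow> val_size (e x) \<le> val_size (enc_list e xs)"
  unfolding val_size_enc_list by (induction xs) auto

lemma length_le_val_size: "length xs \<le> val_size (enc_list e xs)"
  unfolding val_size_enc_list by (induction xs) auto

lemma val_size_enc_list_le:
  assumes "\<And>x. x \<in> set xs \<Longrightarrow> val_size (e x) \<le> B"
  shows "val_size (enc_list e xs) \<le> length xs * (B + 1) + 1"
proof -
  have "(\<Sum>x\<leftarrow>xs. val_size (e x) + 1) \<le> length xs * (B + 1)"
    using assms
  proof (induction xs)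
    case (Cons a xs)
    from Cons.IH Cons.prems have "(\<Sum>x\<leftarrow>xs. val_size (e x) + 1) \<le> length xs * (B + 1)" by simp
    moreover have "val_size (e a) \<le> B" using Cons.prems by simp
    ultimately show ?case by simp
  qed simp
  then show ?thesis by (simp add: val_size_enc_list)
qed

lemma val_size_enc_nat: "val_size (enc_nat k) \<le> Suc k"
proof (cases "k = 0")
  case False
  have "real k \<le> 2 ^ k" using less_exp[of k] by (metis less_imp_le of_nat_le_iff of_nat_numeral of_nat_power)
  then have "log 2 (real k) \<le> real k" using False by (simp add: log_le_iff powr_realpow)
  moreover have "0 \<le> log 2 (real k)" using False by simp
  ultimately show ?thesis by (simp add: enc_nat_def nat_le_iff ceiling_le_iff)
qed (simp add: enc_nat_def log_def)

lemma abs_log_le_val_size: "\<bar>log 2 \<bar>r\<bar>\<bar> \<le> real (val_size (VNum r)) - 1"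
  using real_nat_ceiling_ge[of "\<bar>log 2 \<bar>r\<bar>\<bar>"] by simp

lemma val_size_VNum_le: "\<bar>log 2 \<bar>r\<bar>\<bar> \<le> real B \<Longrightarrow> val_size (VNum r) \<le> Suc B"
  by (simp add: nat_le_iff ceiling_le_iff)

context frt
begin

lemma size_metric: "n \<le> val_size (enc_metric n d)" "u < n \<Longrightarrow> v < n \<Longrightarrow> val_size (VNum (d u v)) \<le> val_size (enc_metric n d)"
proof -
  show "n \<le> val_size (enc_metric n d)"
    using length_le_val_size[of "[0..<n]"] by (simp add: enc_metric_def)
  assume "u < n" "v < n"
  then have "val_size (VNum (d u v)) \<le> val_size (enc_list (\<lambda>v. VNum (d u v)) [0..<n])"
    using val_size_enc_list_ge[of v "[0..<n]" "\<lambda>v. VNum (d u v)"] by simp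
  also have "\<dots> \<le> val_size (enc_metric n d)"
    using val_size_enc_list_ge[of u "[0..<n]" "\<lambda>u. enc_list (\<lambda>v. VNum (d u v)) [0..<n]"] \<open>u < n\<close>
    by (simp add: enc_metric_def)
  finally show "val_size (VNum (d u v)) \<le> val_size (enc_metric n d)" .
qed

text \<open>Each extreme is 1 or an entry of the matrix, and the input size charges every entry for
  its order of magnitude.\<close>

lemma log_extremes:
  "\<bar>log 2 s\<bar> \<le> real (val_size (enc_metric n d))" "\<bar>log 2 D\<bar> \<le> real (val_size (enc_metric n d))"
proof -
  have *: "\<bar>log 2 x\<bar> \<le> real (val_size (enc_metric n d))" if pos: "0 < x" and x: "x = 1 \<or> (\<exists>u<n. \<exists>v<n. x = d u v)" for x
  proof (cases "x = 1")
    case False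
    then obtain u v where "u < n" "v < n" "x = d u v" using x by blast
    then have "val_size (VNum x) \<le> val_size (enc_metric n d)" using size_metric(2) by simp
    then show ?thesis using abs_log_le_val_size[of x] pos by (simp del: val_size.simps)
  qed simp
  show "\<bar>log 2 s\<bar> \<le> real (val_size (enc_metric n d))" by (rule *[OF s extremes(6)[OF ext]])
  show "\<bar>log 2 D\<bar> \<le> real (val_size (enc_metric n d))"
    by (rule *[OF _ extremes(7)[OF ext]]) (use extremes(3)[OF ext] in simp)
qed

text \<open>The depth is logarithmic in the aspect ratio and hence linear in the input size. The
  factor depends on \<open>mu\<close> alone; \<open>mu > 1\<close> keeps it finite.\<close>

lemma L_le:
  assumes "val_size (enc_metric n d) \<le> X"
  shows "L \<le> (2 + nat \<lceil>2 / log 2 mu\<rceil>) * X"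
proof -
  have X: "1 \<le> X" using size_metric(1) n assms by linarith
  have lm: "0 < log 2 mu" using mu by simp
  have "real L \<le> 2 + 2 * real X / log 2 mu"
  proof (cases "num_levels mu (D / s)")
    case 0
    then show ?thesis using lm by (simp add: L_def)
  next
    case (Suc k)
    then have "mu ^ k < D / s" using num_levels(2)[OF mu, of k "D / s"] by simp
    then have "log 2 (mu ^ k) < log 2 (D / s)" using mu s extremes(3)[OF ext] by (subst log_less_cancel_iff) auto
    then have "real k * log 2 mu < log 2 D - log 2 s"
      using mu s extremes(3)[OF ext] by (simp add: log_nat_power log_divide)
    also have "\<dots> \<le> 2 * real X" using log_extremes assms by linarith
    finally have "real k \<le> 2 * real X / log 2 mu" using lm by (simp add: field_simps)
    then show ?thesis by (simp add: L_def Suc)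
  qed
  also have "\<dots> \<le> 2 * real X + real (nat \<lceil>2 / log 2 mu\<rceil>) * real X"
  proof -
    have "2 / log 2 mu * real X \<le> real (nat \<lceil>2 / log 2 mu\<rceil>) * real X"
      by (intro mult_right_mono real_nat_ceiling_ge) auto
    then show ?thesis using X by simp
  qed
  finally have "real L \<le> real ((2 + nat \<lceil>2 / log 2 mu\<rceil>) * X)" by (simp add: algebra_simps)
  then show ?thesis by (simp only: of_nat_le_iff)
qed

text \<open>At most \<open>2 * Z ^ 2\<close> vertices, with entries of size \<open>O(Z ^ 2)\<close>:
  vertex numbers are crudely charged their value, weights the logarithm of \<open>lam\<close> times
  their level. The given program runs on such trees, so its time stays polynomial in the original
  input.\<close>

lemma size_random_hst:
  assumes t: "t \<in> set_pmf (random_hst lam n L s d)" and Z: "n \<le> Z" "L \<le> Z"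
  shows "val_size (enc_wtree t) \<le> (18 + 2 * nat \<lceil>log 2 lam\<rceil>) * Z ^ 4"
proof -
  define \<Lambda> where "\<Lambda> = nat \<lceil>log 2 lam\<rceil>"
  obtain b \<pi> where b: "t = T b \<pi>" "0 \<le> b" "b < 1" "\<pi> \<in> permutations_of_set {..<n}"
    by (rule set_random_hst[OF t])
  obtain m par lev where lt: "level_tree lam n L m par lev" and T: "T b \<pi> = level_tree.tree lam n m par lev"
    and m: "m \<le> n + n * L"
    by (rule random_tree_obtain[OF b(2-4)])
  interpret level_tree lam n L m par lev by (rule lt)
  have entry: "val_size (VPair (enc_nat (par v)) (VNum (if v = n then 0 else lam ^ lev v))) \<le> m + L * \<Lambda> + 3"
    if "v < m" for v
  proof -
    have "val_size (enc_nat (par v)) \<le> Suc m"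
      using val_size_enc_nat[of "par v"] par_less[OF that] by linarith
    moreover have "val_size (VNum (if v = n then 0 else lam ^ lev v)) \<le> Suc (L * \<Lambda>)"
    proof (rule val_size_VNum_le)
      have "0 \<le> log 2 lam" using lam by simp
      have "\<bar>log 2 \<bar>lam ^ lev v\<bar>\<bar> = real (lev v) * log 2 lam"
        using lam by (simp add: log_nat_power)
      also have "\<dots> \<le> real L * real \<Lambda>"
        unfolding \<Lambda>_def using lev_le[OF that] lam by (intro mult_mono real_nat_ceiling_ge) auto
      \<comment> \<open>The root has weight 0, for which the logarithm is 0 by convention.\<close>
      finally show "\<bar>log 2 \<bar>if v = n then 0 else lam ^ lev v\<bar>\<bar> \<le> real (L * \<Lambda>)"
        by (simp add: log_def)
    qed
    ultimately show ?thesis by (simp del: val_size.simps(2))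
  qed
  define Y where "Y = Z ^ 2"
  have Z1: "1 \<le> Z" using n Z by simp
  have Y: "Z \<le> Y" "1 \<le> Y" using Z1 by (simp_all add: Y_def power2_eq_square)
  have YY: "Y \<le> Y * Y" using Y by simp
  have "n * L \<le> Y" unfolding Y_def power2_eq_square using Z by (intro mult_mono) auto
  then have mY: "m \<le> 2 * Y" using m Z Y by linarith
  have "val_size (enc_wtree t) \<le> Suc n + (m * (m + L * \<Lambda> + 3 + 1) + 1) + 1"
    using val_size_enc_list_le[of "[0..<m]" "\<lambda>v. VPair (enc_nat (par v)) (VNum (if v = n then 0 else lam ^ lev v))"
        "m + L * \<Lambda> + 3"] entry val_size_enc_nat[of n]
    by (simp add: b(1) T enc_wtree_def del: val_size.simps(2))
  also have "\<dots> \<le> m * (m + L * \<Lambda> + 4) + (n + 3)" by simp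
  also have "\<dots> \<le> (2 * Y) * (2 * Y + Y * \<Lambda> + 4 * Y) + 4 * (Y * Y)"
  proof (rule add_mono)
    have "L * \<Lambda> \<le> Y * \<Lambda>" using Z Y by (intro mult_right_mono) auto
    then have "m + L * \<Lambda> + 4 \<le> 2 * Y + Y * \<Lambda> + 4 * Y" using mY Y by linarith
    with mY show "m * (m + L * \<Lambda> + 4) \<le> (2 * Y) * (2 * Y + Y * \<Lambda> + 4 * Y)" by (rule mult_le_mono)
    show "n + 3 \<le> 4 * (Y * Y)" using Z Y YY by linarith
  qed
  also have "\<dots> = (16 + 2 * \<Lambda>) * (Y * Y)" by (simp add: algebra_simps)
  also have "\<dots> \<le> (18 + 2 * \<Lambda>) * (Y * Y)" by (intro mult_right_mono) auto
  also have "Y * Y = Z ^ 4" by (simp add: Y_def power2_eq_square numeral_eq_Suc)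
  finally show ?thesis by (simp add: \<Lambda>_def)
qed

lemma size_hst_instance:
  assumes t: "t \<in> set_pmf (random_hst lam n L s d)" and Z: "L \<le> Z" "val_size (enc_instance enc_metric (n, d, f, N)) \<le> Z"
  shows "val_size (enc_instance (\<lambda>n. enc_wtree) (n, t, f / s, N)) \<le> (22 + 2 * nat \<lceil>log 2 lam\<rceil>) * Z ^ 4"
proof -
  let ?M = "val_size (enc_metric n d)" and ?N = "val_size (enc_list (\<lambda>v. enc_nat (N v)) [0..<n])"
  have x: "?M + val_size (VNum f) + ?N + 2 \<le> Z" using Z(2) by (simp del: val_size.simps(2))
  then have nZ: "n \<le> Z" using size_metric(1) by linarith
  have "\<bar>log 2 \<bar>f / s\<bar>\<bar> \<le> \<bar>log 2 \<bar>f\<bar>\<bar> + \<bar>log 2 s\<bar>"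
  proof (cases "f = 0")
    case False
    then have "log 2 \<bar>f / s\<bar> = log 2 \<bar>f\<bar> - log 2 s" using s by (simp add: abs_divide log_divide)
    then show ?thesis by simp
  qed simp
  also have "\<dots> \<le> real (val_size (VNum f)) + real ?M"
    using abs_log_le_val_size[of f] log_extremes(1) by linarith
  finally have "val_size (VNum (f / s)) \<le> Suc (val_size (VNum f) + ?M)"
    by (intro val_size_VNum_le) simp
  then have "val_size (enc_instance (\<lambda>n. enc_wtree) (n, t, f / s, N)) \<le> val_size (enc_wtree t) + 2 * Z"
    using x by (simp del: val_size.simps(2))
  also have "\<dots> \<le> (18 + 2 * nat \<lceil>log 2 lam\<rceil>) * Z ^ 4 + 2 * Z ^ 4"
  proof (intro add_mono size_random_hst[OF t nZ Z(1)] mult_left_mono)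
    have "1 \<le> Z" using x by linarith
    then show "Z \<le> Z ^ 4" by (intro self_le_power) auto
  qed auto
  also have "\<dots> \<le> (22 + 2 * nat \<lceil>log 2 lam\<rceil>) * Z ^ 4" by (simp add: algebra_simps)
  finally show ?thesis .
qed

end

section \<open>The algorithm for general metrics\<close>

fun reduction :: "real \<Rightarrow> (wtree ufl_instance \<Rightarrow> nat set pmf) \<Rightarrow> (nat \<Rightarrow> nat \<Rightarrow> real) ufl_instance \<Rightarrow> (nat set \<times> wtree) pmf" where
  "reduction lam A (n, d, f, N) = (case extremes n d of (s, D) \<Rightarrow>
     bind_pmf (random_hst lam n (Suc (num_levels (min 2 lam) (D / s))) s d)
       (\<lambda>t. map_pmf (\<lambda>R. (R, t)) (A (n, t, f / s, N))))"

lemma frt_instance: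
  assumes "lam > 1" "(n, d, f, N) \<in> metric_instances"
  obtains s D L where "frt lam (min 2 lam) n L d s D" "f \<ge> 0"
  using assms that by (cases "extremes n d") (auto simp: frt_def metric_instances_def)

lemma (in frt) reduction: "reduction lam A (n, d, f, N) =
    bind_pmf (random_hst lam n L s d) (\<lambda>t. map_pmf (\<lambda>R. (R, t)) (A (n, t, f / s, N)))"
  by (simp add: ext L_def mu_def)

lemma (in frt) hst_instance:
  assumes "t \<in> set_pmf (random_hst lam n L s d)" "f \<ge> 0"
  shows "(n, t, f / s, N) \<in> hst_instances lam"
  unfolding hst_instances_def using n s assms random_hst(1,2)[OF assms(1)] by auto

text \<open>An event about pairs is sliced by the tree. The guarantee holds for each slice, and the
  slices are averaged with weights that do not involve the clients.\<close>

lemma private_reduction: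
  assumes lam: "lam > 1" and A: "private_on (hst_instances lam) \<epsilon> A"
  shows "private_on metric_instances \<epsilon> (reduction lam A)"
  unfolding private_on_def
proof (clarify)
  fix n f N and d :: "nat \<Rightarrow> nat \<Rightarrow> real"
  assume inst: "(n, d, f, N) \<in> metric_instances"
  obtain s D L where F: "frt lam (min 2 lam) n L d s D" and f: "f \<ge> 0"
    by (rule frt_instance[OF lam inst])
  interpret frt lam "min 2 lam" n L d s D by (rule F)
  show "differentially_private \<epsilon> n (\<lambda>N'. reduction lam A (n, d, f, N'))"
    unfolding differentially_private_def
  proof (intro allI impI)
    fix N N' E assume close: "(\<Sum>v<n. \<bar>int (N v) - int (N' v)\<bar>) = 1"
    have "emeasure (reduction lam A (n, d, f, N)) E =
        (\<integral>\<^sup>+t. emeasure (A (n, t, f / s, N)) ((\<lambda>R. (R, t)) -` E) \<partial>random_hst lam n L s d)"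
      unfolding reduction by simp
    also have "\<dots> \<le> (\<integral>\<^sup>+t. ennreal (exp \<epsilon>) * emeasure (A (n, t, f / s, N')) ((\<lambda>R. (R, t)) -` E) \<partial>random_hst lam n L s d)"
    proof (rule nn_integral_mono_AE, rule AE_pmfI)
      fix t assume t: "t \<in> set_pmf (random_hst lam n L s d)"
      have "differentially_private \<epsilon> n (\<lambda>N'. A (n, t, f / s, N'))"
        using A hst_instance[OF t f, of N] unfolding private_on_def by fast
      then have "measure_pmf.prob (A (n, t, f / s, N)) ((\<lambda>R. (R, t)) -` E) \<le>
          exp \<epsilon> * measure_pmf.prob (A (n, t, f / s, N')) ((\<lambda>R. (R, t)) -` E)"
        using close unfolding differentially_private_def by blast
      then show "emeasure (A (n, t, f / s, N)) ((\<lambda>R. (R, t)) -` E) \<le>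
          ennreal (exp \<epsilon>) * emeasure (A (n, t, f / s, N')) ((\<lambda>R. (R, t)) -` E)"
        unfolding measure_pmf.emeasure_eq_measure by (simp add: ennreal_mult'[symmetric] ennreal_leI)
    qed
    also have "\<dots> = ennreal (exp \<epsilon>) * emeasure (reduction lam A (n, d, f, N')) E"
      unfolding reduction by (simp add: nn_integral_cmult)
    finally show "measure_pmf.prob (reduction lam A (n, d, f, N)) E \<le> exp \<epsilon> * measure_pmf.prob (reduction lam A (n, d, f, N')) E"
      unfolding measure_pmf.emeasure_eq_measure by (simp add: ennreal_mult'[symmetric])
  qed
qed

text \<open>Clients connect by the tree metric in both settings, so the opened sets agree and
  domination compares their costs. The tree optimum is bounded by the set that is optimal for
  \<open>d\<close>; as this set does not depend on the tree, its cost can be averaged.\<close>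

lemma ratio_reduction:
  assumes lam: "lam > 1" and inst: "(n, d, f, N) \<in> metric_instances"
    and sub: "\<And>n T f N R. (n, T, f, N) \<in> hst_instances lam \<Longrightarrow> R \<in> set_pmf (A (n, T, f, N)) \<Longrightarrow> R \<subseteq> {..<n}"
    and A: "\<And>n T f N. (n, T, f, N) \<in> hst_instances lam \<Longrightarrow> hst_ratio tie A (n, T, f, N) \<le> ennreal (\<alpha> n)"
  shows "metric_ratio tie (reduction lam A) (n, d, f, N) \<le>
    ennreal (distortion lam n * \<alpha> n)"
proof -
  obtain s D L where F: "frt lam (min 2 lam) n L d s D" and f: "f \<ge> 0"
    by (rule frt_instance[OF lam inst])
  interpret frt lam "min 2 lam" n L d s D by (rule F)
  let ?H = "random_hst lam n L s d"
  obtain S where S: "S \<subseteq> {..<n}" "ufl_opt n d f N = ufl_cost n d f N S" by (rule ufl_opt_attained)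
  have "(\<integral>\<^sup>+(R, t). ufl_cost n d f N (opened tie n (tree_dist t) N R) \<partial>measure_pmf (reduction lam A (n, d, f, N))) =
      (\<integral>\<^sup>+t. \<integral>\<^sup>+R. ufl_cost n d f N (opened tie n (tree_dist t) N R) \<partial>A (n, t, f / s, N) \<partial>?H)"
    unfolding reduction by simp
  also have "\<dots> \<le> (\<integral>\<^sup>+t. ennreal (\<alpha> n) * (ennreal s * ufl_cost n (tree_dist t) (f / s) N S) \<partial>?H)"
  proof (rule nn_integral_mono_AE, rule AE_pmfI)
    fix t assume t: "t \<in> set_pmf ?H"
    have hst: "(n, t, f / s, N) \<in> hst_instances lam" by (rule hst_instance[OF t f])
    let ?X = "\<integral>\<^sup>+R. ufl_cost n (tree_dist t) (f / s) N (opened tie n (tree_dist t) N R) \<partial>A (n, t, f / s, N)"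
    have "(\<integral>\<^sup>+R. ufl_cost n d f N (opened tie n (tree_dist t) N R) \<partial>A (n, t, f / s, N)) \<le>
        (\<integral>\<^sup>+R. ennreal s * ufl_cost n (tree_dist t) (f / s) N (opened tie n (tree_dist t) N R) \<partial>A (n, t, f / s, N))"
    proof (rule nn_integral_mono_AE, rule AE_pmfI)
      fix R assume "R \<in> set_pmf (A (n, t, f / s, N))"
      then have "opened tie n (tree_dist t) N R \<subseteq> {..<n}" using sub[OF hst] by (auto simp: opened_def)
      then show "ufl_cost n d f N (opened tie n (tree_dist t) N R) \<le>
          ennreal s * ufl_cost n (tree_dist t) (f / s) N (opened tie n (tree_dist t) N R)"
        by (rule ufl_cost_random_hst[OF t])
    qed
    also have "\<dots> = ennreal s * ?X" by (simp add: nn_integral_cmult)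
    also have "?X \<le> ennreal (\<alpha> n) * ufl_opt n (tree_dist t) (f / s) N"
      using A[OF hst] by (intro ratio_leD ufl_opt_finite) auto
    also have "\<dots> \<le> ennreal (\<alpha> n) * ufl_cost n (tree_dist t) (f / s) N S"
      by (intro mult_left_mono ufl_opt_le S) simp
    finally show "(\<integral>\<^sup>+R. ufl_cost n d f N (opened tie n (tree_dist t) N R) \<partial>A (n, t, f / s, N)) \<le>
        ennreal (\<alpha> n) * (ennreal s * ufl_cost n (tree_dist t) (f / s) N S)"
      by (simp add: mult_left_mono mult.left_commute)
  qed
  also have "\<dots> = ennreal (\<alpha> n) * (\<integral>\<^sup>+t. ennreal s * ufl_cost n (tree_dist t) (f / s) N S \<partial>?H)"
    by (simp add: nn_integral_cmult)
  also have "\<dots> \<le> ennreal (\<alpha> n) * (ennreal (distortion lam n) * ufl_cost n d f N S)"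
    by (intro mult_left_mono expected_ufl_cost S) simp
  also have "\<dots> = ennreal (distortion lam n * \<alpha> n) * ufl_opt n d f N"
  proof -
    \<comment> \<open>\<open>\<alpha> n\<close> may be negative; both sides are then 0.\<close>
    have "ennreal (distortion lam n * \<alpha> n) = ennreal (distortion lam n) * ennreal (\<alpha> n)"
      using distortion_ge_1 by (intro ennreal_mult') simp
    then show ?thesis by (simp add: S(2) mult_ac)
  qed
  finally show ?thesis
    unfolding metric_ratio.simps by (intro ratio_leI ufl_opt_finite)
qed

lemma is_wtree_reduction:
  assumes "is_hst lam L T" "leaves T = {..<n}" "1 \<le> n"
  shows "is_wtree T" "n \<le> num_vertices T"
proof -
  show "is_wtree T" using assms by (simp add: is_hst_def)
  have "n - 1 \<in> leaves T" using assms by simp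
  then have "n - 1 < num_vertices T" unfolding leaves_def by blast
  then show "n \<le> num_vertices T" by simp
qed

lemma efficient_reduction:
  assumes lam: "lam > 1" and A: "efficient_hst_algorithm lam A"
  shows "efficient_metric_algorithm (reduction lam A)"
proof -
  have sub: "R \<subseteq> {..<n}" if "(n, T, f, N) \<in> hst_instances lam" "R \<in> set_pmf (A (n, T, f, N))" for n T f N R
    using A that unfolding efficient_hst_algorithm_def by fast
  have "polytime (hst_instances lam) (enc_instance (\<lambda>n. enc_wtree)) enc_set A"
    using A by (simp only: efficient_hst_algorithm_def)
  then obtain P c k where P: "\<forall>x\<in>hst_instances lam.
      yields (run P (enc_instance (\<lambda>n. enc_wtree) x)) (map_pmf enc_set (A x)) (c * val_size (enc_instance (\<lambda>n. enc_wtree) x) ^ k)"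
    unfolding polytime_def yields_iff[symmetric] by (elim exE)
  note P = P[rule_format]
  \<comment> \<open>\<open>C1\<close> bounds the depth per unit of input size, \<open>C2\<close> the
    size of the tree instance per \<open>Z ^ 4\<close>. A given program of degree \<open>k\<close>
    therefore contributes degree \<open>4 * k\<close>, and the construction of the tree adds degree
    4.\<close>
  define C1 where "C1 = 2 + nat \<lceil>2 / log 2 (min 2 lam)\<rceil>"
  define C2 where "C2 = 22 + 2 * nat \<lceil>log 2 lam\<rceil>"
  define c' where "c' = (c * C2 ^ k + 3000) * C1 ^ (4 * k + 4)"
  have yld: "yields (run (reduction_prog lam (min 2 lam) P) (enc_instance enc_metric x))
      (map_pmf (\<lambda>(R, T). VPair (enc_set R) (enc_wtree T)) (reduction lam A x))
      (c' * val_size (enc_instance enc_metric x) ^ (4 * k + 4))"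
    if "x \<in> metric_instances" for x
  proof -
    obtain n d f N where x: "x = (n, d, f, N)" by (cases x)
    have inst: "(n, d, f, N) \<in> metric_instances" using that by (simp add: x)
    obtain s D L where F: "frt lam (min 2 lam) n L d s D" and f: "f \<ge> 0"
      by (rule frt_instance[OF lam inst])
    interpret frt lam "min 2 lam" n L d s D by (rule F)
    interpret Metric_space "{..<n}" d by (rule metric)
    define X where "X = val_size (enc_instance enc_metric x)"
    define Z where "Z = C1 * X"
    have M: "val_size (enc_metric n d) \<le> X" by (simp add: X_def x)
    have XZ: "X \<le> Z" by (simp add: Z_def C1_def)
    have nZ: "n \<le> Z" using size_metric(1) M XZ by linarith
    have LZ: "L \<le> Z" using L_le[OF M] by (simp add: Z_def C1_def)
    have Z1: "1 \<le> Z" using n nZ by simp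
    let ?N = "enc_list (\<lambda>v. enc_nat (N v)) [0..<n]"
    have yP: "yields (run P (VPair (enc_wtree (T b \<pi>)) (VPair (VNum (f / s)) ?N)))
        (map_pmf enc_set (A (n, T b \<pi>, f / s, N))) (c * (C2 * Z ^ 4) ^ k)"
      if b: "b \<in> set_pmf (random_bits (L - 1))" and \<pi>: "\<pi> \<in> permutations_of_set {..<n}" for b \<pi>
    proof -
      have t: "T b \<pi> \<in> set_pmf (random_hst lam n L s d)"
        using b \<pi> by (auto simp: random_hst_def)
      have "val_size (enc_instance (\<lambda>n. enc_wtree) (n, T b \<pi>, f / s, N)) \<le> C2 * Z ^ 4"
        unfolding C2_def by (rule size_hst_instance[OF t LZ]) (use XZ in \<open>simp only: X_def x\<close>)
      then have "c * val_size (enc_instance (\<lambda>n. enc_wtree) (n, T b \<pi>, f / s, N)) ^ k \<le> c * (C2 * Z ^ 4) ^ k"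
        by (intro mult_left_mono power_mono) auto
      from yields_mono[OF P[OF hst_instance[OF t f, of N]] this refl] show ?thesis by simp
    qed
    have "yields (run (reduction_prog lam (min 2 lam) P) (VPair (enc_metric n d) (VPair (VNum f) ?N)))
      (bind_pmf (random_bits (L - 1)) (\<lambda>b. bind_pmf (random_perm n)
        (\<lambda>\<pi>. map_pmf (\<lambda>v. VPair v (enc_wtree (T b \<pi>))) (map_pmf enc_set (A (n, T b \<pi>, f / s, N))))))
      (c * (C2 * Z ^ 4) ^ k + 3000 * Z ^ 4)"
      by (rule yields_reduction[OF lam mu ext s L_def nZ LZ n _ yP]) simp_all
    then show ?thesis unfolding x enc_instance.simps
    proof (rule yields_mono)
      have "c * (C2 * Z ^ 4) ^ k = c * C2 ^ k * Z ^ (4 * k)" by (simp add: power_mult_distrib power_mult)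
      also have "\<dots> \<le> c * C2 ^ k * Z ^ (4 * k + 4)" using Z1 by (intro mult_left_mono power_increasing) auto
      finally have "c * (C2 * Z ^ 4) ^ k + 3000 * Z ^ 4 \<le> c * C2 ^ k * Z ^ (4 * k + 4) + 3000 * Z ^ (4 * k + 4)"
        using Z1 by (intro add_mono mult_left_mono power_increasing) auto
      also have "\<dots> = c' * X ^ (4 * k + 4)"
        by (simp add: c'_def Z_def power_mult_distrib algebra_simps)
      finally show "c * (C2 * Z ^ 4) ^ k + 3000 * Z ^ 4 \<le>
          c' * val_size (VPair (enc_metric n d) (VPair (VNum f) ?N)) ^ (4 * k + 4)"
        by (simp only: X_def x enc_instance.simps)
      show "bind_pmf (random_bits (L - 1)) (\<lambda>b. bind_pmf (random_perm n)
          (\<lambda>\<pi>. map_pmf (\<lambda>v. VPair v (enc_wtree (T b \<pi>))) (map_pmf enc_set (A (n, T b \<pi>, f / s, N))))) =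
        map_pmf (\<lambda>(R, T). VPair (enc_set R) (enc_wtree T)) (reduction lam A (n, d, f, N))"
        unfolding reduction random_hst_def
        by (simp add: map_bind_pmf bind_map_pmf bind_assoc_pmf pmf.map_comp o_def)
    qed
  qed
  have range: "R \<subseteq> {..<n} \<and> is_wtree T \<and> n \<le> num_vertices T"
    if inst: "(n, d, f, N) \<in> metric_instances" and "(R, T) \<in> set_pmf (reduction lam A (n, d, f, N))" for n d f N R T
  proof -
    obtain s D L where F: "frt lam (min 2 lam) n L d s D" and f: "f \<ge> 0"
      by (rule frt_instance[OF lam inst])
    interpret frt lam "min 2 lam" n L d s D by (rule F)
    from that(2) have T: "T \<in> set_pmf (random_hst lam n L s d)" "R \<in> set_pmf (A (n, T, f / s, N))"
      unfolding reduction by auto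
    show ?thesis
      using sub[OF hst_instance[OF T(1) f] T(2)] is_wtree_reduction[OF random_hst(1,2)[OF T(1)] n] by auto
  qed
  have "\<forall>x\<in>metric_instances. yields (run (reduction_prog lam (min 2 lam) P) (enc_instance enc_metric x))
      (map_pmf (\<lambda>(R, T). VPair (enc_set R) (enc_wtree T)) (reduction lam A x))
      (c' * val_size (enc_instance enc_metric x) ^ (4 * k + 4))"
    using yld by (rule ballI)
  then have "polytime metric_instances (enc_instance enc_metric)
      (\<lambda>(R, T). VPair (enc_set R) (enc_wtree T)) (reduction lam A)"
    unfolding polytime_def yields_iff by (intro exI)
  moreover have "\<forall>(n, d, f, N)\<in>metric_instances. \<forall>(R, T)\<in>set_pmf (reduction lam A (n, d, f, N)).
      R \<subseteq> {..<n} \<and> is_wtree T \<and> n \<le> num_vertices T"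
  proof (rule ballI)
    fix x assume x: "x \<in> metric_instances"
    obtain n d f N where e: "x = (n, d, f, N)" by (cases x)
    show "case x of (n, d, f, N) \<Rightarrow> \<forall>(R, T)\<in>set_pmf (reduction lam A (n, d, f, N)).
        R \<subseteq> {..<n} \<and> is_wtree T \<and> n \<le> num_vertices T"
      unfolding e prod.case
    proof (rule ballI)
      fix y assume y: "y \<in> set_pmf (reduction lam A (n, d, f, N))"
      obtain R T where "y = (R, T)" by (cases y)
      with range[of n d f N R T] x y show "case y of (R, T) \<Rightarrow> R \<subseteq> {..<n} \<and> is_wtree T \<and> n \<le> num_vertices T"
        unfolding e by (simp only: prod.case)
    qed
  qed
  ultimately show ?thesis unfolding efficient_metric_algorithm_def by (rule conjI[rotated])
qed

section \<open>Logarithmic growth of the distortion\<close>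

lemma harm_le_ln: "1 \<le> n \<Longrightarrow> harm n \<le> 1 + ln (real n)"
  \<comment> \<open>The difference of harmonic number and logarithm decreases, and it is 1 at
    \<open>n = 1\<close>.\<close>
  using decseqD[OF decseq_harm_diff_ln, of 0 "n - 1"] by (simp add: harm_def)

lemma harm_bigo_ln: "(\<lambda>n. a + b * harm n :: real) \<in> O(\<lambda>n. ln (real n))"
proof (rule bigoI[of _ "\<bar>a\<bar> + 2 * \<bar>b\<bar>"], rule eventually_sequentiallyI[of 3])
  fix n :: nat assume n: "3 \<le> n"
  \<comment> \<open>The threshold 3 exceeds \<open>exp 1\<close>, so \<open>ln n \<ge> 1\<close>
    absorbs the additive constants.\<close>
  have "exp 1 \<le> real n" using exp_le n by linarith
  then have ln: "1 \<le> ln (real n)" using ln_ge_iff[of "real n" 1] n by simp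
  have "harm n \<le> 2 * ln (real n)" using harm_le_ln[of n] n ln by linarith
  then have "\<bar>b\<bar> * harm n \<le> \<bar>b\<bar> * (2 * ln (real n))" by (rule mult_left_mono) simp
  moreover have "\<bar>a\<bar> * 1 \<le> \<bar>a\<bar> * ln (real n)" using ln by (intro mult_left_mono) auto
  moreover have "\<bar>a + b * harm n\<bar> \<le> \<bar>a\<bar> + \<bar>b\<bar> * harm n"
    using abs_triangle_ineq[of a "b * harm n"] harm_nonneg[of n, where 'a = real] by (simp add: abs_mult)
  ultimately show "norm (a + b * harm n) \<le> (\<bar>a\<bar> + 2 * \<bar>b\<bar>) * norm (ln (real n))"
    using ln by (simp add: algebra_simps)
qed

theorem theorem1:
  fixes lam :: real
  assumes "lam > 1"
  shows "\<exists>g :: nat \<Rightarrow> real. g \<in> O(\<lambda>n. ln (real n)) \<and>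
    (\<forall>(\<epsilon> :: real) (\<alpha>_tree :: nat \<Rightarrow> real \<Rightarrow> real) tie. \<epsilon> > 0 \<longrightarrow> tie_rule tie \<longrightarrow>
      (\<exists>A. efficient_hst_algorithm lam A \<and> private_on (hst_instances lam) \<epsilon> A \<and>
        (\<forall>(n, T, f, N)\<in>hst_instances lam.
           hst_ratio tie A (n, T, f, N) \<le> ennreal (\<alpha>_tree n \<epsilon>))) \<longrightarrow>
      (\<exists>B. efficient_metric_algorithm B \<and> private_on metric_instances \<epsilon> B \<and>
        (\<forall>(n, d, f, N)\<in>metric_instances.
           metric_ratio tie B (n, d, f, N) \<le> ennreal (g n * \<alpha>_tree n \<epsilon>))))"
\<comment> \<open>The factor is fixed before \<open>\<epsilon>\<close>, the tree ratio and the
  tie-breaking rule; besides \<open>n\<close> it depends on \<open>lam\<close> alone.\<close>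
proof (intro exI[of _ "distortion lam"] conjI allI impI)
  show "distortion lam \<in> O(\<lambda>n. ln (real n))"
    unfolding distortion_def[abs_def] by (rule harm_bigo_ln)
  fix \<epsilon> :: real and \<alpha>_tree :: "nat \<Rightarrow> real \<Rightarrow> real" and tie
  assume "\<exists>A. efficient_hst_algorithm lam A \<and> private_on (hst_instances lam) \<epsilon> A \<and>
        (\<forall>(n, T, f, N)\<in>hst_instances lam.
           hst_ratio tie A (n, T, f, N) \<le> ennreal (\<alpha>_tree n \<epsilon>))"
  then obtain A where A: "efficient_hst_algorithm lam A" "private_on (hst_instances lam) \<epsilon> A"
      "\<And>n T f N. (n, T, f, N) \<in> hst_instances lam \<Longrightarrow> hst_ratio tie A (n, T, f, N) \<le> ennreal (\<alpha>_tree n \<epsilon>)"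
    by fast
  have sub: "R \<subseteq> {..<n}" if "(n, T, f, N) \<in> hst_instances lam" "R \<in> set_pmf (A (n, T, f, N))" for n T f N R
    using A(1) that unfolding efficient_hst_algorithm_def by fast
  have "metric_ratio tie (reduction lam A) (n, d, f, N) \<le>
      ennreal (distortion lam n * \<alpha>_tree n \<epsilon>)"
    if "(n, d, f, N) \<in> metric_instances" for n d f N
    by (rule ratio_reduction[where \<alpha> = "\<lambda>n. \<alpha>_tree n \<epsilon>", OF assms that])
      (rule sub, assumption+, rule A(3), assumption)
  then show "\<exists>B. efficient_metric_algorithm B \<and> private_on metric_instances \<epsilon> B \<and>
        (\<forall>(n, d, f, N)\<in>metric_instances. metric_ratio tie B (n, d, f, N) \<le>
          ennreal (distortion lam n * \<alpha>_tree n \<epsilon>))"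
    using efficient_reduction[OF assms A(1)] private_reduction[OF assms A(2)]
    by (intro exI[of _ "reduction lam A"]) blast
qed

end
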